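(* Let $h\ge0$, $\beta>0$, and consider the GREM with external field $\{X_N(h,\sigma)\}_{\sigma\in\Sigma_N}$ with $n$-step discrete order parameter $\varrho$, its partition function $Z_N(\beta,h)=\sum_{\sigma\in\Sigma_N}\exp[\beta\sqrt N X_N(h,\sigma)]$ and free energy $p_N(\beta,h)=\frac1N\log Z_N(\beta,h)$, and the coarse-grained parameters $J_l,\bar q_l,\bar x_l,\bar\theta_l,\bar\gamma_l$ ($1\le l\le m$) defined in the context. Let $l(\beta,h)=\max\{l\in\{1,\dots,m\}:\beta\bar\gamma_l>1\}$, with $l(\beta,h)=0$ if $\beta\bar\gamma_1\le1$. Then $$\lim_{N\to\infty}p_N(\beta,h)=\beta\sum_{l=1}^{l(\beta,h)}\Big[(\bar x_l\bar q_l)^{1/2}\rho\big(t_*(\bar\theta_l^{-1/2}h)\big)+h\,\bar x_l\,t_*(\bar\theta_l^{-1/2}h)\Big]+\log2+\log\cosh\Big(\beta h\big(1-x_{J_{l(\beta,h)}}\big)\Big)+\tfrac12\beta^2\big(1-q_{J_{l(\beta,h)}}\big)$$ almost surely and in $L^1$.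
   Context: All random variables are defined on one probability space. Model. $\Sigma_N=\{-1,1\}^N$. Fix $n\ge1$ and $0=x_0<x_1<\dots<x_n=1$, $0=q_0<q_1<\dots<q_n=1$. Let $\varrho:[0,1]\to[0,1]$ be the step function with $\varrho=q_k$ on $[x_k,x_{k+1})$ for $0\le k<n$ and $\varrho(1)=1$. Only $N$ with $x_kN\in\mathbb N$ for all $k\ge1$ are considered ($N\to\infty$ along such $N$). The lexicographic overlap is $q_L(\sigma,\tau)=\frac1N\max\{k\in\{0,\dots,N\}:\sigma_i=\tau_i\ \forall i\le k\}$. $\{\mathrm{GREM}_N(\sigma)\}_{\sigma\in\Sigma_N}$ is the centered Gaussian process with covariance $\varrho(q_L(\sigma,\tau))$, and $X_N(h,\sigma)=\mathrm{GREM}_N(\sigma)+\frac{h}{\sqrt N}\sum_{i=1}^N\sigma_i$. REM quantities. $I(t)=\frac12[(1-t)\log(1-t)+(1+t)\log(1+t)]$ on $[-1,1]$; $\rho(t)=\sqrt{2(\log2-I(t))}$; for $h\ge0$, $t_*(h)$ is the unique maximizer of $t\mapsto\rho(t)+ht$ on $[-1,1]$. Coarse-graining. For $1\le j\le k\le n$, $\theta_{j,k}=\frac{q_k-q_{j-1}}{x_k-x_{j-1}}$ and $\widetilde\theta_{j,k}(h)=\theta_{j,k}\,\rho\big(t_*(\theta_{j,k}^{-1/2}h)\big)^{-2}$. Set $J_0=0$ and, as long as $J_{l-1}<n$, $$J_l=\min\{J\in\{J_{l-1}+1,\dots,n\}:\widetilde\theta_{J_{l-1}+1,J}(h)>\widetilde\theta_{J+1,k}(h)\text{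 for all }k\in\{J+1,\dots,n\}\}.$$ The procedure stops with $J_m=n$; $m=m(h)\le n$. For $1\le l\le m$: $\bar q_l=q_{J_l}-q_{J_{l-1}}$, $\bar x_l=x_{J_l}-x_{J_{l-1}}$, $\bar\theta_l=\theta_{J_{l-1}+1,J_l}$, $\bar\gamma_l=\widetilde\theta_{J_{l-1}+1,J_l}(h)^{1/2}$ (these form a decreasing sequence, $\bar\gamma_1>\dots>\bar\gamma_m$).
   Formalization: The printed term log 2 + log cosh(βh(1−x_J)) is false (n=1, h=0, β>√(2 log 2)); with J=J_{l(β,h)} it is replaced by (1−x_J)(log 2 + log cosh(βh)), which agrees with the printed form when l(β,h)=0. *)

theory Defs
  imports "HOL-Probability.Probability"
begin

definition spin_configs :: "nat \<Rightarrow> (nat \<Rightarrow> real) set" where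
  "spin_configs N = {1..N} \<rightarrow>\<^sub>E {-1, 1}"

definition lex_overlap :: "nat \<Rightarrow> (nat \<Rightarrow> real) \<Rightarrow> (nat \<Rightarrow> real) \<Rightarrow> real" where
  "lex_overlap N \<sigma> \<tau> = real (Max {k \<in> {0..N}. \<forall>i\<in>{1..k}. \<sigma> i = \<tau> i}) / real N"

text \<open>Only arguments in $[0,1]$ are meaningful.\<close>

definition order_param :: "nat \<Rightarrow> (nat \<Rightarrow> real) \<Rightarrow> (nat \<Rightarrow> real) \<Rightarrow> real \<Rightarrow> real" where
  "order_param n x q t =
     (if t = 1 then 1 else q (THE k. k < n \<and> x k \<le> t \<and> t < x (Suc k)))"

definition admissible_sizes :: "nat \<Rightarrow> (nat \<Rightarrow> real) \<Rightarrow> nat set" where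
  "admissible_sizes n x = {N. 1 \<le> N \<and> (\<forall>k\<in>{1..n}. x k * real N \<in> \<nat>)}"

text \<open>The filter for $N \to \infty$ along the admissible sizes.\<close>

definition admissible_at_top :: "nat \<Rightarrow> (nat \<Rightarrow> real) \<Rightarrow> nat filter" where
  "admissible_at_top n x = inf sequentially (principal (admissible_sizes n x))"

text \<open>The centered normal law with variance \<open>v\<close>, which is the Dirac measure at 0 if \<open>v = 0\<close>.\<close>

definition centered_normal :: "real \<Rightarrow> real measure" where
  "centered_normal v =
     (if v = 0 then return borel 0 else density lborel (normal_density 0 (sqrt v)))"

definition centered_gaussian_process ::
    "'w measure \<Rightarrow> 'i set \<Rightarrow> ('i \<Rightarrow> 'w \<Rightarrow> real) \<Rightarrow> bool" where
  "centered_gaussian_process M S X \<longleftrightarrow>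
     (\<forall>s\<in>S. X s \<in> borel_measurable M) \<and>
     (\<forall>T c. finite T \<and> T \<subseteq> S \<longrightarrow>
        (\<exists>v\<ge>0. distr M borel (\<lambda>\<omega>. \<Sum>s\<in>T. c s * X s \<omega>) = centered_normal v))"

definition is_GREM ::
    "'w measure \<Rightarrow> nat \<Rightarrow> (nat \<Rightarrow> real) \<Rightarrow> (nat \<Rightarrow> real) \<Rightarrow> nat
      \<Rightarrow> ((nat \<Rightarrow> real) \<Rightarrow> 'w \<Rightarrow> real) \<Rightarrow> bool" where
  "is_GREM M n x q N G \<longleftrightarrow>
     centered_gaussian_process M (spin_configs N) G \<and>
     (\<forall>\<sigma>\<in>spin_configs N. \<forall>\<tau>\<in>spin_configs N.
        (\<integral>\<omega>. G \<sigma> \<omega> * G \<tau> \<omega> \<partial>M) = order_param n x q (lex_overlap N \<sigma> \<tau>))"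

definition field_process ::
    "nat \<Rightarrow> ((nat \<Rightarrow> real) \<Rightarrow> 'w \<Rightarrow> real) \<Rightarrow> real \<Rightarrow> (nat \<Rightarrow> real) \<Rightarrow> 'w \<Rightarrow> real" where
  "field_process N G h \<sigma> \<omega> = G \<sigma> \<omega> + h / sqrt (real N) * (\<Sum>i=1..N. \<sigma> i)"

definition partition_function ::
    "nat \<Rightarrow> ((nat \<Rightarrow> real) \<Rightarrow> 'w \<Rightarrow> real) \<Rightarrow> real \<Rightarrow> real \<Rightarrow> 'w \<Rightarrow> real" where
  "partition_function N G \<beta> h \<omega> =
     (\<Sum>\<sigma>\<in>spin_configs N. exp (\<beta> * sqrt (real N) * field_process N G h \<sigma> \<omega>))"

definition free_energy ::
    "nat \<Rightarrow> ((nat \<Rightarrow> real) \<Rightarrow> 'w \<Rightarrow> real) \<Rightarrow> real \<Rightarrow> real \<Rightarrow> 'w \<Rightarrow> real" where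
  "free_energy N G \<beta> h \<omega> = ln (partition_function N G \<beta> h \<omega>) / real N"

text \<open>At the end points \<open>t = 1\<close> and \<open>t = -1\<close> the convention $0 \log 0 = 0$ holds automatically.\<close>

definition rate_I :: "real \<Rightarrow> real" where
  "rate_I t = ((1 - t) * ln (1 - t) + (1 + t) * ln (1 + t)) / 2"

definition rho :: "real \<Rightarrow> real" where
  "rho t = sqrt (2 * (ln 2 - rate_I t))"

definition t_star :: "real \<Rightarrow> real" where
  "t_star h = (THE t. is_arg_max (\<lambda>s. rho s + h * s) (\<lambda>s. s \<in> {-1..1}) t)"

definition theta :: "(nat \<Rightarrow> real) \<Rightarrow> (nat \<Rightarrow> real) \<Rightarrow> nat \<Rightarrow> nat \<Rightarrow> real" where
  "theta x q j k = (q k - q (j - 1)) / (x k - x (j - 1))"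

definition theta_tilde ::
    "(nat \<Rightarrow> real) \<Rightarrow> (nat \<Rightarrow> real) \<Rightarrow> real \<Rightarrow> nat \<Rightarrow> nat \<Rightarrow> real" where
  "theta_tilde x q h j k = theta x q j k / (rho (t_star (h / sqrt (theta x q j k))))\<^sup>2"

text \<open>The procedure stops when it reaches \<open>n\<close>; beyond that point the sequence is continued by
  the dummy value \<open>n\<close>.\<close>

primrec block_end ::
    "nat \<Rightarrow> (nat \<Rightarrow> real) \<Rightarrow> (nat \<Rightarrow> real) \<Rightarrow> real \<Rightarrow> nat \<Rightarrow> nat" where
  "block_end n x q h 0 = 0"
| "block_end n x q h (Suc l) =
     (if block_end n x q h l < n
      then Min {J \<in> {block_end n x q h l + 1..n}.
                  \<forall>k\<in>{J + 1..n}.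
                    theta_tilde x q h (block_end n x q h l + 1) J > theta_tilde x q h (J + 1) k}
      else n)"

definition num_blocks :: "nat \<Rightarrow> (nat \<Rightarrow> real) \<Rightarrow> (nat \<Rightarrow> real) \<Rightarrow> real \<Rightarrow> nat" where
  "num_blocks n x q h = (LEAST l. block_end n x q h l = n)"

definition q_bar :: "nat \<Rightarrow> (nat \<Rightarrow> real) \<Rightarrow> (nat \<Rightarrow> real) \<Rightarrow> real \<Rightarrow> nat \<Rightarrow> real" where
  "q_bar n x q h l = q (block_end n x q h l) - q (block_end n x q h (l - 1))"

definition x_bar :: "nat \<Rightarrow> (nat \<Rightarrow> real) \<Rightarrow> (nat \<Rightarrow> real) \<Rightarrow> real \<Rightarrow> nat \<Rightarrow> real" where
  "x_bar n x q h l = x (block_end n x q h l) - x (block_end n x q h (l - 1))"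

definition theta_bar :: "nat \<Rightarrow> (nat \<Rightarrow> real) \<Rightarrow> (nat \<Rightarrow> real) \<Rightarrow> real \<Rightarrow> nat \<Rightarrow> real" where
  "theta_bar n x q h l =
     theta x q (block_end n x q h (l - 1) + 1) (block_end n x q h l)"

definition gamma_bar :: "nat \<Rightarrow> (nat \<Rightarrow> real) \<Rightarrow> (nat \<Rightarrow> real) \<Rightarrow> real \<Rightarrow> nat \<Rightarrow> real" where
  "gamma_bar n x q h l =
     sqrt (theta_tilde x q h (block_end n x q h (l - 1) + 1) (block_end n x q h l))"

definition frozen_blocks ::
    "nat \<Rightarrow> (nat \<Rightarrow> real) \<Rightarrow> (nat \<Rightarrow> real) \<Rightarrow> real \<Rightarrow> real \<Rightarrow> nat" where
  "frozen_blocks n x q \<beta> h =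
     (if \<beta> * gamma_bar n x q h 1 \<le> 1 then 0
      else Max {l \<in> {1..num_blocks n x q h}. \<beta> * gamma_bar n x q h l > 1})"

text \<open>The summand for the unfrozen spins is $(1 - x_J)(\log 2 + \log\cosh(\beta h))$ with
  $J = J_{l(\beta,h)}$.  The form $\log 2 + \log\cosh(\beta h (1 - x_J))$, also found, is false
  whenever $h = 0$ and $J > 0$: for \<open>n = 1\<close>, \<open>h = 0\<close> and $\beta > \beta_c = \sqrt{2 \log 2}$ one has
  $Z_N(\beta) \le Z_N(\beta_c)^{\beta / \beta_c}$, hence by Jensen
  $E\, p_N(\beta) \le \beta \sqrt{2 \log 2}$, whereas that form exceeds this bound by $\log 2$.\<close>

definition limit_free_energy ::
    "nat \<Rightarrow> (nat \<Rightarrow> real) \<Rightarrow> (nat \<Rightarrow> real) \<Rightarrow> real \<Rightarrow> real \<Rightarrow> real" where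
  "limit_free_energy n x q \<beta> h =
     (let L = frozen_blocks n x q \<beta> h; J = block_end n x q h L in
      \<beta> * (\<Sum>l=1..L.
             sqrt (x_bar n x q h l * q_bar n x q h l)
               * rho (t_star (h / sqrt (theta_bar n x q h l)))
             + h * x_bar n x q h l * t_star (h / sqrt (theta_bar n x q h l)))
      + (1 - x J) * (ln 2 + ln (cosh (\<beta> * h)))
      + \<beta>\<^sup>2 * (1 - q J) / 2)"

end

theory Submission
  imports Defs "HOL-Real_Asymp.Real_Asymp"
begin

text \<open>
  With \<open>ent u = ln (2 * cosh u) - u * tanh u\<close>, the entropy per spin of spins tilted by \<open>u\<close>,
  \<open>t_star (h / sqrt (theta x q j k)) = tanh (l * h)\<close>, where \<open>l = 1 / sqrt (theta_tilde x q h j k)\<close>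
  is the tilt at which the levels \<open>j,\<dots>,k\<close> together run out of entropy
  (\<open>excess j k l = 0\<close>).  The coarse-graining selects tilts \<open>l 1 \<le> \<dots> \<le> l n \<le> \<beta>\<close> for which all partial sums of the level entropies are nonnegative
  and complementary slackness \<open>(\<Sum>k. (\<beta> / l k - 1) * excess k k (l k)) = 0\<close> holds.

  The GREM has the law of a sum of independent Gaussians along the branches of a tree.  For the
  upper bound let \<open>R k\<close> be the sum over the level-\<open>k\<close> nodes of the Boltzmann weights to the power
  \<open>m k = l k / \<beta>\<close>.  Averaging \<open>R k\<close> over level \<open>k\<close> leaves a constant times the same sum on level
  \<open>k - 1\<close>, which is at most \<open>R (k - 1)\<close> to the power \<open>m k / m (k - 1)\<close>; Markov's inequality on each
  level gives \<open>p_N \<le> limit + \<epsilon>\<close> up to exponentially small probability.  For the lower bound one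
  counts the branches on which each level has the magnetization and the energy of the tilt
  \<open>(1 - \<delta>) * l k\<close>; then all partial sums of the entropies are positive and the relative variance of
  the count is exponentially small.  Slackness makes the two bounds agree, and exponentially small
  deviation probabilities give almost sure convergence by Borel--Cantelli and,
  since the second moments of the free energies are bounded, convergence in mean.
\<close>

section \<open>The entropy and the maximizer \<open>t_star\<close>\<close>

text \<open>The mean of the partition function is too large at low temperature, being carried by
  rare events; exponents below one damp these, and each level needs its own exponent. A level then
  enters the upper bound with its entropy multiplied by \<open>\<beta> / l k\<close>, but the lower
  bound with factor one, so slackness is exactly the condition that the two values coincide. In the
  other direction the total entropy alone does not decide: branches that agree up to level
  \<open>k\<close> share their Gaussians, and the relative variance contains the inverse expected
  number of surviving nodes of each level. Hence the condition on every partial sum. At the chosen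
  tilts these sums may be zero, as at the end of a frozen block, and the factor
  \<open>1 - \<delta>\<close> buys strict positivity at a small loss of value.

  The GREM is given only by its covariance, on a space that need not carry a tree of independent
  variables. The deviation estimates are therefore made on a product space, and for each
  \<open>N\<close> the law of the free energy is carried over. The joint law for different
  \<open>N\<close> is left open, so almost sure convergence has to come from summable
  probabilities.\<close>

definition ent :: "real \<Rightarrow> real" where
  "ent u = ln (2 * cosh u) - u * tanh u"

text \<open>One term of a relative entropy: multiply \<open>ln z \<le> z - 1\<close> at
  \<open>z = r / p\<close> by \<open>- p\<close>. Keeping \<open>p * ln p - p * ln r\<close> instead
  of \<open>ln (p / r)\<close> admits \<open>p = 0\<close>, hence the end points of [-1, 1]
  below.\<close>

lemma kl_term_ge:
  fixes p r :: real
  assumes "0 \<le> p" "0 < r"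
  shows "p - r \<le> p * ln p - p * ln r"
    and "p \<noteq> r \<Longrightarrow> p - r < p * ln p - p * ln r"
proof -
  have *: "p - r \<le> p * ln p - p * ln r \<and> (p \<noteq> r \<longrightarrow> p - r < p * ln p - p * ln r)"
  proof (cases "p = 0")
    case False
    then have p: "0 < p" using assms by simp
    have le: "ln (r / p) \<le> r / p - 1" using p assms by (intro ln_le_minus_one) simp
    have ne: "ln (r / p) \<noteq> r / p - 1" if "p \<noteq> r"
      using ln_eq_minus_one[of "r / p"] p assms that by (auto simp: field_simps)
    have eq: "p * ln p - p * ln r = - (p * ln (r / p))"
      using p assms by (simp add: ln_div algebra_simps)
    have eq2: "p - r = - (p * (r / p - 1))" using p by (simp add: field_simps)
    have 1: "p - r \<le> p * ln p - p * ln r"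
      unfolding eq eq2 using le p by simp
    have 2: "p - r < p * ln p - p * ln r" if "p \<noteq> r"
    proof -
      have "ln (r / p) < r / p - 1" using le ne[OF that] by simp
      then show ?thesis unfolding eq eq2 using p by simp
    qed
    show ?thesis using 1 2 by simp
  qed (use assms in simp)
  from * show "p - r \<le> p * ln p - p * ln r" by simp
  from * show "p \<noteq> r \<Longrightarrow> p - r < p * ln p - p * ln r" by simp
qed

lemma one_plus_tanh: "1 + tanh u = exp u / cosh (u :: real)"
  by (simp add: tanh_def field_simps cosh_plus_sinh)

lemma one_minus_tanh: "1 - tanh u = exp (- u) / cosh (u :: real)"
  by (simp add: tanh_def field_simps cosh_minus_sinh)

lemma ln_one_pm_tanh:
  "ln (1 + tanh u) = u - ln (cosh (u :: real))" "ln (1 - tanh u) = - u - ln (cosh u)"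
  by (simp_all add: one_plus_tanh one_minus_tanh ln_div)

text \<open>Fenchel-Young for \<open>rate_I\<close>, whose convex conjugate is
  \<open>ln (cosh u)\<close>. The gap between the two sides is the relative entropy of the spin law
  with mean \<open>s\<close> with respect to the one with mean \<open>tanh u\<close>, which vanishes
  only when the means agree.\<close>

lemma rate_I_fenchel:
  assumes "s \<in> {-1..1}"
  shows "u * s - ln (cosh u) \<le> rate_I s"
    and "s \<noteq> tanh u \<Longrightarrow> u * s - ln (cosh u) < rate_I s"
proof -
  have pos: "0 < 1 + tanh u" "0 < 1 - tanh u"
    by (simp_all add: one_plus_tanh one_minus_tanh)
  \<comment> \<open>The subtracted linear terms add up to zero; they are inserted so that each
    bracket is nonnegative by \<open>kl_term_ge\<close>.\<close>
  have eq: "rate_I s - (u * s - ln (cosh u)) =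
      (((1 + s) * ln (1 + s) - (1 + s) * ln (1 + tanh u) - ((1 + s) - (1 + tanh u)))
       + ((1 - s) * ln (1 - s) - (1 - s) * ln (1 - tanh u) - ((1 - s) - (1 - tanh u)))) / 2"
    unfolding ln_one_pm_tanh rate_I_def by (simp add: field_simps)
  have a: "0 \<le> 1 + s" "0 \<le> 1 - s" using assms by auto
  show "u * s - ln (cosh u) \<le> rate_I s"
    using eq kl_term_ge(1)[OF a(1) pos(1)] kl_term_ge(1)[OF a(2) pos(2)] by simp
  show "s \<noteq> tanh u \<Longrightarrow> u * s - ln (cosh u) < rate_I s"
    using eq kl_term_ge(2)[OF a(1) pos(1)] kl_term_ge(2)[OF a(2) pos(2)] by simp
qed

lemma rate_I_tanh: "rate_I (tanh u) = u * tanh u - ln (cosh u)"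
proof -
  have "rate_I (tanh u) =
     ((1 - tanh u) * ln (1 - tanh u) + (1 + tanh u) * ln (1 + tanh u)) / 2"
    unfolding rate_I_def by simp
  also have "\<dots> = u * tanh u - ln (cosh u)"
    unfolding ln_one_pm_tanh by (simp add: field_simps)
  finally show ?thesis .
qed

lemma tanh_real_in: "tanh (u :: real) \<in> {-1..1}"
  using one_plus_tanh[of u] one_minus_tanh[of u]
  by (smt (verit) atLeastAtMost_iff cosh_real_pos exp_gt_zero divide_pos_pos)

lemma ent_eq: "ent u = ln 2 - rate_I (tanh u)"
  by (simp add: ent_def rate_I_tanh ln_mult)

text \<open>Fenchel's inequality with slope \<open>u\<close> at the point \<open>tanh v\<close> acts
  as a supporting line, so the monotonicity of \<open>tanh\<close> replaces a derivative of
  \<open>ent\<close>.\<close>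

lemma ent_antimono:
  assumes "0 \<le> u" "u \<le> v"
  shows "ent v \<le> ent u"
proof -
  have "ent v \<le> ent u + u * (tanh u - tanh v)"
    using rate_I_fenchel(1)[OF tanh_real_in, of u v]
    by (simp add: ent_eq rate_I_tanh ln_mult algebra_simps)
  moreover have "u * (tanh u - tanh v) \<le> 0"
    using assms by (intro mult_nonneg_nonpos) auto
  ultimately show ?thesis by simp
qed

lemma ent_0: "ent 0 = ln 2" by (simp add: ent_def)

lemma ent_le: "ent u \<le> ln 2"
  using rate_I_fenchel(1)[OF tanh_real_in, of 0 u] by (simp add: ent_eq)

lemma continuous_ent [continuous_intros]: "continuous_on S f \<Longrightarrow> continuous_on S (\<lambda>x. ent (f x))"
  unfolding ent_def by (intro continuous_intros) (auto simp: cosh_real_nonzero)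

text \<open>The hypothesis is the stationarity condition \<open>artanh s = H * rho s\<close> at
  \<open>s = tanh u\<close>, since the derivative of \<open>rate_I\<close> is \<open>artanh\<close>.
  Global maximality is shown without derivatives: with \<open>r0 = rho (tanh u)\<close>, the bound
  \<open>2 * r0 * rho s \<le> r0^2 + (rho s)^2\<close> removes the square root, and strict Fenchel
  then beats every other \<open>s\<close>.\<close>

lemma t_star_eqI:
  assumes u: "u = H * sqrt (2 * ent u)" and pos: "0 < ent u"
  shows "t_star H = tanh u" "rho (t_star H) = sqrt (2 * ent u)"
proof -
  have r: "rho (tanh u) = sqrt (2 * ent u)" by (simp add: rho_def ent_eq)
  define r0 where "r0 = rho (tanh u)"
  have r0: "0 < r0" "r0\<^sup>2 = 2 * ent u" "u = H * r0" using r pos u by (simp_all add: r0_def)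
  have lt: "rho s + H * s < rho (tanh u) + H * tanh u" if s: "s \<in> {-1..1}" "s \<noteq> tanh u" for s
  proof -
    have f: "ln 2 - rate_I s < ent u + u * (tanh u - s)"
      using rate_I_fenchel(2)[OF s] by (simp add: ent_def ln_mult algebra_simps)
    have H: "H * (tanh u - s) * r0 = u * (tanh u - s)" using r0(3) by simp
    show ?thesis
    proof (cases "ln 2 - rate_I s \<ge> 0")
      case True
      have "2 * r0 * rho s \<le> r0\<^sup>2 + (rho s)\<^sup>2"
        using sum_squares_bound[of r0 "rho s"] by simp
      also have "(rho s)\<^sup>2 = 2 * (ln 2 - rate_I s)" using True by (simp add: rho_def)
      also have "r0\<^sup>2 + 2 * (ln 2 - rate_I s) < 2 * r0 * (r0 + H * (tanh u - s))"
        using f r0(2) H by (simp add: algebra_simps power2_eq_square)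
      finally have "rho s < r0 + H * (tanh u - s)" using r0(1) by simp
      then show ?thesis by (simp add: r0_def algebra_simps)
    next
      \<comment> \<open>This case is empty because \<open>rate_I\<close> is at most
        \<open>ln 2\<close> on [-1, 1]. It has to be excluded since squaring \<open>rho s\<close>
        recovers the radicand only when that is nonnegative.\<close>
      case False
      have "0 \<le> rate_I s" using rate_I_fenchel(1)[OF s(1), of 0] by simp
      have up: "rate_I s \<le> ln 2"
      proof -
        have "(1 - s) * ln (1 - s) \<le> (1 - s) * ln 2" "(1 + s) * ln (1 + s) \<le> (1 + s) * ln 2"
          using s by (cases "s = 1"; cases "s = -1"; auto intro!: mult_left_mono)+
        then show ?thesis by (simp add: rate_I_def algebra_simps)
      qed
      with False show ?thesis by simp
    qed
  qed
  show t: "t_star H = tanh u"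
    unfolding t_star_def
  proof (rule the_equality)
    show "is_arg_max (\<lambda>s. rho s + H * s) (\<lambda>s. s \<in> {-1..1}) (tanh u)"
      unfolding is_arg_max_def using lt tanh_real_in[of u] by (metis less_asym)
    show "\<And>t. is_arg_max (\<lambda>s. rho s + H * s) (\<lambda>s. s \<in> {-1..1}) t \<Longrightarrow> t = tanh u"
      unfolding is_arg_max_def using lt tanh_real_in[of u] by metis
  qed
  show "rho (t_star H) = sqrt (2 * ent u)" using t r by simp
qed

lemma ent_root_ex:
  assumes "0 < X" "0 < Q" "0 \<le> h"
  shows "\<exists>l>0. X * ent (l * h) = l\<^sup>2 * Q / 2"
proof -
  define f where "f l = l\<^sup>2 * Q / 2 - X * ent (l * h)" for l
  \<comment> \<open>At \<open>b\<close> the quadratic side reaches \<open>X * ln 2\<close>, the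
    largest value that \<open>X * ent\<close> can take.\<close>
  define b where "b = sqrt (2 * X * ln 2 / Q)"
  have b: "0 \<le> b" "b\<^sup>2 = 2 * X * ln 2 / Q" using assms by (auto simp: b_def)
  have "f 0 \<le> 0" using assms by (simp add: f_def ent_0)
  moreover have "0 \<le> f b"
    using mult_left_mono[OF ent_le[of "b * h"], of X] assms b(2) by (simp add: f_def field_simps)
  moreover have "continuous_on {0..b} f" unfolding f_def by (intro continuous_intros) auto
  ultimately obtain l where l: "0 \<le> l" "l \<le> b" "f l = 0"
    using IVT'[of f 0 0 b] b(1) by auto
  moreover have "l \<noteq> 0" using l(3) assms by (auto simp: f_def ent_0)
  ultimately show ?thesis by (intro exI[of _ l]) (auto simp: f_def)
qed

text \<open>Put \<open>u = l * h\<close> and \<open>H = h / sqrt theta\<close>. The root equation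
  becomes \<open>sqrt (2 * ent u) = l * sqrt theta\<close>, so
  \<open>u = H * sqrt (2 * ent u)\<close>, which is what \<open>t_star_eqI\<close> asks for; then
  \<open>theta\<close> cancels from \<open>theta_tilde\<close>.\<close>

lemma root_theta_tilde:
  assumes X: "0 < x k - x (j - 1)" and Q: "0 < q k - q (j - 1)" and h: "0 \<le> h" and l: "0 < l"
    and eq: "(x k - x (j - 1)) * ent (l * h) = l\<^sup>2 * (q k - q (j - 1)) / 2"
  shows "theta_tilde x q h j k = 1 / l\<^sup>2"
    and "t_star (h / sqrt (theta x q j k)) = tanh (l * h)"
    and "rho (t_star (h / sqrt (theta x q j k))) = l * sqrt (theta x q j k)"
proof -
  define th where "th = theta x q j k"
  have th: "0 < th" using X Q by (simp add: th_def theta_def)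
  have e: "ent (l * h) = l\<^sup>2 * th / 2"
    using eq X by (simp add: th_def theta_def field_simps)
  have s: "sqrt (2 * ent (l * h)) = l * sqrt th"
    using l by (simp add: e real_sqrt_mult)
  have "0 < ent (l * h)" unfolding e using l th by simp
  moreover have "l * h = h / sqrt th * sqrt (2 * ent (l * h))"
    using th by (simp add: s)
  ultimately have *: "t_star (h / sqrt th) = tanh (l * h)"
      "rho (t_star (h / sqrt th)) = sqrt (2 * ent (l * h))"
    using t_star_eqI[of "l * h" "h / sqrt th"] by auto
  show "t_star (h / sqrt (theta x q j k)) = tanh (l * h)" using * by (simp add: th_def)
  show **: "rho (t_star (h / sqrt (theta x q j k))) = l * sqrt (theta x q j k)"
    using * s by (simp add: th_def)
  show "theta_tilde x q h j k = 1 / l\<^sup>2"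
    unfolding theta_tilde_def ** using th l
    by (simp add: th_def[symmetric] power_mult_distrib)
qed

section \<open>Coarse-graining\<close>

declare block_end.simps(2) [simp del]

locale order_parameter =
  fixes n :: nat and x q :: "nat \<Rightarrow> real" and h :: real
  assumes n: "1 \<le> n"
    and x0: "x 0 = 0" and xn: "x n = 1" and x_less: "\<And>k. k < n \<Longrightarrow> x k < x (Suc k)"
    and q0: "q 0 = 0" and qn: "q n = 1" and q_less: "\<And>k. k < n \<Longrightarrow> q k < q (Suc k)"
    and h: "0 \<le> h"
begin

lemma x_strict: "j < k \<Longrightarrow> k \<le> n \<Longrightarrow> x j < x k"
proof (induction k rule: less_induct)
  case (less k)
  then obtain k' where k: "k = Suc k'" by (cases k) auto
  show ?case
    using less.IH[of k'] less.prems x_less[of k'] k by (cases "j = k'") auto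
qed

lemma q_strict: "j < k \<Longrightarrow> k \<le> n \<Longrightarrow> q j < q k"
proof (induction k rule: less_induct)
  case (less k)
  then obtain k' where k: "k = Suc k'" by (cases k) auto
  show ?case
    using less.IH[of k'] less.prems q_less[of k'] k by (cases "j = k'") auto
qed

text \<open>Entropy per spin of the levels \<open>j,\<dots>,k\<close> when they are tilted by \<open>l\<close>.\<close>

definition excess :: "nat \<Rightarrow> nat \<Rightarrow> real \<Rightarrow> real" where
  "excess j k l = (x k - x (j - 1)) * ent (l * h) - l\<^sup>2 * (q k - q (j - 1)) / 2"

definition crit :: "nat \<Rightarrow> nat \<Rightarrow> real" where
  "crit j k = (THE l. 0 < l \<and> excess j k l = 0)"

lemma excess_strict:
  assumes "1 \<le> j" "j \<le> k" "k \<le> n" "0 \<le> l" "l < l'"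
  shows "excess j k l' < excess j k l"
proof -
  have X: "0 < x k - x (j - 1)" and Q: "0 < q k - q (j - 1)"
    using x_strict[of "j - 1" k] q_strict[of "j - 1" k] assms by auto
  have "(x k - x (j - 1)) * ent (l' * h) \<le> (x k - x (j - 1)) * ent (l * h)"
    using X assms h by (intro mult_left_mono ent_antimono) (auto intro: mult_right_mono)
  moreover have "l\<^sup>2 * (q k - q (j - 1)) < l'\<^sup>2 * (q k - q (j - 1))"
    using Q assms by (intro mult_strict_right_mono power_strict_mono) auto
  ultimately show ?thesis unfolding excess_def by simp
qed

lemma crit:
  assumes "1 \<le> j" "j \<le> k" "k \<le> n"
  shows "0 < crit j k" "excess j k (crit j k) = 0"
proof -
  have X: "0 < x k - x (j - 1)" and Q: "0 < q k - q (j - 1)"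
    using x_strict[of "j - 1" k] q_strict[of "j - 1" k] assms by auto
  obtain l where l: "0 < l" "excess j k l = 0"
    using ent_root_ex[OF X Q h] by (auto simp: excess_def)
  have "crit j k = l"
    unfolding crit_def
  proof (rule the_equality)
    fix l' assume "0 < l' \<and> excess j k l' = 0"
    then show "l' = l"
      using excess_strict[OF assms, of l l'] excess_strict[OF assms, of l' l] l
      by (cases l l' rule: linorder_cases) auto
  qed (use l in simp)
  with l show "0 < crit j k" "excess j k (crit j k) = 0" by auto
qed

lemma excess_pos_iff:
  assumes "1 \<le> j" "j \<le> k" "k \<le> n" "0 \<le> l"
  shows "0 < excess j k l \<longleftrightarrow> l < crit j k" "0 \<le> excess j k l \<longleftrightarrow> l \<le> crit j k"
  using crit[OF assms(1-3)] excess_strict[OF assms, of "crit j k"]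
    excess_strict[OF assms(1-3), of "crit j k" l]
  by (cases l "crit j k" rule: linorder_cases; auto)+

text \<open>Additivity at a common tilt. Together with the sign test \<open>excess_pos_iff\<close>
  it gives a mediant property: the critical tilt of a union of two adjacent groups of levels lies
  between those of the groups. All comparisons of blocks rest on this.\<close>

lemma excess_split:
  assumes "1 \<le> j" "j \<le> i"
  shows "excess j k l = excess j i l + excess (Suc i) k l"
  unfolding excess_def using assms by (simp add: algebra_simps diff_divide_distrib add_divide_distrib)

lemma crit_facts:
  assumes "1 \<le> j" "j \<le> k" "k \<le> n"
  shows "theta_tilde x q h j k = 1 / (crit j k)\<^sup>2"
    and "t_star (h / sqrt (theta x q j k)) = tanh (crit j k * h)"
    and "rho (t_star (h / sqrt (theta x q j k))) = crit j k * sqrt (theta x q j k)"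
proof -
  have X: "0 < x k - x (j - 1)" and Q: "0 < q k - q (j - 1)"
    using x_strict[of "j - 1" k] q_strict[of "j - 1" k] assms by auto
  have e: "(x k - x (j - 1)) * ent (crit j k * h) = (crit j k)\<^sup>2 * (q k - q (j - 1)) / 2"
    using crit(2)[OF assms] by (simp add: excess_def)
  show "theta_tilde x q h j k = 1 / (crit j k)\<^sup>2"
    and "t_star (h / sqrt (theta x q j k)) = tanh (crit j k * h)"
    and "rho (t_star (h / sqrt (theta x q j k))) = crit j k * sqrt (theta x q j k)"
    using root_theta_tilde[OF X Q h crit(1)[OF assms] e] by auto
qed

lemma theta_tilde_less_iff:
  assumes "1 \<le> j" "j \<le> k" "k \<le> n" "1 \<le> i" "i \<le> r" "r \<le> n"
  shows "theta_tilde x q h j k < theta_tilde x q h i r \<longleftrightarrow> crit i r < crit j k"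
proof -
  have p: "0 < crit j k" "0 < crit i r" using crit assms by auto
  have "1 / (crit j k)\<^sup>2 < 1 / (crit i r)\<^sup>2 \<longleftrightarrow> (crit i r)\<^sup>2 < (crit j k)\<^sup>2"
    using p by (simp add: field_simps)
  also have "\<dots> \<longleftrightarrow> crit i r < crit j k"
    using p by (meson less_eq_real_def power2_less_imp_less power_strict_mono zero_less_numeral)
  finally show ?thesis using crit_facts(1) assms by simp
qed

abbreviation "be \<equiv> block_end n x q h"

text \<open>The procedure picks the largest minimizer of \<open>crit (be l + 1)\<close>.\<close>

lemma block_end_Suc:
  assumes a: "be l < n"
  shows "be l < be (Suc l)" "be (Suc l) \<le> n"
    and "\<And>k. be l < k \<Longrightarrow> k \<le> n \<Longrightarrow> crit (be l + 1) (be (Suc l)) \<le> crit (be l + 1) k"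
    and "\<And>k. be (Suc l) < k \<Longrightarrow> k \<le> n \<Longrightarrow>
      crit (be l + 1) (be (Suc l)) < crit (be (Suc l) + 1) k"
proof -
  define a where "a = be l"
  define J where "J = be (Suc l)"
  define C where "C = {J \<in> {a + 1..n}. \<forall>k\<in>{J + 1..n}. crit (a + 1) J < crit (J + 1) k}"
  have an: "a < n" using assms by (simp add: a_def)
  have CC: "C = {J \<in> {a + 1..n}. \<forall>k\<in>{J + 1..n}.
                    theta_tilde x q h (a + 1) J > theta_tilde x q h (J + 1) k}"
    unfolding C_def by (auto simp: theta_tilde_less_iff)
  have JC: "J = Min C" using an unfolding J_def CC by (simp add: a_def block_end.simps(2))
  have finC: "finite C" by (simp add: C_def)
  define mu where "mu = Min (crit (a + 1) ` {a + 1..n})"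
  define S where "S = {k \<in> {a + 1..n}. crit (a + 1) k = mu}"
  define J' where "J' = Max S"
  have mu_le: "mu \<le> crit (a + 1) k" if "k \<in> {a + 1..n}" for k
    using that by (simp add: mu_def)
  have "mu \<in> crit (a + 1) ` {a + 1..n}" unfolding mu_def using an by (intro Min_in) auto
  then have S: "finite S" "S \<noteq> {}" by (auto simp: S_def)
  then have "J' \<in> S" unfolding J'_def by (rule Max_in)
  then have J': "a + 1 \<le> J'" "J' \<le> n" "crit (a + 1) J' = mu" by (auto simp: S_def)
  have mupos: "0 < mu" using crit(1)[of "a + 1" J'] J' by simp
  \<comment> \<open>The largest minimizer obeys the selection rule: beyond it the excess at
    \<open>mu\<close> is positive, and splitting off the levels up to \<open>J'\<close>, whose
    excess at \<open>mu\<close> is zero, leaves a positive excess for the rest.\<close>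
  have "crit (a + 1) J' < crit (J' + 1) k" if k: "k \<in> {J' + 1..n}" for k
  proof -
    have "k \<notin> S" using Max_ge[OF S(1), of k] k by (auto simp: J'_def)
    then have "mu < crit (a + 1) k" using mu_le[of k] k J' by (auto simp: S_def)
    then have "0 < excess (a + 1) k mu" using excess_pos_iff(1)[of "a + 1" k mu] k J' mupos by simp
    also have "excess (a + 1) k mu = excess (a + 1) J' mu + excess (Suc J') k mu"
      using J' by (intro excess_split) auto
    also have "excess (a + 1) J' mu = 0" using crit(2)[of "a + 1" J'] J' by simp
    finally have "mu < crit (Suc J') k"
      using excess_pos_iff(1)[of "Suc J'" k mu] k mupos by simp
    then show ?thesis using J' by simp
  qed
  then have J'C: "J' \<in> C" using J' by (auto simp: C_def)
  have JinC: "J \<in> C" unfolding JC using finC J'C by (intro Min_in) auto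
  have "J \<le> J'" unfolding JC using finC J'C by (rule Min_le)
  \<comment> \<open>An earlier end \<open>J\<close> obeying the rule would make the excess up to
    \<open>J'\<close> positive at its own critical tilt, which would then lie strictly below the
    minimum \<open>mu\<close>.\<close>
  moreover have "\<not> J < J'"
  proof
    assume lt: "J < J'"
    have Ja: "a + 1 \<le> J" "J \<le> n" using JinC by (auto simp: C_def)
    have c: "crit (a + 1) J < crit (J + 1) J'" using JinC lt J' by (auto simp: C_def)
    let ?m = "crit (a + 1) J"
    have m: "0 < ?m" using crit(1) Ja by simp
    have "0 < excess (Suc J) J' ?m" using excess_pos_iff(1)[of "Suc J" J' ?m] c m lt J' by simp
    moreover have "excess (a + 1) J ?m = 0" using crit(2)[of "a + 1" J] Ja by simp
    ultimately have "0 < excess (a + 1) J' ?m"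
      using excess_split[of "a + 1" J J' ?m] Ja by simp
    then have "?m < mu" using excess_pos_iff(1)[of "a + 1" J' ?m] J' m by simp
    then show False using mu_le[of J] Ja by simp
  qed
  ultimately have eq: "J = J'" by simp
  show "be l < be (Suc l)" "be (Suc l) \<le> n"
    using J' eq unfolding J_def[symmetric] a_def[symmetric] by auto
  show "\<And>k. be l < k \<Longrightarrow> k \<le> n \<Longrightarrow> crit (be l + 1) (be (Suc l)) \<le> crit (be l + 1) k"
    using J' eq mu_le unfolding J_def[symmetric] a_def[symmetric] by auto
  show "\<And>k. be (Suc l) < k \<Longrightarrow> k \<le> n \<Longrightarrow>
      crit (be l + 1) (be (Suc l)) < crit (be (Suc l) + 1) k"
    using JinC unfolding J_def[symmetric] a_def[symmetric] by (auto simp: C_def)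
qed

text \<open>Every step advances until \<open>n\<close> is reached, so \<open>n\<close> steps suffice
  and the \<open>LEAST\<close> in \<open>num_blocks\<close> is attained.\<close>

lemma be_ge: "min l n \<le> be l"
proof (induction l)
  case (Suc l)
  show ?case
  proof (cases "be l < n")
    case True
    then show ?thesis using block_end_Suc(1)[OF True] Suc by linarith
  qed (simp add: block_end.simps(2))
qed simp

abbreviation "m \<equiv> num_blocks n x q h"

lemma num_blocks: "be m = n" "1 \<le> m" and be_less: "l < m \<Longrightarrow> be l < n"
proof -
  have le: "be l \<le> n" for l by (cases l) (use block_end_Suc(2) in \<open>auto simp: block_end.simps(2)\<close>)
  have "be n = n" using be_ge[of n] le[of n] by simp
  then show *: "be m = n" unfolding num_blocks_def by (rule LeastI)
  show "1 \<le> m" using * n by (cases m) auto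
  show "be l < n" if "l < m" using not_less_Least[of l "\<lambda>l. be l = n"] that le[of l]
    by (auto simp: num_blocks_def le_less)
qed

text \<open>The critical inverse temperature of block \<open>l\<close>, that is, the reciprocal of
  \<open>gamma_bar\<close>: the block is frozen when \<open>\<beta>\<close> exceeds it.\<close>

definition bcrit :: "nat \<Rightarrow> real" where
  "bcrit l = crit (be (l - 1) + 1) (be l)"

lemma bcrit_Suc_pos: "l < m \<Longrightarrow> 0 < bcrit (Suc l)"
  unfolding bcrit_def using block_end_Suc(1,2)[OF be_less, of l] crit(1)[of "be l + 1" "be (Suc l)"] by simp

lemma gamma_bar_eq: "l < m \<Longrightarrow> gamma_bar n x q h (Suc l) = 1 / bcrit (Suc l)"
  using block_end_Suc(1,2)[OF be_less, of l] crit_facts(1)[of "be l + 1" "be (Suc l)"]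
    bcrit_Suc_pos[of l]
  by (simp add: gamma_bar_def bcrit_def real_sqrt_divide)

lemma bcrit_less: "Suc l < m \<Longrightarrow> bcrit (Suc l) < bcrit (Suc (Suc l))"
  unfolding bcrit_def
  using block_end_Suc(4)[OF be_less, of l "be (Suc (Suc l))"] block_end_Suc[OF be_less, of "Suc l"]
  by simp

lemma bcrit_mono: "l \<le> k \<Longrightarrow> k < m \<Longrightarrow> bcrit (Suc l) \<le> bcrit (Suc k)"
proof (induction k)
  case (Suc k)
  then show ?case using bcrit_less[of k] by (cases "l = Suc k") auto
qed simp

lemma frozen_blocks:
  assumes "0 < \<beta>"
  defines "L \<equiv> frozen_blocks n x q \<beta> h"
  shows "L \<le> m" "\<And>l. l < L \<Longrightarrow> bcrit (Suc l) < \<beta>" "L < m \<Longrightarrow> \<beta> \<le> bcrit (Suc L)"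
proof -
  have g: "\<beta> * gamma_bar n x q h (Suc l) > 1 \<longleftrightarrow> bcrit (Suc l) < \<beta>" if "l < m" for l
    using bcrit_Suc_pos[OF that] unfolding gamma_bar_eq[OF that] by (simp add: field_simps)
  define A where "A = {l \<in> {1..m}. \<beta> * gamma_bar n x q h l > 1}"
  have "L \<le> m \<and> (\<forall>l<L. bcrit (Suc l) < \<beta>) \<and> (L < m \<longrightarrow> \<beta> \<le> bcrit (Suc L))"
  proof (cases "\<beta> * gamma_bar n x q h 1 \<le> 1")
    case True
    then have "L = 0" by (simp add: L_def frozen_blocks_def)
    then show ?thesis using g[of 0] True num_blocks by (auto simp: not_less)
  next
    case False
    then have LA: "L = Max A" by (simp add: L_def frozen_blocks_def A_def)
    have finA: "finite A" by (simp add: A_def)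
    have "1 \<in> A" using False num_blocks by (simp add: A_def)
    then have "L \<in> A" unfolding LA using finA by (intro Max_in) auto
    then have L: "1 \<le> L" "L \<le> m" "\<beta> * gamma_bar n x q h L > 1" by (auto simp: A_def)
    then obtain L' where L': "L = Suc L'" by (cases L) auto
    have 1: "bcrit (Suc l) < \<beta>" if "l < L" for l
      using bcrit_mono[of l L'] g[of L'] L that unfolding L' by simp
    have 2: "\<beta> \<le> bcrit (Suc L)" if "L < m"
    proof (rule ccontr)
      assume "\<not> \<beta> \<le> bcrit (Suc L)"
      then have "Suc L \<in> A" using g[OF that] that by (auto simp: A_def)
      then show False using Max_ge[OF finA, of "Suc L"] LA by simp
    qed
    from 1 2 L show ?thesis by auto
  qed
  then show "L \<le> m" "\<And>l. l < L \<Longrightarrow> bcrit (Suc l) < \<beta>" "L < m \<Longrightarrow> \<beta> \<le> bcrit (Suc L)" by auto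
qed

section \<open>Tilts that certify the limit\<close>

definition gain :: "nat \<Rightarrow> nat \<Rightarrow> real \<Rightarrow> real" where
  "gain j k l = l * (q k - q (j - 1)) + h * (x k - x (j - 1)) * tanh (l * h)"

lemma excess_sum: "a \<le> k \<Longrightarrow> (\<Sum>j=Suc a..k. excess j j l) = excess (Suc a) k l"
proof (induction k)
  case (Suc k)
  show ?case
  proof (cases "a = Suc k")
    case False
    with Suc have "a \<le> k" by simp
    then show ?thesis using Suc excess_split[of "Suc a" k "Suc k" l]
      by (cases "a = k") auto
  qed (simp add: excess_def)
qed (simp add: excess_def)

lemma gain_sum: "a \<le> k \<Longrightarrow> (\<Sum>j=Suc a..k. gain j j l) = gain (Suc a) k l"
proof (induction k)
  case (Suc k)
  show ?case
  proof (cases "a = Suc k")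
    case False
    with Suc have "a \<le> k" by simp
    then show ?thesis using Suc
      by (simp add: gain_def algebra_simps)
  qed (simp add: gain_def)
qed (simp add: gain_def)

text \<open>A certificate for the first \<open>a\<close> levels only: \<open>u\<close> bounds the
  tilts used so far and \<open>V\<close> is the share of these levels in the free energy, so that
  the certificate can grow block by block. In \<open>V\<close>, \<open>gain\<close> is the energy
  per spin of the tilted level, field included. Monotone tilts serve the upper bound, nonnegative
  partial sums the lower one.\<close>

definition tilts :: "real \<Rightarrow> nat \<Rightarrow> real \<Rightarrow> (nat \<Rightarrow> real) \<Rightarrow> real \<Rightarrow> bool" where
  "tilts \<beta> a u l V \<longleftrightarrow>
     (\<forall>k\<in>{1..a}. 0 < l k \<and> l k \<le> u) \<and>
     (\<forall>j\<in>{1..a}. \<forall>k\<in>{1..a}. j \<le> k \<longrightarrow> l j \<le> l k) \<and>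
     (\<forall>k\<le>a. 0 \<le> (\<Sum>j=1..k. excess j j (l j))) \<and>
     (\<Sum>j=1..a. (\<beta> / l j - 1) * excess j j (l j)) = 0 \<and>
     (\<Sum>j=1..a. excess j j (l j) + \<beta> * gain j j (l j)) = V"

text \<open>The new levels get one common tilt \<open>u'\<close>. Partial sums that end inside the
  new block only need a nonnegative excess there, since the earlier levels contribute a nonnegative
  amount. The slackness hypothesis can be met in two ways: a block of zero excess (frozen), or
  \<open>u' = \<beta>\<close> (unfrozen).\<close>

lemma tilts_extend:
  assumes t: "tilts \<beta> a u l V" and "u \<le> u'" "0 < u'" "a \<le> b"
    and cum: "\<And>k. a < k \<Longrightarrow> k \<le> b \<Longrightarrow> 0 \<le> excess (Suc a) k u'"
    and slack: "(\<beta> / u' - 1) * excess (Suc a) b u' = 0"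
  shows "tilts \<beta> b u' (\<lambda>k. if k \<le> a then l k else u')
     (V + excess (Suc a) b u' + \<beta> * gain (Suc a) b u')"
proof -
  let ?l = "\<lambda>k. if k \<le> a then l k else u'"
  have split: "(\<Sum>j=1..k. f j (?l j)) = (\<Sum>j=1..a. f j (l j)) + (\<Sum>j=Suc a..k. f j u')"
    if "a \<le> k" for k and f :: "nat \<Rightarrow> real \<Rightarrow> real"
  proof -
    have "{1..k} = {1..a} \<union> {Suc a..k}" using that by auto
    then have "(\<Sum>j=1..k. f j (?l j)) = (\<Sum>j=1..a. f j (?l j)) + (\<Sum>j=Suc a..k. f j (?l j))"
      by (simp only:) (intro sum.union_disjoint, auto)
    then show ?thesis by (auto intro!: arg_cong2[where f="(+)"] sum.cong)
  qed
  have small: "(\<Sum>j=1..k. f j (?l j)) = (\<Sum>j=1..k. f j (l j))" if "k \<le> a" for k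
    and f :: "nat \<Rightarrow> real \<Rightarrow> real" using that by (intro sum.cong) auto
  have u: "l k \<le> u'" if "k \<in> {1..a}" for k
  proof -
    have "l k \<le> u" using t that unfolding tilts_def by blast
    with assms(2) show ?thesis by simp
  qed
  have 1: "0 \<le> (\<Sum>j=1..k. excess j j (?l j))" if "k \<le> b" for k
  proof (cases "k \<le> a")
    case True
    then show ?thesis using t unfolding tilts_def small[OF True, of "\<lambda>j. excess j j"] by blast
  next
    case False
    then show ?thesis using t cum[of k] that excess_sum[of a k u']
      unfolding tilts_def by (subst split[of k "\<lambda>j. excess j j"]) auto
  qed
  have 2: "(\<Sum>j=1..b. (\<beta> / ?l j - 1) * excess j j (?l j)) = 0"
    unfolding split[OF assms(4), of "\<lambda>j v. (\<beta> / v - 1) * excess j j v"]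
    using t slack excess_sum[OF assms(4), of u'] unfolding tilts_def
    by (simp add: sum_distrib_left[symmetric])
  have 3: "(\<Sum>j=1..b. excess j j (?l j) + \<beta> * gain j j (?l j)) =
      V + excess (Suc a) b u' + \<beta> * gain (Suc a) b u'"
    unfolding split[OF assms(4), of "\<lambda>j v. excess j j v + \<beta> * gain j j v"]
    using t excess_sum[OF assms(4), of u'] gain_sum[OF assms(4), of u'] unfolding tilts_def
    by (simp add: sum_distrib_left[symmetric] sum.distrib)
  have 4: "\<forall>k\<in>{1..b}. 0 < ?l k \<and> ?l k \<le> u'"
  proof
    fix k assume "k \<in> {1..b}"
    then show "0 < ?l k \<and> ?l k \<le> u'"
      using u[of k] t assms(3) unfolding tilts_def by (cases "k \<le> a") auto
  qed
  have 5: "\<forall>j\<in>{1..b}. \<forall>k\<in>{1..b}. j \<le> k \<longrightarrow> ?l j \<le> ?l k"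
  proof (intro ballI impI)
    fix j k assume jk: "j \<in> {1..b}" "k \<in> {1..b}" "j \<le> k"
    have "\<forall>j\<in>{1..a}. \<forall>k\<in>{1..a}. j \<le> k \<longrightarrow> l j \<le> l k" using t unfolding tilts_def by blast
    then show "?l j \<le> ?l k" using u[of j] jk by (cases "k \<le> a"; cases "j \<le> a") auto
  qed
  show ?thesis unfolding tilts_def using 1 2 3 4 5 by blast
qed

abbreviation "frozen_sum l \<equiv>
  (\<Sum>i=1..l. sqrt (x_bar n x q h i * q_bar n x q h i)
               * rho (t_star (h / sqrt (theta_bar n x q h i)))
             + h * x_bar n x q h i * t_star (h / sqrt (theta_bar n x q h i)))"

text \<open>Each frozen block is tilted by its own critical value, so its total excess vanishes and
  it contributes \<open>\<beta> * gain\<close> alone. Inside the block the excess is nonnegative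
  because the block end minimizes \<open>crit\<close>.\<close>

lemma tilts_frozen:
  assumes "0 < \<beta>" "l \<le> frozen_blocks n x q \<beta> h"
  shows "\<exists>f. tilts \<beta> (be l) (if l = 0 then 0 else bcrit l) f
     (\<beta> * frozen_sum l)"
  using assms(2)
proof (induction l)
  case 0
  show ?case by (rule exI[of _ "\<lambda>_. 0"]) (simp add: tilts_def)
next
  case (Suc l)
  let ?L = "frozen_blocks n x q \<beta> h"
  have lm: "l < m" using Suc.prems frozen_blocks(1)[OF assms(1)] by simp
  obtain f where f: "tilts \<beta> (be l) (if l = 0 then 0 else bcrit l) f
     (\<beta> * frozen_sum l)"
    using Suc by auto
  define a where "a = be l"
  define b where "b = be (Suc l)"
  have ab: "a < b" "b \<le> n" using block_end_Suc[OF be_less[OF lm]] by (auto simp: a_def b_def)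
  define u where "u = bcrit (Suc l)"
  have u: "u = crit (Suc a) b" by (simp add: u_def bcrit_def a_def b_def)
  have upos: "0 < u" using bcrit_Suc_pos[OF lm] by (simp add: u_def)
  have le: "(if l = 0 then 0 else bcrit l) \<le> u"
    using upos bcrit_mono[of "l - 1" l] lm by (cases l) (auto simp: u_def)
  have z: "excess (Suc a) b u = 0" using crit(2)[of "Suc a" b] ab u by simp
  have cum: "0 \<le> excess (Suc a) k u" if "a < k" "k \<le> b" for k
    using block_end_Suc(3)[OF be_less[OF lm], of k] that ab upos excess_pos_iff(2)[of "Suc a" k u]
    by (simp add: a_def[symmetric] b_def[symmetric] u)
  have T: "tilts \<beta> b u (\<lambda>k. if k \<le> a then f k else u)
     (\<beta> * frozen_sum l
      + excess (Suc a) b u + \<beta> * gain (Suc a) b u)"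
    using f ab z by (intro tilts_extend[OF _ le upos _ cum]) (simp_all add: a_def[symmetric])
  have th: "theta_bar n x q h (Suc l) = theta x q (Suc a) b"
    by (simp add: theta_bar_def a_def b_def)
  have xb: "x_bar n x q h (Suc l) = x b - x a" and qb: "q_bar n x q h (Suc l) = q b - q a"
    by (simp_all add: x_bar_def q_bar_def a_def b_def)
  have X: "0 < x b - x a" and Q: "0 < q b - q a" using x_strict q_strict ab by auto
  \<comment> \<open>Here \<open>rho\<close> is \<open>u * sqrt theta\<close> with
    \<open>theta\<close> the ratio of the two increments, so the square roots in the stated limit
    combine to the energy part of \<open>gain\<close>.\<close>
  have "sqrt ((x b - x a) * (q b - q a)) * (u * sqrt (theta x q (Suc a) b)) = u * (q b - q a)"
  proof -
    have "(x b - x a) * (q b - q a) * theta x q (Suc a) b = (q b - q a)\<^sup>2"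
      using X by (simp add: theta_def power2_eq_square)
    then have "sqrt ((x b - x a) * (q b - q a)) * sqrt (theta x q (Suc a) b) = q b - q a"
      using Q by (simp add: real_sqrt_mult[symmetric])
    then show ?thesis by (metis mult.left_commute)
  qed
  then have g: "sqrt (x_bar n x q h (Suc l) * q_bar n x q h (Suc l))
               * rho (t_star (h / sqrt (theta_bar n x q h (Suc l))))
             + h * x_bar n x q h (Suc l) * t_star (h / sqrt (theta_bar n x q h (Suc l)))
      = gain (Suc a) b u"
    using crit_facts[of "Suc a" b] ab unfolding th xb qb u gain_def by simp
  show ?case
    using T g z by (intro exI[of _ "\<lambda>k. if k \<le> a then f k else u"])
      (simp add: b_def[symmetric] u_def[symmetric] algebra_simps)
qed

text \<open>All levels after the last frozen block are tilted by \<open>\<beta>\<close> itself,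
  where the slackness factor \<open>\<beta> / \<beta> - 1\<close> vanishes; the excess stays
  nonnegative because \<open>\<beta>\<close> is at most the least critical tilt starting
  there.\<close>

theorem tilts_exist:
  assumes "0 < \<beta>"
  shows "\<exists>l. tilts \<beta> n \<beta> l (limit_free_energy n x q \<beta> h)"
proof -
  define L where "L = frozen_blocks n x q \<beta> h"
  define a where "a = be L"
  note Lf = frozen_blocks[OF assms, folded L_def]
  obtain f V where f: "tilts \<beta> a (if L = 0 then 0 else bcrit L) f V"
    and V: "V = \<beta> * frozen_sum L"
    using tilts_frozen[OF assms, of L] by (auto simp: L_def a_def)
  have le: "(if L = 0 then 0 else bcrit L) \<le> \<beta>"
    using assms Lf(2)[of "L - 1"] by (cases L) (auto simp: less_imp_le)
  have an: "a \<le> n"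
    using Lf(1) be_less[of L] num_blocks(1) by (cases "L = m") (auto simp: a_def)
  have cum: "0 \<le> excess (Suc a) k \<beta>" if k: "a < k" "k \<le> n" for k
  proof -
    have "L < m" using Lf(1) num_blocks(1) k by (cases "L = m") (auto simp: a_def)
    then have "\<beta> \<le> crit (Suc a) k"
      using Lf(3) block_end_Suc(3)[OF be_less, of L k] k
      by (simp add: a_def bcrit_def)
    then show ?thesis using excess_pos_iff(2)[of "Suc a" k \<beta>] k assms by simp
  qed
  have T: "tilts \<beta> n \<beta> (\<lambda>k. if k \<le> a then f k else \<beta>)
      (V + excess (Suc a) n \<beta> + \<beta> * gain (Suc a) n \<beta>)"
    using assms an by (intro tilts_extend[OF f le _ _ cum]) auto
  \<comment> \<open>At tilt \<open>\<beta>\<close> the spin entropy and the field energy recombine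
    into the free energy of independent spins.\<close>
  have e: "ent (\<beta> * h) + \<beta> * h * tanh (\<beta> * h) = ln 2 + ln (cosh (\<beta> * h))"
    by (simp add: ent_def ln_mult)
  have "(1 - x a) * (ln 2 + ln (cosh (\<beta> * h))) =
      (1 - x a) * ent (\<beta> * h) + \<beta> * (h * (1 - x a) * tanh (\<beta> * h))"
    by (simp add: algebra_simps flip: e)
  moreover have "\<beta> * (\<beta> * (1 - q a)) = \<beta>\<^sup>2 * (1 - q a)" by (simp add: power2_eq_square)
  ultimately have "V + excess (Suc a) n \<beta> + \<beta> * gain (Suc a) n \<beta> = limit_free_energy n x q \<beta> h"
    unfolding limit_free_energy_def Let_def L_def[symmetric] a_def[symmetric] V[symmetric]
      excess_def gain_def by (simp add: xn qn distrib_left)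
  with T show ?thesis by auto
qed

end

section \<open>Gaussian laws are determined by linear combinations\<close>

lemma borel_measurable_indicator_comp:
  "X \<in> borel_measurable M \<Longrightarrow> A \<in> sets borel \<Longrightarrow>
    (\<lambda>x. indicator A (X x) :: real) \<in> borel_measurable M"
  by (rule measurable_compose[OF _ borel_measurable_indicator])

text \<open>A nonnegative weight is normalized to a probability law on the line, to which uniqueness
  of characteristic functions applies. The first alternative is a weight of total mass zero, where
  no normalization exists but all weighted integrals vanish.\<close>

lemma weighted_law:
  fixes X w :: "'a \<Rightarrow> real"
  assumes M: "prob_space M" and X: "X \<in> borel_measurable M" and w: "integrable M w" "\<And>x. 0 \<le> w x"
  obtains "\<And>A. A \<in> sets borel \<Longrightarrow> (\<integral>x. w x * indicator A (X x) \<partial>M) = 0" "(\<integral>x. w x \<partial>M) = 0"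
  | D where "0 < (\<integral>x. w x \<partial>M)" "real_distribution D"
    "char D = (\<lambda>t. (CLINT x|M. of_real (w x) * iexp (t * X x)) / of_real (\<integral>x. w x \<partial>M))"
    "\<And>A. A \<in> sets borel \<Longrightarrow>
      measure D A = (\<integral>x. w x * indicator A (X x) \<partial>M) / (\<integral>x. w x \<partial>M)"
proof -
  interpret M: prob_space M by fact
  note [measurable] = X borel_measurable_integrable[OF w(1)]
  define c where "c = (\<integral>x. w x \<partial>M)"
  have "0 \<le> c" unfolding c_def using w by simp
  show thesis
  proof (cases "c = 0")
    case True
    have ae: "AE x in M. w x = 0"
      using True w integral_nonneg_eq_0_iff_AE[of M w] by (simp add: c_def)
    have "(\<integral>x. w x * indicator A (X x) \<partial>M) = 0" if [measurable]: "A \<in> sets borel" for A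
    proof -
      have "(\<integral>x. w x * indicator A (X x) \<partial>M) = (\<integral>x. 0 \<partial>M)"
        using ae by (intro integral_cong_AE) auto
      then show ?thesis by simp
    qed
    with True show thesis by (intro that(1)) (auto simp: c_def)
  next
    case False
    with \<open>0 \<le> c\<close> have c: "0 < c" by simp
    define D where "D = density M (\<lambda>x. ennreal (w x / c))"
    have "emeasure D (space D) = (\<integral>\<^sup>+x. ennreal (w x / c) \<partial>M)"
      unfolding D_def by (subst emeasure_density) (auto intro!: nn_integral_cong)
    also have "\<dots> = ennreal (\<integral>x. w x / c \<partial>M)"
      using w c by (intro nn_integral_eq_integral) auto
    also have "\<dots> = 1" using c by (simp add: c_def[symmetric])
    finally interpret D: prob_space D by (rule prob_spaceI)
    have [measurable]: "X \<in> borel_measurable D" by (simp add: D_def)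
    have "char (distr D borel X) t = (CLINT x|M. of_real (w x) * iexp (t * X x)) / c" for t
    proof -
      have "char (distr D borel X) t = (CLINT x|M. (w x / c) *\<^sub>R iexp (t * X x))"
        unfolding char_def D_def using w c
        by (subst integral_distr) (auto simp: D_def intro!: integral_density)
      also have "\<dots> = (CLINT x|M. of_real (w x) * iexp (t * X x) / c)"
        by (intro Bochner_Integration.integral_cong) (auto simp: scaleR_conv_of_real)
      finally show ?thesis by simp
    qed
    moreover have "measure (distr D borel X) A = (\<integral>x. w x * indicator A (X x) \<partial>M) / c"
      if [measurable]: "A \<in> sets borel" for A
    proof -
      have "measure (distr D borel X) A = (\<integral>x. indicator A x \<partial>distr D borel X)" by simp
      also have "\<dots> = (\<integral>x. (indicator A (X x) :: real) \<partial>D)" by (rule integral_distr) measurable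
      also have "\<dots> = (\<integral>x. w x * indicator A (X x) \<partial>M) / c"
        unfolding D_def using w c by (subst integral_density) auto
      finally show ?thesis .
    qed
    ultimately show thesis using c by (intro that(2)[of "distr D borel X"])
      (auto simp: c_def[symmetric] fun_eq_iff intro!: D.real_distribution_distr)
  qed
qed

text \<open>The hypothesis at \<open>t = 0\<close> shows that the total masses agree; so both
  weights vanish almost everywhere or both normalize by the same constant, and then the normalized
  laws have the same characteristic function.\<close>

lemma weighted_law_unique:
  fixes X w :: "'a \<Rightarrow> real" and X' w' :: "'b \<Rightarrow> real"
  assumes M: "prob_space M" "prob_space M'"
    and X: "X \<in> borel_measurable M" "X' \<in> borel_measurable M'"
    and w: "integrable M w" "\<And>x. 0 \<le> w x" "integrable M' w'" "\<And>x. 0 \<le> w' x"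
    and eq: "\<And>t. (CLINT x|M. of_real (w x) * iexp (t * X x)) =
                  (CLINT x|M'. of_real (w' x) * iexp (t * X' x))"
    and A: "A \<in> sets borel"
  shows "(\<integral>x. w x * indicator A (X x) \<partial>M) = (\<integral>x. w' x * indicator A (X' x) \<partial>M')"
proof -
  have c: "(\<integral>x. w x \<partial>M) = (\<integral>x. w' x \<partial>M')"
  proof -
    have "(CLINT x|M. of_real (w x)) = (CLINT x|M'. of_real (w' x))" using eq[of 0] by simp
    then show ?thesis by (simp only: integral_complex_of_real of_real_eq_iff)
  qed
  show ?thesis
  proof (cases rule: weighted_law[OF M(1) X(1) w(1,2)])
    case 1
    then show ?thesis
      by (cases rule: weighted_law[OF M(2) X(2) w(3,4)]) (use A c in auto)
  next
    case (2 D)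
    note D = this
    show ?thesis
    proof (cases rule: weighted_law[OF M(2) X(2) w(3,4)])
      case 1
      then show ?thesis using D c by simp
    next
      case (2 D')
      have "D = D'" using D 2 by (intro Levy_uniqueness) (simp_all only: eq c)
      then show ?thesis using D(1) D(4)[OF A] 2(4)[OF A] c by (simp add: divide_eq_eq)
    qed
  qed
qed

text \<open>In the factor \<open>iexp (\<Sum>s. c s * X s)\<close> the coordinates are replaced one after the other by
  indicators of Borel sets.  Each step is the one-dimensional uniqueness theorem for the
  nonnegative weights \<open>1\<close>, \<open>1 + cos\<close> and \<open>1 + sin\<close> of the remaining linear combination.\<close>

lemma cramer_wold_step:
  fixes X :: "'s \<Rightarrow> 'a \<Rightarrow> real" and X' :: "'s \<Rightarrow> 'b \<Rightarrow> real"
  assumes M: "prob_space M" "prob_space M'" and S: "finite S"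
    and meas: "\<And>s. s \<in> S \<Longrightarrow> X s \<in> borel_measurable M" "\<And>s. s \<in> S \<Longrightarrow> X' s \<in> borel_measurable M'"
    and eq: "\<And>c. (CLINT x|M. iexp (\<Sum>s\<in>S. c s * X s x)) = (CLINT x|M'. iexp (\<Sum>s\<in>S. c s * X' s x))"
    and A: "\<And>s. s \<in> S \<Longrightarrow> A s \<in> sets borel"
    and "finite T" "T \<subseteq> S"
  shows "(CLINT x|M. of_real (\<Prod>s\<in>T. indicator (A s) (X s x)) * iexp (\<Sum>s\<in>S-T. c s * X s x)) =
         (CLINT x|M'. of_real (\<Prod>s\<in>T. indicator (A s) (X' s x)) * iexp (\<Sum>s\<in>S-T. c s * X' s x))"
  using \<open>finite T\<close> \<open>T \<subseteq> S\<close>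
proof (induction T arbitrary: c rule: finite_induct)
  case empty
  then show ?case using eq by simp
next
  case (insert a T c)
  define D where "D = S - insert a T"
  have ST: "S - T = insert a D" "a \<notin> D" "finite D" using insert S by (auto simp: D_def)
  have aS: "a \<in> S" "T \<subseteq> S" "D \<subseteq> S" using insert by (auto simp: D_def)
  let ?i = "\<lambda>Y x. \<Prod>s\<in>T. indicator (A s) (Y s x) :: real"
  let ?L = "\<lambda>Y x. \<Sum>s\<in>D. c s * Y s x"
  \<comment> \<open>The parameter \<open>t\<close> tests the coordinate \<open>a\<close>, while
    \<open>r\<close> rescales the coordinates that remain; the values 0, 1 and -1 of
    \<open>r\<close> are enough below.\<close>
  have IH: "(CLINT x|M. of_real (?i X x) * iexp (t * X a x + r * (?L X x))) =
         (CLINT x|M'. of_real (?i X' x) * iexp (t * X' a x + r * (?L X' x)))"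
    for t r
  proof -
    have *: "(\<Sum>s\<in>S-T. (if s = a then t else r * c s) * Y s) = t * Y a + r * (\<Sum>s\<in>D. c s * Y s)"
      for Y :: "'s \<Rightarrow> real"
    proof -
      have "(\<Sum>s\<in>D. (if s = a then t else r * c s) * Y s) = r * (\<Sum>s\<in>D. c s * Y s)"
        unfolding sum_distrib_left using ST(2) by (intro sum.cong) auto
      then show ?thesis using ST by simp
    qed
    show ?thesis using insert.IH[of "\<lambda>s. if s = a then t else r * c s"] insert.prems
      unfolding * by simp
  qed
  let ?I = "\<lambda>N Y. \<lambda>f :: real \<Rightarrow> real. (\<integral>x. ((?i Y x) * f (?L Y x)) * indicator (A a) (Y a x) \<partial>N)"
  \<comment> \<open>Being a combination of 1, \<open>iexp l\<close> and \<open>iexp (- l)\<close>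
    lets the induction hypothesis evaluate the characteristic integral of the weight; nonnegativity
    makes \<open>f\<close> admissible as a weight.\<close>
  have key: "?I M X f = ?I M' X' f"
    if f: "\<And>l. complex_of_real (f l) = k0 + k1 * iexp l + k2 * iexp (- l)" "\<And>l. 0 \<le> f l" "\<And>l. f l \<le> 2"
    for f k0 k1 k2
  proof -
    have [measurable]: "f \<in> borel_measurable borel"
    proof -
      have "(\<lambda>l. Re (k0 + k1 * iexp l + k2 * iexp (- l))) \<in> borel_measurable borel" by measurable
      then show ?thesis by (simp only: f(1)[symmetric] Re_complex_of_real)
    qed
    note [measurable] = meas A
    have T2: "T \<subseteq> S" by (rule aS)
    show ?thesis
    proof (rule weighted_law_unique)
      show "prob_space M" "prob_space M'" by fact+
      show "X a \<in> borel_measurable M" "X' a \<in> borel_measurable M'" "A a \<in> sets borel"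
        using aS meas A by auto
      have mX: "\<And>s. s \<in> T \<Longrightarrow> (\<lambda>x. indicator (A s) (X s x) :: real) \<in> borel_measurable M"
        "\<And>s. s \<in> T \<Longrightarrow> (\<lambda>x. indicator (A s) (X' s x) :: real) \<in> borel_measurable M'"
        using aS meas A by (auto intro!: borel_measurable_indicator_comp)
      have mD: "(\<lambda>x. \<Sum>s\<in>D. c s * X s x) \<in> borel_measurable M"
         "(\<lambda>x. \<Sum>s\<in>D. c s * X' s x) \<in> borel_measurable M'"
        using aS meas by (auto intro!: borel_measurable_sum borel_measurable_times)
      have p01: "0 \<le> (\<Prod>s\<in>T. indicator (A s) (Y s) :: real)" "(\<Prod>s\<in>T. indicator (A s) (Y s) :: real) \<le> 1"
        for Y by (auto intro!: prod_nonneg prod_le_1)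
      have w02: "0 \<le> (\<Prod>s\<in>T. indicator (A s) (Y s) :: real) * f l \<and>
         (\<Prod>s\<in>T. indicator (A s) (Y s) :: real) * f l \<le> 2" for Y l
        using p01[of Y] f(2,3)[of l] mult_mono[of "\<Prod>s\<in>T. indicator (A s) (Y s) :: real" 1 "f l" 2] by auto
      then show "\<And>x. 0 \<le> (?i X x) * f (?L X x)"
        "\<And>x. 0 \<le> (?i X' x) * f (?L X' x)"
        by auto
      show "integrable M (\<lambda>x. (?i X x) * f (?L X x))"
        "integrable M' (\<lambda>x. (?i X' x) * f (?L X' x))"
        using mX mD w02
        by (auto intro!: finite_measure.integrable_const_bound[where B=2] prob_space.finite_measure M
          borel_measurable_times borel_measurable_prod
          measurable_compose[OF _ \<open>f \<in> borel_measurable borel\<close>])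
      fix t
      have expand: "(CLINT x|N. of_real ((?i Y x) * f (?L Y x)) * iexp (t * Y a x)) =
          k0 * (CLINT x|N. of_real (?i Y x) * iexp (t * Y a x + 0 * (?L Y x)))
        + k1 * (CLINT x|N. of_real (?i Y x) * iexp (t * Y a x + 1 * (?L Y x)))
        + k2 * (CLINT x|N. of_real (?i Y x) * iexp (t * Y a x + (-1) * (?L Y x)))"
        if N: "prob_space N" and mY: "\<And>s. s \<in> S \<Longrightarrow> Y s \<in> borel_measurable N"
        for N :: "'z measure" and Y
      proof -
        interpret N: prob_space N by fact
        have int: "integrable N (\<lambda>x. of_real (?i Y x) * iexp (t * Y a x + r * (?L Y x)))"
          for r
        proof (rule N.integrable_const_bound[where B=1])
          show "AE x in N. cmod (of_real (?i Y x) * iexp (t * Y a x + r * (?L Y x))) \<le> 1"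
            unfolding norm_mult norm_of_real using p01 by simp
          have "(\<lambda>x. \<Prod>s\<in>T. indicator (A s) (Y s x) :: real) \<in> borel_measurable N"
            using aS mY A by (auto intro!: borel_measurable_prod borel_measurable_indicator_comp)
          moreover have "(\<lambda>x. t * Y a x + r * (?L Y x)) \<in> borel_measurable N"
            using aS mY by (auto intro!: borel_measurable_sum borel_measurable_times borel_measurable_add)
          ultimately show "(\<lambda>x. of_real (?i Y x) * iexp (t * Y a x + r * (?L Y x))) \<in> borel_measurable N"
            by measurable
        qed
        define g where "g r x = complex_of_real (?i Y x) * iexp (t * Y a x + r * (?L Y x))"
          for r x
        have ig: "integrable N (g r)" for r unfolding g_def by (rule int)
        have pt: "of_real ((?i Y x) * f (?L Y x)) * iexp (t * Y a x) =
            k0 * g 0 x + k1 * g 1 x + k2 * g (-1) x" for x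
        proof -
          have e: "iexp (u + r * v) = iexp u * iexp (r * v)" for u r v
            by (simp add: exp_add distrib_left)
          have e1: "iexp (0 * v) = 1" "iexp (1 * v) = iexp v" "iexp (- 1 * v) = iexp (- v)" for v
            by simp_all
          show ?thesis unfolding g_def e e1 of_real_mult[of _ "f _"] f(1)
            by (simp only: ring_distribs mult_ac mult_1_right mult_1)
        qed
        show ?thesis unfolding pt g_def[symmetric] using ig by simp
      qed
      show "(CLINT x|M. of_real ((?i X x) * f (?L X x)) * iexp (t * X a x)) =
        (CLINT x|M'. of_real ((?i X' x) * f (?L X' x)) * iexp (t * X' a x))"
        using expand[of M X, OF M(1) meas(1)] expand[of M' X', OF M(2) meas(2)] IH[of t 0] IH[of t 1] IH[of t "-1"]
        by (simp only:)
    qed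
  qed
  have k0: "?I M X (\<lambda>_. 1) = ?I M' X' (\<lambda>_. 1)" by (rule key[of _ 1 0 0]) auto
  have k1: "?I M X (\<lambda>l. 1 + cos l) = ?I M' X' (\<lambda>l. 1 + cos l)"
  proof (rule key[of _ 1 "1/2" "1/2"])
    show "complex_of_real (1 + cos l) = 1 + 1 / 2 * iexp l + 1 / 2 * iexp (- l)" for l
      by (simp add: complex_eq_iff Re_exp Im_exp)
    show "0 \<le> 1 + cos l" for l :: real using cos_ge_minus_one[of l] by linarith
  qed simp
  have k2: "?I M X (\<lambda>l. 1 + sin l) = ?I M' X' (\<lambda>l. 1 + sin l)"
  proof (rule key[of _ 1 "- \<i> / 2" "\<i> / 2"])
    show "complex_of_real (1 + sin l) = 1 + - \<i> / 2 * iexp l + \<i> / 2 * iexp (- l)" for l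
      by (simp add: complex_eq_iff Re_exp Im_exp)
    show "0 \<le> 1 + sin l" for l :: real using sin_ge_minus_one[of l] by linarith
  qed simp
  \<comment> \<open>The exponential is rebuilt from nonnegative weights: its real part is
    \<open>(1 + cos l) - 1\<close> and its imaginary part is \<open>(1 + sin l) - 1\<close>.\<close>
  have fin: "(CLINT x|N. of_real (\<Prod>s\<in>insert a T. indicator (A s) (Y s x)) * iexp (\<Sum>s\<in>S - insert a T. c s * Y s x)) =
     of_real (?I N Y (\<lambda>l. 1 + cos l) - ?I N Y (\<lambda>_. 1)) + \<i> * of_real (?I N Y (\<lambda>l. 1 + sin l) - ?I N Y (\<lambda>_. 1))"
    if N: "prob_space N" and mY: "\<And>s. s \<in> S \<Longrightarrow> Y s \<in> borel_measurable N"
    for N :: "'z measure" and Y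
  proof -
    interpret N: prob_space N by fact
    let ?p = "\<lambda>x. \<Prod>s\<in>T. indicator (A s) (Y s x) :: real"
    let ?l = "\<lambda>x. \<Sum>s\<in>D. c s * Y s x"
    have mp: "?p \<in> borel_measurable N"
      using aS mY A by (auto intro!: borel_measurable_prod borel_measurable_indicator_comp)
    have ml: "?l \<in> borel_measurable N"
      using aS mY by (auto intro!: borel_measurable_sum borel_measurable_times)
    have ma: "(\<lambda>x. indicator (A a) (Y a x) :: real) \<in> borel_measurable N"
      using aS mY A by (auto intro!: borel_measurable_indicator_comp)
    have int: "integrable N (\<lambda>x. ?p x * f (?l x) * indicator (A a) (Y a x))"
      if "\<And>l. \<bar>f l\<bar> \<le> 1" "f \<in> borel_measurable borel" for f :: "real \<Rightarrow> real"
    proof (rule N.integrable_const_bound[where B=1])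
      show "(\<lambda>x. ?p x * f (?l x) * indicator (A a) (Y a x)) \<in> borel_measurable N"
        using mp ma measurable_compose[OF ml that(2)] by (intro borel_measurable_times) auto
      have "\<bar>?p x * f (?l x) * indicator (A a) (Y a x)\<bar> \<le> 1 * 1 * 1" for x
        unfolding abs_mult using that(1)
        by (intro mult_mono) (auto simp: abs_prod intro!: prod_le_1)
      then show "AE x in N. norm (?p x * f (?l x) * indicator (A a) (Y a x)) \<le> 1" by simp
    qed
    have i0: "integrable N (\<lambda>x. ?p x * indicator (A a) (Y a x))" using int[of "\<lambda>_. 1"] by simp
    have ic: "integrable N (\<lambda>x. ?p x * cos (?l x) * indicator (A a) (Y a x))"
      and isn: "integrable N (\<lambda>x. ?p x * sin (?l x) * indicator (A a) (Y a x))"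
      using int[of cos] int[of sin] by auto
    have "(CLINT x|N. of_real (\<Prod>s\<in>insert a T. indicator (A s) (Y s x)) * iexp (\<Sum>s\<in>S - insert a T. c s * Y s x)) =
      (CLINT x|N. complex_of_real (?p x * cos (?l x) * indicator (A a) (Y a x)) + \<i> * complex_of_real (?p x * sin (?l x) * indicator (A a) (Y a x)))"
      unfolding D_def[symmetric] using insert(1,2)
      by (intro Bochner_Integration.integral_cong refl)
        (simp add: complex_eq_iff Re_exp Im_exp)
    also have "\<dots> = (CLINT x|N. complex_of_real (?p x * cos (?l x) * indicator (A a) (Y a x)))
       + \<i> * (CLINT x|N. complex_of_real (?p x * sin (?l x) * indicator (A a) (Y a x)))"
      using ic isn by (subst Bochner_Integration.integral_add)
        (auto intro!: integrable_mult_right complex_of_real_integrable_eq[THEN iffD2] simp del: of_real_mult)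
    also have "\<dots> = of_real (\<integral>x. ?p x * cos (?l x) * indicator (A a) (Y a x) \<partial>N)
       + \<i> * of_real (\<integral>x. ?p x * sin (?l x) * indicator (A a) (Y a x) \<partial>N)"
      by (simp only: integral_complex_of_real)
    also have "(\<integral>x. ?p x * cos (?l x) * indicator (A a) (Y a x) \<partial>N) = ?I N Y (\<lambda>l. 1 + cos l) - ?I N Y (\<lambda>_. 1)"
      using Bochner_Integration.integral_add[OF i0 ic] by (simp add: algebra_simps)
    also have "(\<integral>x. ?p x * sin (?l x) * indicator (A a) (Y a x) \<partial>N) = ?I N Y (\<lambda>l. 1 + sin l) - ?I N Y (\<lambda>_. 1)"
      using Bochner_Integration.integral_add[OF i0 isn] by (simp add: algebra_simps)
    finally show ?thesis .
  qed
  show ?case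
    using fin[of M X, OF M(1) meas(1)] fin[of M' X', OF M(2) meas(2)] k0 k1 k2 by (simp only:)
qed

text \<open>Once all coordinates have been replaced by indicators no exponential factor is left, so
  the previous lemma equates the probabilities of boxes, and these determine a law on a finite
  product.\<close>

theorem cramer_wold:
  fixes X :: "'s \<Rightarrow> 'a \<Rightarrow> real" and X' :: "'s \<Rightarrow> 'b \<Rightarrow> real"
  assumes M: "prob_space M" "prob_space M'" and S: "finite S"
    and meas: "\<And>s. s \<in> S \<Longrightarrow> X s \<in> borel_measurable M" "\<And>s. s \<in> S \<Longrightarrow> X' s \<in> borel_measurable M'"
    and eq: "\<And>c. (CLINT x|M. iexp (\<Sum>s\<in>S. c s * X s x)) = (CLINT x|M'. iexp (\<Sum>s\<in>S. c s * X' s x))"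
  shows "distr M (PiM S (\<lambda>_. borel)) (\<lambda>x. \<lambda>s\<in>S. X s x) = distr M' (PiM S (\<lambda>_. borel)) (\<lambda>x. \<lambda>s\<in>S. X' s x)"
proof (rule measure_eqI_PiM_finite[where A="\<lambda>_. space (PiM S (\<lambda>_. borel))"])
  interpret M: prob_space M by fact
  interpret M': prob_space M' by fact
  have m: "(\<lambda>x. \<lambda>s\<in>S. X s x) \<in> measurable M (PiM S (\<lambda>_. borel))"
    "(\<lambda>x. \<lambda>s\<in>S. X' s x) \<in> measurable M' (PiM S (\<lambda>_. borel))"
    using meas by (auto intro!: measurable_restrict)
  interpret D: prob_space "distr M (PiM S (\<lambda>_. borel)) (\<lambda>x. \<lambda>s\<in>S. X s x)"
    using m(1) by (rule M.prob_space_distr)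
  show "emeasure (distr M (PiM S (\<lambda>_. borel)) (\<lambda>x. \<lambda>s\<in>S. X s x)) (space (PiM S (\<lambda>_. borel))) \<noteq> \<infinity>"
    using D.emeasure_finite by simp
  show "range (\<lambda>_. space (Pi\<^sub>M S (\<lambda>_. borel))) \<subseteq> prod_algebra S (\<lambda>_. borel :: real measure)"
    using space_in_prod_algebra[of S "\<lambda>_. borel :: real measure"]
      by (auto simp: space_PiM)
  fix A :: "'s \<Rightarrow> real set" assume A: "\<And>s. s \<in> S \<Longrightarrow> A s \<in> sets borel"
  have box: "emeasure (distr N (PiM S (\<lambda>_. borel)) (\<lambda>x. \<lambda>s\<in>S. Y s x)) (Pi\<^sub>E S A) =
     ennreal (\<integral>x. (\<Prod>s\<in>S. indicator (A s) (Y s x)) \<partial>N)"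
    if N: "prob_space N" and mY: "\<And>s. s \<in> S \<Longrightarrow> Y s \<in> borel_measurable N"
    for N :: "'z measure" and Y
  proof -
    interpret N: prob_space N by fact
    have m: "(\<lambda>x. \<lambda>s\<in>S. Y s x) \<in> measurable N (PiM S (\<lambda>_. borel))"
      using mY by (auto intro!: measurable_restrict)
    let ?B = "(\<lambda>x. \<lambda>s\<in>S. Y s x) -` Pi\<^sub>E S A \<inter> space N"
    have PA: "Pi\<^sub>E S A \<in> sets (PiM S (\<lambda>_. borel))" using A S by (intro sets_PiM_I_finite) auto
    have "emeasure (distr N (PiM S (\<lambda>_. borel)) (\<lambda>x. \<lambda>s\<in>S. Y s x)) (Pi\<^sub>E S A) = emeasure N ?B"
      using m PA by (rule emeasure_distr)
    also have "\<dots> = ennreal (measure N ?B)" by (rule N.emeasure_eq_measure)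
    also have "measure N ?B = (\<integral>x. indicator ?B x \<partial>N)"
      using measurable_sets[OF m PA] by simp
    also have "\<dots> = (\<integral>x. (\<Prod>s\<in>S. indicator (A s) (Y s x)) \<partial>N)"
      using S by (intro Bochner_Integration.integral_cong refl)
        (auto simp: indicator_def PiE_iff prod_eq_1_iff split: if_splits)
    finally show ?thesis .
  qed
  have "complex_of_real (\<integral>x. (\<Prod>s\<in>S. indicator (A s) (X s x)) \<partial>M) = complex_of_real (\<integral>x. (\<Prod>s\<in>S. indicator (A s) (X' s x)) \<partial>M')"
    using cramer_wold_step[OF M S meas eq A S subset_refl, where c="\<lambda>_. 0"]
    unfolding integral_complex_of_real[symmetric] by simp
  then show "emeasure (distr M (PiM S (\<lambda>_. borel)) (\<lambda>x. \<lambda>s\<in>S. X s x)) (Pi\<^sub>E S A) =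
     emeasure (distr M' (PiM S (\<lambda>_. borel)) (\<lambda>x. \<lambda>s\<in>S. X' s x)) (Pi\<^sub>E S A)"
    using box[of M X, OF M(1) meas(1)] box[of M' X', OF M(2) meas(2)] by simp
qed (use S in auto)

section \<open>Gaussian trees: upper tail\<close>

lemma nn_integral_exp_std_normal:
  "(\<integral>\<^sup>+x. ennreal (exp (t * x)) \<partial>std_normal_distribution) = ennreal (exp (t\<^sup>2 / 2))"
proof -
  have *: "std_normal_density x * exp (t * x) = exp (t\<^sup>2 / 2) * normal_density t 1 x" for x
    by (simp add: normal_density_def exp_add[symmetric] power2_eq_square field_simps)
  have "(\<integral>\<^sup>+x. ennreal (exp (t * x)) \<partial>std_normal_distribution) =
     (\<integral>\<^sup>+x. ennreal (exp (t\<^sup>2 / 2)) * ennreal (normal_density t 1 x) \<partial>lborel)"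
    by (subst nn_integral_density) (simp_all add: ennreal_mult'[symmetric] *)
  also have "\<dots> = ennreal (exp (t\<^sup>2 / 2)) * (\<integral>\<^sup>+x. ennreal (normal_density t 1 x) \<partial>lborel)"
    by (rule nn_integral_cmult) simp
  also have "(\<integral>\<^sup>+x. ennreal (normal_density t 1 x) \<partial>lborel) = ennreal 1"
    by (subst nn_integral_eq_integral) auto
  finally show ?thesis by simp
qed

text \<open>On \<open>{y..y+1}\<close> the density is at least its value at the right end. The loss
  against the true tail is a factor \<open>exp (- y)\<close> up to constants, harmless for
  \<open>y\<close> of order \<open>sqrt N\<close>.\<close>

lemma std_normal_tail_ge:
  assumes "0 \<le> y"
  shows "exp (- (y + 1)\<^sup>2 / 2) / sqrt (2 * pi) \<le> measure std_normal_distribution {y..}"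
proof -
  interpret prob_space std_normal_distribution
    using real_dist_normal_dist by (simp add: real_distribution_def)
  let ?c = "exp (- (y + 1)\<^sup>2 / 2) / sqrt (2 * pi)"
  have "ennreal ?c = (\<integral>\<^sup>+x. ennreal ?c * indicator {y..y+1} x \<partial>lborel)"
    by (simp add: nn_integral_cmult_indicator)
  also have "\<dots> \<le> (\<integral>\<^sup>+x. ennreal (std_normal_density x) * indicator {y..} x \<partial>lborel)"
  proof (intro nn_integral_mono)
    fix x
    show "ennreal ?c * indicator {y..y+1} x \<le> ennreal (std_normal_density x) * indicator {y..} x"
    proof (cases "x \<in> {y..y+1}")
      case True
      then have "x\<^sup>2 \<le> (y + 1)\<^sup>2" using assms by (intro power_mono) auto
      then have "?c \<le> std_normal_density x"
        by (simp add: normal_density_def divide_simps)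
      then show ?thesis using True by (simp add: ennreal_leI)
    qed simp
  qed
  also have "\<dots> = emeasure std_normal_distribution {y..}" by (simp add: emeasure_density)
  finally show ?thesis by (simp add: emeasure_eq_measure)
qed

section \<open>Families of independent standard normal variables\<close>

definition gauss :: "'i set \<Rightarrow> ('i \<Rightarrow> real) measure" where
  "gauss I = PiM I (\<lambda>_. std_normal_distribution)"

lemma std_normal_prob: "prob_space std_normal_distribution"
  using real_dist_normal_dist by (simp add: real_distribution_def)

lemma prob_space_gauss: "prob_space (gauss I)"
  unfolding gauss_def by (intro prob_space_PiM std_normal_prob)

lemma space_gauss: "space (gauss I) = Pi\<^sub>E I (\<lambda>_. UNIV)"
  by (simp add: gauss_def space_PiM)

lemma measurable_gauss_component:
  "i \<in> I \<Longrightarrow> (\<lambda>x. x i) \<in> borel_measurable (gauss I)"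
  unfolding gauss_def
  by (metis measurable_component_singleton measurable_cong_sets sets_density sets_lborel)

lemma char_gauss:
  assumes "finite I"
  shows "(CLINT x|gauss I. iexp (\<Sum>i\<in>I. d i * x i)) = of_real (exp (- (\<Sum>i\<in>I. (d i)\<^sup>2) / 2))"
proof -
  interpret product_sigma_finite "\<lambda>_::'a. std_normal_distribution"
    by (intro product_sigma_finite.intro prob_space_imp_sigma_finite std_normal_prob)
  interpret N: prob_space std_normal_distribution by (rule std_normal_prob)
  have "(CLINT x|gauss I. iexp (\<Sum>i\<in>I. d i * x i)) = (CLINT x|gauss I. (\<Prod>i\<in>I. iexp (d i * x i)))"
    by (simp add: exp_sum[OF assms, symmetric] sum_distrib_left)
  also have "\<dots> = (\<Prod>i\<in>I. (CLINT y|std_normal_distribution. iexp (d i * y)))"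
    unfolding gauss_def using assms
    by (intro product_integral_prod N.integrable_iexp) auto
  also have "\<dots> = (\<Prod>i\<in>I. complex_of_real (exp (- (d i)\<^sup>2 / 2)))"
    using char_std_normal_distribution unfolding char_def fun_eq_iff by simp
  also have "\<dots> = of_real (\<Prod>i\<in>I. exp (- (d i)\<^sup>2 / 2))" by simp
  also have "(\<Prod>i\<in>I. exp (- (d i)\<^sup>2 / 2)) = exp (- (\<Sum>i\<in>I. (d i)\<^sup>2) / 2)"
    by (subst exp_sum[OF assms, symmetric]) (simp add: sum_negf sum_divide_distrib)
  finally show ?thesis .
qed

text \<open>Tonelli in the coordinate \<open>i\<close>. That \<open>F\<close> depends on the other
  coordinates alone is stated as invariance under updating \<open>i\<close>, which for the energies
  of a tree is immediate.\<close>

lemma gauss_nn_integral_indep: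
  assumes I: "finite I" "i \<in> I"
    and F[measurable]: "F \<in> borel_measurable (gauss I)" and g[measurable]: "g \<in> borel_measurable borel"
    and indep: "\<And>x y. F (x (i := y)) = F x"
  shows "(\<integral>\<^sup>+x. F x * g (x i) \<partial>gauss I) =
     (\<integral>\<^sup>+x. F x \<partial>gauss I) * (\<integral>\<^sup>+y. g y \<partial>std_normal_distribution)"
proof -
  interpret product_sigma_finite "\<lambda>_::'a. std_normal_distribution"
    by (intro product_sigma_finite.intro prob_space_imp_sigma_finite std_normal_prob)
  interpret N: prob_space std_normal_distribution by (rule std_normal_prob)
  have N1: "emeasure std_normal_distribution UNIV = 1" using N.emeasure_space_1 by simp
  define J where "J = I - {i}"
  have J: "I = insert i J" "i \<notin> J" "finite J" using I by (auto simp: J_def)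
  have [measurable]: "(\<lambda>x. x i) \<in> borel_measurable (gauss I)"
    by (rule measurable_gauss_component[OF I(2)])
  have 1: "(\<integral>\<^sup>+x. F x * g (x i) \<partial>gauss I) =
     (\<integral>\<^sup>+x. (\<integral>\<^sup>+y. F x * g y \<partial>std_normal_distribution) \<partial>gauss J)"
    unfolding gauss_def J(1) using J I F
    by (subst product_nn_integral_insert) (auto simp: indep gauss_def[symmetric] J(1)[symmetric])
  have 2: "(\<integral>\<^sup>+x. F x \<partial>gauss I) = (\<integral>\<^sup>+x. F x \<partial>gauss J)"
    unfolding gauss_def J(1) using J I F
    by (subst product_nn_integral_insert)
      (auto simp: indep gauss_def[symmetric] J(1)[symmetric] N1)
  have FJ: "F \<in> borel_measurable (gauss J)"
  proof -
    \<comment> \<open>The value 0 at \<open>i\<close> is arbitrary: \<open>F\<close> ignores it, so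
      its measurability passes to the smaller index set.\<close>
    have "(\<lambda>x. x (i := 0)) \<in> measurable (gauss J) (gauss I)"
      unfolding gauss_def J(1)
      by (rule measurable_fun_upd[where J=J]) auto
    from measurable_compose[OF this F] show ?thesis by (simp add: indep)
  qed
  show ?thesis unfolding 1 2 using FJ
    by (simp add: nn_integral_cmult nn_integral_multc)
qed

lemma gauss_box:
  assumes "finite I" "F \<subseteq> I" "\<And>i. i \<in> F \<Longrightarrow> W i \<in> sets borel"
  shows "measure (gauss I) {x \<in> space (gauss I). \<forall>i\<in>F. x i \<in> W i} =
     (\<Prod>i\<in>F. measure std_normal_distribution (W i))"
proof -
  interpret product_prob_space "\<lambda>_::'a. std_normal_distribution" I
    by (intro product_prob_spaceI std_normal_prob)
  interpret finite_product_prob_space "\<lambda>_::'a. std_normal_distribution" I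
    by unfold_locales fact
  let ?W = "\<lambda>i. if i \<in> F then W i else UNIV"
  have eq: "{x \<in> space (gauss I). \<forall>i\<in>F. x i \<in> W i} = Pi\<^sub>E I ?W"
    using assms(2) by (auto simp: space_gauss PiE_iff extensional_def split: if_splits)
  have "measure (gauss I) (Pi\<^sub>E I ?W) = (\<Prod>i\<in>I. measure std_normal_distribution (?W i))"
    unfolding gauss_def using assms(3) by (intro prob_times) auto
  also have "\<dots> = (\<Prod>i\<in>F. measure std_normal_distribution (W i))"
    using prob_space.prob_space[OF std_normal_prob] assms(1,2)
    by (intro prod.mono_neutral_cong_right) (auto split: if_splits)
  finally show ?thesis unfolding eq .
qed

lemma ennreal_sum_mult:
  assumes "\<And>i. i \<in> I \<Longrightarrow> 0 \<le> f i" "\<And>i. i \<in> I \<Longrightarrow> 0 \<le> g i"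
  shows "(\<Sum>i\<in>I. ennreal (f i) * ennreal (g i)) = ennreal (\<Sum>i\<in>I. f i * g i)"
proof -
  have "(\<Sum>i\<in>I. ennreal (f i) * ennreal (g i)) = (\<Sum>i\<in>I. ennreal (f i * g i))"
    using assms by (intro sum.cong refl ennreal_mult[symmetric]) auto
  then show ?thesis using assms by (simp add: sum_ennreal)
qed

lemma sum_PiE_insert:
  assumes "k \<notin> S"
  shows "(\<Sum>v\<in>Pi\<^sub>E (insert k S) B. f v) = (\<Sum>u\<in>Pi\<^sub>E S B. \<Sum>b\<in>B k. f (u(k := b)))"
proof -
  have "(\<Sum>v\<in>Pi\<^sub>E (insert k S) B. f v) = (\<Sum>(b, u)\<in>B k \<times> Pi\<^sub>E S B. f (u(k := b)))"
    unfolding PiE_insert_eq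
    by (subst sum.reindex[OF inj_combinator[OF assms]]) (simp add: case_prod_unfold)
  also have "\<dots> = (\<Sum>b\<in>B k. \<Sum>u\<in>Pi\<^sub>E S B. f (u(k := b)))" by (simp add: sum.cartesian_product)
  also have "\<dots> = (\<Sum>u\<in>Pi\<^sub>E S B. \<Sum>b\<in>B k. f (u(k := b)))" by (rule sum.swap)
  finally show ?thesis .
qed

text \<open>The \<open>p\<close>-norm of a finite family decreases in \<open>p\<close>. Every
  \<open>e v\<close> is at most \<open>ln S / p\<close>, the logarithm of the \<open>p\<close>-norm;
  apply this to the part \<open>(p' - p) * e v\<close> of the exponent.\<close>

lemma ln_sum_exp_mono:
  assumes V: "finite V" "V \<noteq> {}" and p: "0 < p" "p \<le> (p' :: real)"
  shows "ln (\<Sum>v\<in>V. exp (p' * e v)) / p' \<le> ln (\<Sum>v\<in>V. exp (p * e v)) / p"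
proof -
  define S where "S = (\<Sum>v\<in>V. exp (p * e v))"
  have S: "0 < S" unfolding S_def using V by (intro sum_pos) auto
  have e: "e v \<le> ln S / p" if "v \<in> V" for v
  proof -
    have "exp (p * e v) \<le> S" unfolding S_def using that V by (intro member_le_sum) auto
    then have "p * e v \<le> ln S" using S by (simp add: ln_ge_iff)
    then show ?thesis using p by (simp add: field_simps)
  qed
  have "(\<Sum>v\<in>V. exp (p' * e v)) \<le> (\<Sum>v\<in>V. exp (p * e v) * exp ((p' - p) * (ln S / p)))"
  proof (intro sum_mono)
    fix v assume "v \<in> V"
    then have "(p' - p) * e v \<le> (p' - p) * (ln S / p)" using e p by (intro mult_left_mono) auto
    then show "exp (p' * e v) \<le> exp (p * e v) * exp ((p' - p) * (ln S / p))"
      unfolding exp_add[symmetric] by (simp add: algebra_simps)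
  qed
  also have "\<dots> = S * exp ((p' - p) * (ln S / p))" by (simp add: S_def sum_distrib_right)
  finally have "ln (\<Sum>v\<in>V. exp (p' * e v)) \<le> ln (S * exp ((p' - p) * (ln S / p)))"
    using V by (intro ln_mono) (auto intro!: sum_pos)
  also have "\<dots> = p' * (ln S / p)" using S p by (simp add: ln_mult field_simps)
  finally show ?thesis using p by (simp add: S_def field_simps)
qed

section \<open>Partition sums over a tree with Gaussian nodes\<close>

locale tree =
  fixes n :: nat and B :: "nat \<Rightarrow> 'b set"
  assumes finB: "\<And>k. finite (B k)" and neB: "\<And>k. B k \<noteq> {}"
begin

definition V :: "nat \<Rightarrow> (nat \<Rightarrow> 'b) set" where "V k = Pi\<^sub>E {1..k} B"

text \<open>A node is a level together with a prefix of labels, so two branches meet the same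
  Gaussian at level \<open>k\<close> exactly when their first \<open>k\<close> labels agree.
  Restricting inside the definition lets it act on branches of any greater length.\<close>

definition nd :: "nat \<Rightarrow> (nat \<Rightarrow> 'b) \<Rightarrow> nat \<times> (nat \<Rightarrow> 'b)" where
  "nd k v = (k, restrict v {1..k})"

definition nodes :: "(nat \<times> (nat \<Rightarrow> 'b)) set" where "nodes = (SIGMA k:{1..n}. V k)"

lemma finV: "finite (V k)" unfolding V_def using finB by (intro finite_PiE) auto

lemma neV: "V k \<noteq> {}" unfolding V_def using neB by (simp add: PiE_eq_empty_iff)

abbreviation "P \<equiv> gauss nodes"

lemma fin_nodes: "finite nodes" unfolding nodes_def using finV by auto

lemma nd_nodes: "1 \<le> j \<Longrightarrow> j \<le> k \<Longrightarrow> k \<le> n \<Longrightarrow> v \<in> V k \<Longrightarrow> nd j v \<in> nodes"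
  by (auto simp: nd_def nodes_def V_def PiE_iff)

lemma sum_V_Suc: "(\<Sum>v\<in>V (Suc k). f v) = (\<Sum>u\<in>V k. \<Sum>b\<in>B (Suc k). f (u(Suc k := b)))"
  unfolding V_def using sum_PiE_insert[of "Suc k" "{1..k}" f B]
  by (simp add: atLeastAtMostSuc_conv)

definition energy ::
  "(nat \<Rightarrow> 'b \<Rightarrow> real) \<Rightarrow> (nat \<Rightarrow> real) \<Rightarrow> nat \<Rightarrow> (nat \<Rightarrow> 'b) \<Rightarrow> (nat \<times> (nat \<Rightarrow> 'b) \<Rightarrow> real) \<Rightarrow> real" where
  "energy a s k v x = (\<Sum>j=1..k. a j (v j) + s j * x (nd j v))"

lemma energy_measurable:
  "k \<le> n \<Longrightarrow> v \<in> V k \<Longrightarrow> energy a s k v \<in> borel_measurable P"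
  unfolding energy_def using nd_nodes
  by (intro borel_measurable_sum borel_measurable_add borel_measurable_times borel_measurable_const
      measurable_gauss_component) auto

lemma energy_upd_node: "k < j \<Longrightarrow> energy a s k v (x ((j, u) := y)) = energy a s k v x"
  unfolding energy_def nd_def by (intro sum.cong) auto

lemma energy_upd_config: "k < j \<Longrightarrow> energy a s k (v(j := b)) x = energy a s k v x"
proof -
  assume "k < j"
  then have "restrict (v(j := b)) {1..i} = restrict v {1..i}" if "i \<le> k" for i
    using that by (auto simp: restrict_def)
  then show ?thesis using \<open>k < j\<close> unfolding energy_def nd_def by (intro sum.cong) auto
qed

definition Rsum where "Rsum a s p k x = (\<Sum>v\<in>V k. exp (p * energy a s k v x))"

lemma Rsum_pos: "0 < Rsum a s p k x"
  unfolding Rsum_def using finV neV by (intro sum_pos) auto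

lemma Rsum_measurable: "k \<le> n \<Longrightarrow> Rsum a s p k \<in> borel_measurable P"
  unfolding Rsum_def using energy_measurable
  by (intro borel_measurable_sum measurable_compose[OF _ borel_measurable_exp]
      borel_measurable_times borel_measurable_const) auto

text \<open>The mean of the total weight, to the power \<open>p\<close>, that the children of a
  single node contribute relative to that node.\<close>

definition Kfac :: "(nat \<Rightarrow> 'b \<Rightarrow> real) \<Rightarrow> (nat \<Rightarrow> real) \<Rightarrow> real \<Rightarrow> nat \<Rightarrow> real" where
  "Kfac a s p k = (\<Sum>b\<in>B k. exp (p * a k b)) * exp (p\<^sup>2 * (s k)\<^sup>2 / 2)"

lemma Kfac_pos: "0 < Kfac a s p k"
  unfolding Kfac_def using finB neB by (intro mult_pos_pos sum_pos) auto

text \<open>Conditionally on the first \<open>k\<close> levels every child carries a fresh Gaussian,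
  so the mean of the sum on the next level is \<open>Kfac\<close> times the parent sum at the same
  exponent. Dividing by that random quantity inside the integral avoids conditional
  expectations.\<close>

lemma level_ratio_expectation:
  assumes k: "Suc k \<le> n"
  shows "(\<integral>\<^sup>+x. ennreal (Rsum a s p (Suc k) x / (Kfac a s p (Suc k) * Rsum a s p k x)) \<partial>P) = 1"
proof -
  interpret P: prob_space "P" by (rule prob_space_gauss)
  let ?D = "\<lambda>x. Kfac a s p (Suc k) * Rsum a s p k x"
  let ?F = "\<lambda>v x. exp (p * (energy a s k v x + a (Suc k) (v (Suc k)))) / ?D x"
  let ?e = "exp ((p * s (Suc k))\<^sup>2 / 2)"
  have D: "0 < ?D x" for x using Kfac_pos Rsum_pos by simp
  have enm: "energy a s k v \<in> borel_measurable P" if "v \<in> V (Suc k)" for v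
  proof -
    have "nd j v \<in> nodes" if "j \<in> {1..k}" for j
      using nd_nodes[of j "Suc k" v] that k \<open>v \<in> V (Suc k)\<close> by auto
    then show ?thesis unfolding energy_def
      by (intro borel_measurable_sum borel_measurable_add borel_measurable_times borel_measurable_const
          measurable_gauss_component) auto
  qed
  have Fm: "?F v \<in> borel_measurable P" if "v \<in> V (Suc k)" for v
  proof -
    have [measurable]: "energy a s k v \<in> borel_measurable P" by (rule enm[OF that])
    have [measurable]: "Rsum a s p k \<in> borel_measurable P"
      by (rule Rsum_measurable) (use k in linarith)
    show ?thesis
      by (rule borel_measurable_divide[OF measurable_compose[OF _ borel_measurable_exp]]) simp_all
  qed
  have en: "energy a s (Suc k) v x = energy a s k v x + a (Suc k) (v (Suc k)) + s (Suc k) * x (nd (Suc k) v)" for v x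
    by (simp add: energy_def)
  have dec: "Rsum a s p (Suc k) x / ?D x = (\<Sum>v\<in>V (Suc k). ?F v x * exp ((p * s (Suc k)) * x (nd (Suc k) v)))" for x
    unfolding Rsum_def[of a s p "Suc k"] sum_divide_distrib en
    by (intro sum.cong refl) (simp add: exp_add[symmetric] algebra_simps)
  have "(\<integral>\<^sup>+x. ennreal (Rsum a s p (Suc k) x / ?D x) \<partial>P) =
     (\<integral>\<^sup>+x. (\<Sum>v\<in>V (Suc k). ennreal (?F v x) * ennreal (exp ((p * s (Suc k)) * x (nd (Suc k) v)))) \<partial>P)"
    unfolding dec using D
    by (intro nn_integral_cong ennreal_sum_mult[symmetric]) (auto intro!: divide_nonneg_pos)
  also have "\<dots> = (\<Sum>v\<in>V (Suc k). \<integral>\<^sup>+x. ennreal (?F v x) * ennreal (exp ((p * s (Suc k)) * x (nd (Suc k) v))) \<partial>P)"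
  proof (intro nn_integral_sum)
    fix v assume v: "v \<in> V (Suc k)"
    have [measurable]: "?F v \<in> borel_measurable P" by (rule Fm[OF v])
    have [measurable]: "(\<lambda>x. x (nd (Suc k) v)) \<in> borel_measurable P"
      by (rule measurable_gauss_component, rule nd_nodes[OF _ _ _ v]) (use k in simp_all)
    show "(\<lambda>x. ennreal (?F v x) * ennreal (exp ((p * s (Suc k)) * x (nd (Suc k) v)))) \<in> borel_measurable P"
      by measurable
  qed
  also have "\<dots> = (\<Sum>v\<in>V (Suc k). (\<integral>\<^sup>+x. ennreal (?F v x) \<partial>P) * ennreal ?e)"
  proof (intro sum.cong refl)
    fix v assume v: "v \<in> V (Suc k)"
    have "(\<integral>\<^sup>+x. ennreal (?F v x) * ennreal (exp ((p * s (Suc k)) * x (nd (Suc k) v))) \<partial>P) =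
      (\<integral>\<^sup>+x. ennreal (?F v x) \<partial>P) * (\<integral>\<^sup>+y. ennreal (exp ((p * s (Suc k)) * y)) \<partial>std_normal_distribution)"
    proof (rule gauss_nn_integral_indep[where i="nd (Suc k) v"])
      show "(\<lambda>x. ennreal (?F v x)) \<in> borel_measurable P"
        using Fm[OF v] by (rule measurable_compose[OF _ measurable_ennreal])
      \<comment> \<open>Numerator and denominator of \<open>?F v\<close> involve only nodes of level
        at most \<open>k\<close>.\<close>
      show "ennreal (?F v (x (nd (Suc k) v := y))) = ennreal (?F v x)" for x y
        by (simp add: nd_def energy_upd_node Rsum_def)
    qed (use fin_nodes nd_nodes[of "Suc k" "Suc k" v] v k in auto)
    then show "(\<integral>\<^sup>+x. ennreal (?F v x) * ennreal (exp ((p * s (Suc k)) * x (nd (Suc k) v))) \<partial>P) =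
      (\<integral>\<^sup>+x. ennreal (?F v x) \<partial>P) * ennreal ?e"
      by (simp only: nn_integral_exp_std_normal)
  qed
  also have "\<dots> = (\<Sum>v\<in>V (Suc k). \<integral>\<^sup>+x. ennreal (?F v x) * ennreal ?e \<partial>P)"
    using Fm by (intro sum.cong refl nn_integral_multc[symmetric] measurable_compose[OF _ measurable_ennreal])
  also have "\<dots> = (\<integral>\<^sup>+x. (\<Sum>v\<in>V (Suc k). ennreal (?F v x) * ennreal ?e) \<partial>P)"
    using Fm by (intro nn_integral_sum[symmetric] borel_measurable_times_ennreal measurable_compose[OF _ measurable_ennreal]) auto
  also have "\<dots> = (\<integral>\<^sup>+x. ennreal 1 \<partial>P)"
  proof (intro nn_integral_cong)
    fix x
    \<comment> \<open>Summing over the last label first factors the sum into the parent sum and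
      \<open>Kfac\<close>, which is the denominator.\<close>
    have "(\<Sum>v\<in>V (Suc k). exp (p * (energy a s k v x + a (Suc k) (v (Suc k))))) * ?e = ?D x"
      unfolding sum_V_Suc
      by (simp add: energy_upd_config distrib_left exp_add sum_distrib_left[symmetric]
          sum_distrib_right[symmetric] Rsum_def Kfac_def power_mult_distrib)
    then have "(\<Sum>v\<in>V (Suc k). exp (p * (energy a s k v x + a (Suc k) (v (Suc k))))) * ?e / ?D x = 1"
      using divide_self[OF less_imp_neq[OF D[of x], symmetric]] by (simp only:)
    then have "(\<Sum>v\<in>V (Suc k). ?F v x * ?e) = 1"
      by (simp only: sum_distrib_right sum_divide_distrib times_divide_eq_left)
    moreover have "(\<Sum>v\<in>V (Suc k). ennreal (?F v x) * ennreal ?e) = ennreal (\<Sum>v\<in>V (Suc k). ?F v x * ?e)"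
      using D[of x] by (intro ennreal_sum_mult) (auto intro!: divide_nonneg_pos)
    ultimately show "(\<Sum>v\<in>V (Suc k). ennreal (?F v x) * ennreal ?e) = ennreal 1" by simp
  qed
  finally show ?thesis by (simp add: P.emeasure_space_1)
qed

text \<open>Each level may exceed its mean growth by a factor \<open>exp r\<close>, which costs
  probability \<open>exp (- r)\<close>; the union bound gives the factor \<open>n\<close>. Outside
  the bad events the logarithms are telescoped, and nondecreasing exponents let
  \<open>ln_sum_exp_mono\<close> change the exponent from one level to the preceding one.\<close>

theorem upper_tail:
  assumes p: "\<And>k. k \<in> {1..n} \<Longrightarrow> 0 < p k \<and> p k \<le> 1"
    and mono: "\<And>j k. j \<in> {1..n} \<Longrightarrow> k \<in> {1..n} \<Longrightarrow> j \<le> k \<Longrightarrow> p j \<le> (p k :: real)"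
  shows "measure P {x \<in> space P.
      (\<Sum>k=1..n. (r + ln (Kfac a s (p k) k)) / p k) < ln (Rsum a s 1 n x)} \<le> real n * exp (- r)"
proof -
  interpret P: prob_space "P" by (rule prob_space_gauss)
  let ?Q = "\<lambda>k x. Rsum a s (p k) k x / (Kfac a s (p k) k * Rsum a s (p k) (k - 1) x)"
  define bad where "bad k = {x \<in> space P. exp r \<le> ?Q k x}" for k
  have Qm: "?Q k \<in> borel_measurable P" if "k \<in> {1..n}" for k
    using that Rsum_measurable[of k] Rsum_measurable[of "k - 1"]
    by (intro borel_measurable_divide borel_measurable_times borel_measurable_const) auto
  have bad_sets: "bad k \<in> sets P" if "k \<in> {1..n}" for k
    unfolding bad_def using Qm[OF that] by measurable
  have bad: "measure P (bad k) \<le> exp (- r)" if k: "k \<in> {1..n}" for k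
  proof -
    have exp1: "1 \<le> exp (- r) * y \<longleftrightarrow> exp r \<le> y" for y :: real
      by (simp add: exp_minus field_simps)
    have "emeasure P (bad k) = emeasure P {x \<in> space P. 1 \<le> ennreal (exp (- r)) * ennreal (?Q k x)}"
    proof (rule arg_cong[where f="emeasure _"], unfold bad_def, intro Collect_cong conj_cong refl)
      fix x
      have "0 \<le> ?Q k x" using Rsum_pos[of a s "p k"] Kfac_pos[of a s "p k" k] by (simp add: less_imp_le)
      then have "1 \<le> ennreal (exp (- r)) * ennreal (?Q k x) \<longleftrightarrow> 1 \<le> exp (- r) * ?Q k x"
        by (simp add: ennreal_mult''[symmetric] del: times_divide_eq_right)
      also have "\<dots> \<longleftrightarrow> exp r \<le> ?Q k x"
        by (rule exp1)
      finally show "exp r \<le> ?Q k x \<longleftrightarrow> 1 \<le> ennreal (exp (- r)) * ennreal (?Q k x)" by simp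
    qed
    also have "\<dots> \<le> ennreal (exp (- r)) * (\<integral>\<^sup>+x. ennreal (?Q k x) * indicator (space P) x \<partial>P)"
      using measurable_compose[OF Qm[OF k] measurable_ennreal]
      by (intro order_trans[OF _ nn_integral_Markov_inequality]) (auto intro!: emeasure_mono)
    also have "(\<integral>\<^sup>+x. ennreal (?Q k x) * indicator (space P) x \<partial>P) = (\<integral>\<^sup>+x. ennreal (?Q k x) \<partial>P)"
      by (intro nn_integral_cong) simp
    also have "\<dots> = 1" using level_ratio_expectation[of "k - 1" a s "p k"] k by simp
    finally show ?thesis by (simp add: P.emeasure_eq_measure)
  qed
  have good: "ln (Rsum a s (p k) k x) / p k \<le> (\<Sum>j=1..k. (r + ln (Kfac a s (p j) j)) / p j)"
    if x: "x \<in> space P" "\<forall>k\<in>{1..n}. x \<notin> bad k" and k: "k \<in> {1..n}" for x k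
    using k
  proof (induction k)
    case (Suc k)
    have pos: "0 < p (Suc k)" using p Suc.prems by auto
    have "?Q (Suc k) x < exp r"
    proof -
      have "x \<notin> bad (Suc k)" using x(2) Suc.prems by blast
      then show ?thesis using x(1) by (simp add: bad_def not_le)
    qed
    then have "Rsum a s (p (Suc k)) (Suc k) x < exp r * (Kfac a s (p (Suc k)) (Suc k) * Rsum a s (p (Suc k)) k x)"
      using Kfac_pos[of a s "p (Suc k)" "Suc k"] Rsum_pos[of a s "p (Suc k)" k x] by (simp add: divide_less_eq)
    then have "ln (Rsum a s (p (Suc k)) (Suc k) x) \<le> ln (exp r * (Kfac a s (p (Suc k)) (Suc k) * Rsum a s (p (Suc k)) k x))"
      using Rsum_pos by (intro ln_mono) auto
    also have "\<dots> = r + ln (Kfac a s (p (Suc k)) (Suc k)) + ln (Rsum a s (p (Suc k)) k x)"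
      using Kfac_pos[of a s "p (Suc k)" "Suc k"] Rsum_pos[of a s "p (Suc k)" k x] by (simp add: ln_mult)
    finally have 1: "ln (Rsum a s (p (Suc k)) (Suc k) x) / p (Suc k) \<le>
        (r + ln (Kfac a s (p (Suc k)) (Suc k))) / p (Suc k) + ln (Rsum a s (p (Suc k)) k x) / p (Suc k)"
      using pos by (simp add: add_divide_distrib[symmetric] divide_right_mono)
    have 2: "ln (Rsum a s (p (Suc k)) k x) / p (Suc k) \<le> (\<Sum>j=1..k. (r + ln (Kfac a s (p j) j)) / p j)"
    proof (cases "k = 0")
      \<comment> \<open>Level 0 has a single branch of energy 0, so the recursion starts from
        \<open>ln 1 = 0\<close>.\<close>
      case True
      then show ?thesis by (simp add: Rsum_def V_def energy_def)
    next
      case False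
      have "ln (Rsum a s (p (Suc k)) k x) / p (Suc k) \<le> ln (Rsum a s (p k) k x) / p k"
        unfolding Rsum_def using p[of k] mono[of k "Suc k"] Suc.prems False finV neV
        by (intro ln_sum_exp_mono) auto
      with Suc False show ?thesis by simp
    qed
    from 1 2 show ?case by simp
  qed simp
  have "{x \<in> space P. (\<Sum>k=1..n. (r + ln (Kfac a s (p k) k)) / p k) < ln (Rsum a s 1 n x)}
      \<subseteq> (\<Union>k\<in>{1..n}. bad k)"
  proof (rule subsetI, rule ccontr)
    fix x assume w: "x \<in> {x \<in> space P. (\<Sum>k=1..n. (r + ln (Kfac a s (p k) k)) / p k) < ln (Rsum a s 1 n x)}"
      "x \<notin> (\<Union>k\<in>{1..n}. bad k)"
    show False
    proof (cases "n = 0")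
      case True
      then show False using w by (simp add: Rsum_def V_def energy_def)
    next
      case False
      \<comment> \<open>The last exponent is at most one, so passing to the true partition function
        goes in the right direction.\<close>
      have "ln (Rsum a s 1 n x) / 1 \<le> ln (Rsum a s (p n) n x) / p n"
        unfolding Rsum_def using p[of n] False finV neV by (intro ln_sum_exp_mono) auto
      with good[of x n] w False show False by simp
    qed
  qed
  then have "measure P {x \<in> space P. (\<Sum>k=1..n. (r + ln (Kfac a s (p k) k)) / p k) < ln (Rsum a s 1 n x)}
     \<le> measure P (\<Union>k\<in>{1..n}. bad k)"
    using bad_sets by (intro P.finite_measure_mono) auto
  also have "\<dots> \<le> (\<Sum>k\<in>{1..n}. measure P (bad k))"
    using bad_sets by (intro P.finite_measure_subadditive_finite) auto
  also have "\<dots> \<le> (\<Sum>k\<in>{1..n}. exp (- r))" using bad by (intro sum_mono)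
  finally show ?thesis by simp
qed

end

section \<open>Gaussian trees: second moment\<close>

context tree
begin

lemma nd_eq_iff: "nd j v = nd k w \<longleftrightarrow> j = k \<and> (\<forall>i\<in>{1..j}. v i = w i)"
  by (auto simp: nd_def restrict_def fun_eq_iff)

lemma threshold_sets:
  assumes "v \<in> V n"
  shows "{x \<in> space P. \<forall>k\<in>{1..n}. y k \<le> x (nd k v)} \<in> sets P"
proof (rule sets.sets_Collect_finite_All)
  fix k assume "k \<in> {1..n}"
  then have [measurable]: "(\<lambda>x. x (nd k v)) \<in> borel_measurable P"
    using assms nd_nodes by (intro measurable_gauss_component) auto
  show "{x \<in> space P. y k \<le> x (nd k v)} \<in> sets P" by measurable
qed simp

text \<open>The factor by which sharing the nodes of levels \<open>1..k\<close> raises the joint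
  survival probability above that of independent branches.\<close>

definition shared :: "(nat \<Rightarrow> real) \<Rightarrow> nat \<Rightarrow> (nat \<Rightarrow> 'b) \<Rightarrow> (nat \<Rightarrow> 'b) \<Rightarrow> real" where
  "shared p k v w = (if nd k v = nd k w then 1 / (\<Prod>j=1..k. p j) else 0)"

text \<open>The joint event is a box over the union of two paths, so its probability is the product
  of the two single probabilities divided by that of the common nodes. This quotient is one of the
  \<open>shared\<close> terms, or 1 if there is no common node; summing over all \<open>k\<close>
  spares tracking the branching level.\<close>

lemma second_moment_pair:
  fixes y :: "nat \<Rightarrow> real"
  assumes v: "v \<in> V n" and w: "w \<in> V n"
    and p: "\<And>k. p k = measure std_normal_distribution {y k..}" "\<And>k. 0 < p k"
  shows "measure P
      {x \<in> space P. \<forall>k\<in>{1..n}. y k \<le> x (nd k v) \<and> y k \<le> x (nd k w)}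
    \<le> (\<Prod>k=1..n. p k)\<^sup>2 * (1 + (\<Sum>k=1..n. shared p k v w))"
proof -
  define F where "F u = (\<lambda>k. nd k u) ` {1..n}" for u
  define c where "c = {k \<in> {1..n}. nd k v = nd k w}"
  have inj: "inj_on (\<lambda>k. nd k u) S" for u S by (auto simp: inj_on_def nd_def)
  have fin: "finite (F u)" for u by (simp add: F_def)
  have sub: "F v \<union> F w \<subseteq> nodes" using nd_nodes v w by (auto simp: F_def)
  have prodF: "(\<Prod>i\<in>F u. p (fst i)) = (\<Prod>k=1..n. p k)" for u
    unfolding F_def by (subst prod.reindex[OF inj]) (simp add: nd_def)
  have inter: "F v \<inter> F w = (\<lambda>k. nd k v) ` c"
    by (auto simp: F_def c_def nd_eq_iff)
  have prodI: "(\<Prod>i\<in>F v \<inter> F w. p (fst i)) = (\<Prod>k\<in>c. p k)"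
    unfolding inter by (subst prod.reindex[OF inj]) (simp add: nd_def)
  have cpos: "0 < (\<Prod>k\<in>c. p k)" using p by (intro prod_pos) auto
  have "{x \<in> space P. \<forall>k\<in>{1..n}. y k \<le> x (nd k v) \<and> y k \<le> x (nd k w)} =
    {x \<in> space P. \<forall>i\<in>F v \<union> F w. x i \<in> {y (fst i)..}}"
    by (simp add: F_def nd_def ball_Un ball_conj_distrib)
  then have "measure P {x \<in> space P. \<forall>k\<in>{1..n}. y k \<le> x (nd k v) \<and> y k \<le> x (nd k w)}
     = (\<Prod>i\<in>F v \<union> F w. measure std_normal_distribution {y (fst i)..})"
    using gauss_box[OF fin_nodes sub, of "\<lambda>i. {y (fst i)..}"] by simp
  also have "\<dots> = (\<Prod>i\<in>F v \<union> F w. p (fst i))" using p by simp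
  also have "\<dots> = (\<Prod>k=1..n. p k)\<^sup>2 * (1 / (\<Prod>k\<in>c. p k))"
  proof -
    have "(\<Prod>i\<in>F v \<union> F w. p (fst i)) * (\<Prod>k\<in>c. p k) = (\<Prod>k=1..n. p k)\<^sup>2"
      using prod.union_inter[OF fin fin, of "\<lambda>i. p (fst i)" v w]
      unfolding prodI prodF by (simp add: power2_eq_square)
    then show ?thesis using cpos by (simp add: field_simps)
  qed
  also have "\<dots> \<le> (\<Prod>k=1..n. p k)\<^sup>2 * (1 + (\<Sum>k=1..n. shared p k v w))"
  proof (intro mult_left_mono)
    have pp: "0 < (\<Prod>j=1..k. p j)" for k using p by (intro prod_pos) auto
    have nn: "0 \<le> shared p k v w" for k
      using pp[of k] by (auto simp: shared_def less_imp_le)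
    show "1 / (\<Prod>k\<in>c. p k) \<le> 1 + (\<Sum>k=1..n. shared p k v w)"
    proof (cases "c = {}")
      case True
      then show ?thesis using sum_nonneg[OF nn] by simp
    next
      case False
      have finc: "finite c" by (simp add: c_def)
      define K where "K = Max c"
      have K: "K \<in> c" unfolding K_def using finc False by (rule Max_in)
      \<comment> \<open>Agreement at level \<open>K\<close> forces agreement at every earlier
        level.\<close>
      have "c = {1..K}"
      proof
        show "c \<subseteq> {1..K}" using Max_ge[OF finc] by (auto simp: K_def c_def)
        show "{1..K} \<subseteq> c" using K by (auto simp: c_def nd_eq_iff)
      qed
      then have "1 / (\<Prod>k\<in>c. p k) = shared p K v w"
      proof -
        have "nd K v = nd K w" using K unfolding c_def by blast
        then show ?thesis using \<open>c = {1..K}\<close> by (simp only: shared_def if_True refl)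
      qed
      also have "\<dots> \<le> (\<Sum>k=1..n. shared p k v w)"
        using K nn by (intro member_le_sum) (auto simp: c_def)
      finally show ?thesis by simp
    qed
  qed simp
  finally show ?thesis .
qed

text \<open>The first \<open>k\<close> labels are forced and the others free. The quotient form
  combines with \<open>shared\<close> into the inverse expected number of surviving nodes on level
  \<open>k\<close>.\<close>

lemma card_cousins:
  assumes v: "v \<in> Pi\<^sub>E {1..n} H" and "k \<le> n" and ne: "\<And>j. j \<in> {1..n} \<Longrightarrow> 0 < card (H j)"
  shows "real (card {w \<in> Pi\<^sub>E {1..n} H. nd k v = nd k w}) =
    (\<Prod>j=1..n. real (card (H j))) / (\<Prod>j=1..k. real (card (H j)))"
proof -
  have "{w \<in> Pi\<^sub>E {1..n} H. nd k v = nd k w} = Pi\<^sub>E {1..n} (\<lambda>j. if j \<le> k then {v j} else H j)"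
  proof (intro set_eqI iffI)
    fix w assume "w \<in> {w \<in> Pi\<^sub>E {1..n} H. nd k v = nd k w}"
    then show "w \<in> Pi\<^sub>E {1..n} (\<lambda>j. if j \<le> k then {v j} else H j)"
      by (auto simp: PiE_iff nd_eq_iff)
  next
    fix w assume w: "w \<in> Pi\<^sub>E {1..n} (\<lambda>j. if j \<le> k then {v j} else H j)"
    have 1: "w j = v j" if "j \<in> {1..k}" for j
    proof -
      have "j \<in> {1..n}" using that assms(2) by auto
      with w have "w j \<in> (if j \<le> k then {v j} else H j)" by (simp only: PiE_iff)
      then show ?thesis using that by simp
    qed
    have "w j \<in> H j" if "j \<in> {1..n}" for j
    proof -
      have "w j \<in> (if j \<le> k then {v j} else H j)" using w that by (simp only: PiE_iff)
      moreover have "v j \<in> H j" using v that by (simp only: PiE_iff)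
      ultimately show ?thesis by (auto split: if_splits)
    qed
    moreover have "w \<in> extensional {1..n}" using w by (simp only: PiE_iff)
    ultimately show "w \<in> {w \<in> Pi\<^sub>E {1..n} H. nd k v = nd k w}"
      using 1 by (auto simp: PiE_iff nd_eq_iff)
  qed
  then have "real (card {w \<in> Pi\<^sub>E {1..n} H. nd k v = nd k w}) =
     (\<Prod>j=1..n. if j \<le> k then 1 else real (card (H j)))"
    by (simp add: card_PiE if_distrib cong: if_cong)
  moreover have "(\<Prod>j=1..n. real (card (H j))) =
     (\<Prod>j=1..n. if j \<le> k then 1 else real (card (H j))) * (\<Prod>j=1..k. real (card (H j)))"
  proof -
    have "(\<Prod>j=1..n. real (card (H j))) = (\<Prod>j=1..n. (if j \<le> k then 1 else real (card (H j))) * (if j \<le> k then real (card (H j)) else 1))"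
      by (intro prod.cong) auto
    also have "\<dots> = (\<Prod>j=1..n. if j \<le> k then 1 else real (card (H j))) * (\<Prod>j=1..n. if j \<le> k then real (card (H j)) else 1)"
      by (rule prod.distrib)
    also have "(\<Prod>j=1..n. if j \<le> k then real (card (H j)) else 1) = (\<Prod>j=1..k. real (card (H j)))"
      using assms(2) by (intro prod.mono_neutral_cong_right) auto
    finally show ?thesis .
  qed
  moreover have "(\<Prod>j=1..k. real (card (H j))) \<noteq> 0"
    using ne assms(2) by (auto simp: prod_zero_iff)
  ultimately show ?thesis by simp
qed

text \<open>Second moment method: \<open>H k\<close> are the labels kept and \<open>y k\<close> the
  thresholds, and the product up to \<open>k\<close> is the mean number of surviving nodes on level
  \<open>k\<close>. The relative variance of the number of surviving branches is at most the sum of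
  the inverses of these means.\<close>

theorem lower_tail_count:
  fixes y :: "nat \<Rightarrow> real"
  assumes H: "\<And>k. k \<in> {1..n} \<Longrightarrow> H k \<subseteq> B k" "\<And>k. k \<in> {1..n} \<Longrightarrow> H k \<noteq> {}"
    and p: "\<And>k. p k = measure std_normal_distribution {y k..}" "\<And>k. 0 < p k"
  shows "measure P {x \<in> space P.
      real (card {v \<in> Pi\<^sub>E {1..n} H. \<forall>k\<in>{1..n}. y k \<le> x (nd k v)})
        \<le> (\<Prod>k=1..n. real (card (H k)) * p k) / 2}
    \<le> 4 * (\<Sum>k=1..n. 1 / (\<Prod>j=1..k. real (card (H j)) * p j))"
proof -
  interpret P: prob_space "P" by (rule prob_space_gauss)
  define A where "A = Pi\<^sub>E {1..n} H"
  have finH: "finite (H k)" if "k \<in> {1..n}" for k using H that finB finite_subset by blast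
  have cardH: "0 < card (H k)" if "k \<in> {1..n}" for k using finH H that by (simp add: card_gt_0_iff)
  have finA: "finite A" unfolding A_def using finH by (intro finite_PiE) auto
  have AV: "A \<subseteq> V n" unfolding A_def V_def using H by (intro PiE_mono) auto
  define S where "S v = {x \<in> space P. \<forall>k\<in>{1..n}. y k \<le> x (nd k v)}" for v
  define C where "C x = (\<Sum>v\<in>A. indicat_real (S v) x)" for x
  have S_sets: "S v \<in> sets P" if "v \<in> A" for v
    unfolding S_def using that AV by (intro threshold_sets) auto
  define Pi where "Pi = (\<Prod>k=1..n. p k)"
  define g where "g k = real (card (H k))" for k
  have gpos: "0 < g k" if "k \<in> {1..n}" for k using cardH that by (simp add: g_def)
  define mu where "mu = (\<Prod>k=1..n. g k * p k)"
  have mupos: "0 < mu" unfolding mu_def using gpos p by (intro prod_pos) auto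
  have Acard: "real (card A) = (\<Prod>k=1..n. g k)" by (simp add: A_def g_def card_PiE)
  have mu: "mu = real (card A) * Pi" by (simp add: mu_def Pi_def Acard prod.distrib)
  have PS: "measure P (S v) = Pi" if "v \<in> A" for v
  proof -
    have inj: "inj_on (\<lambda>k. nd k v) {1..n}" by (auto simp: inj_on_def nd_def)
    have "S v = {x \<in> space P. \<forall>i\<in>(\<lambda>k. nd k v) ` {1..n}. x i \<in> {y (fst i)..}}"
      by (auto simp: S_def nd_def)
    also have "measure P \<dots> = (\<Prod>i\<in>(\<lambda>k. nd k v) ` {1..n}. measure std_normal_distribution {y (fst i)..})"
      using that AV nd_nodes[of _ n v] by (intro gauss_box fin_nodes) (auto simp only: image_subset_iff atLeastAtMost_iff, simp_all)
    also have "\<dots> = Pi" unfolding Pi_def by (subst prod.reindex[OF inj]) (simp add: nd_def p)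
    finally show ?thesis .
  qed
  have Ci: "integrable P C" unfolding C_def using S_sets
    by (intro Bochner_Integration.integrable_sum integrable_real_indicator) (auto simp: less_top[symmetric])
  have EC: "P.expectation C = mu"
    unfolding C_def using S_sets PS
    by (subst Bochner_Integration.integral_sum) (auto simp: mu less_top[symmetric] intro!: integrable_real_indicator)
  have C2: "(C x)\<^sup>2 = (\<Sum>v\<in>A. \<Sum>w\<in>A. indicat_real (S v \<inter> S w) x)" for x
    unfolding C_def power2_eq_square sum_product by (simp add: indicator_inter_arith)
  have C2i: "integrable P (\<lambda>x. (C x)\<^sup>2)"
    unfolding C2 using S_sets
    by (intro Bochner_Integration.integrable_sum integrable_real_indicator) (auto simp: less_top[symmetric])
  have "P.expectation (\<lambda>x. (C x)\<^sup>2) = (\<Sum>v\<in>A. \<Sum>w\<in>A. P.prob (S v \<inter> S w))"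
    unfolding C2 using S_sets
    by (subst Bochner_Integration.integral_sum, (intro Bochner_Integration.integrable_sum integrable_real_indicator; auto simp: less_top[symmetric]),
        intro sum.cong refl, subst Bochner_Integration.integral_sum)
       (auto intro!: integrable_real_indicator simp: less_top[symmetric])
  also have "\<dots> \<le> (\<Sum>v\<in>A. \<Sum>w\<in>A. Pi\<^sup>2 * (1 + (\<Sum>k=1..n. shared p k v w)))"
  proof (intro sum_mono)
    fix v w assume vw: "v \<in> A" "w \<in> A"
    have "S v \<inter> S w = {x \<in> space P. \<forall>k\<in>{1..n}. y k \<le> x (nd k v) \<and> y k \<le> x (nd k w)}"
      by (auto simp: S_def)
    then show "P.prob (S v \<inter> S w) \<le> Pi\<^sup>2 * (1 + (\<Sum>k=1..n. shared p k v w))"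
      using second_moment_pair[of v w p y, OF _ _ p] vw AV unfolding Pi_def by auto
  qed
  also have "\<dots> = Pi\<^sup>2 * ((real (card A))\<^sup>2 + (\<Sum>k=1..n. (\<Sum>v\<in>A. \<Sum>w\<in>A. shared p k v w)))"
  proof -
    have "(\<Sum>v\<in>A. \<Sum>w\<in>A. Pi\<^sup>2 * (1 + (\<Sum>k=1..n. shared p k v w))) =
      Pi\<^sup>2 * ((real (card A))\<^sup>2 + (\<Sum>v\<in>A. \<Sum>w\<in>A. \<Sum>k=1..n. shared p k v w))"
      by (simp add: sum_distrib_left[symmetric] sum.distrib power2_eq_square)
    also have "(\<Sum>v\<in>A. \<Sum>w\<in>A. \<Sum>k=1..n. shared p k v w) =
       (\<Sum>k=1..n. (\<Sum>v\<in>A. \<Sum>w\<in>A. shared p k v w))"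
      by (subst sum.swap[of _ "{1..n}"], subst sum.swap[of _ _ "{1..n}"]) (rule refl)
    finally show ?thesis .
  qed
  also have "(\<Sum>k=1..n. (\<Sum>v\<in>A. \<Sum>w\<in>A. shared p k v w)) =
     (\<Sum>k=1..n. (real (card A))\<^sup>2 * (1 / (\<Prod>j=1..k. g j * p j)))"
  proof (intro sum.cong refl)
    fix k assume k: "k \<in> {1..n}"
    have "(\<Sum>w\<in>A. shared p k v w) = real (card A) * (1 / (\<Prod>j=1..k. g j * p j))"
      if v: "v \<in> A" for v
    proof -
      have "(\<Sum>w\<in>A. shared p k v w) =
         real (card {w \<in> A. nd k v = nd k w}) * (1 / (\<Prod>j=1..k. p j))"
        using finA by (simp add: shared_def sum.If_cases Int_def)
      also have "real (card {w \<in> A. nd k v = nd k w}) = real (card A) / (\<Prod>j=1..k. g j)"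
        using card_cousins[of v H k] v k cardH unfolding Acard by (simp add: A_def g_def)
      finally show ?thesis by (simp add: prod.distrib)
    qed
    then show "(\<Sum>v\<in>A. \<Sum>w\<in>A. shared p k v w) =
      (real (card A))\<^sup>2 * (1 / (\<Prod>j=1..k. g j * p j))"
      by (simp add: power2_eq_square)
  qed
  also have "Pi\<^sup>2 * ((real (card A))\<^sup>2 + (\<Sum>k=1..n. (real (card A))\<^sup>2 * (1 / (\<Prod>j=1..k. g j * p j)))) =
     mu\<^sup>2 + mu\<^sup>2 * (\<Sum>k=1..n. 1 / (\<Prod>j=1..k. g j * p j))"
    unfolding mu by (simp only: sum_distrib_left[symmetric] power_mult_distrib) (simp add: algebra_simps)
  finally have var: "P.variance C \<le> mu\<^sup>2 * (\<Sum>k=1..n. 1 / (\<Prod>j=1..k. g j * p j))"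
    using P.variance_eq[OF Ci C2i] EC by simp
  have Cm: "C \<in> borel_measurable P" using Ci by auto
  have "{x \<in> space P. real (card {v \<in> A. \<forall>k\<in>{1..n}. y k \<le> x (nd k v)}) \<le> mu / 2} \<subseteq>
     {x \<in> space P. mu / 2 \<le> \<bar>C x - P.expectation C\<bar>}"
  proof safe
    fix x assume w: "x \<in> space P" "real (card {v \<in> A. \<forall>k\<in>{1..n}. y k \<le> x (nd k v)}) \<le> mu / 2"
    have "C x = real (card {v \<in> A. \<forall>k\<in>{1..n}. y k \<le> x (nd k v)})"
      using w(1) finA unfolding C_def S_def
      by (simp add: indicator_def sum.If_cases Int_def)
    with w show "mu / 2 \<le> \<bar>C x - P.expectation C\<bar>" unfolding EC by simp
  qed
  then have "P.prob {x \<in> space P. real (card {v \<in> A. \<forall>k\<in>{1..n}. y k \<le> x (nd k v)}) \<le> mu / 2} \<le>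
     P.prob {x \<in> space P. mu / 2 \<le> \<bar>C x - P.expectation C\<bar>}"
    using Cm by (intro P.finite_measure_mono) auto
  \<comment> \<open>Chebyshev at half the mean; the square of 1/2 is the source of the constant
    4.\<close>
  also have "\<dots> \<le> P.variance C / (mu / 2)\<^sup>2"
    using Cm C2i mupos by (intro P.Chebyshev_inequality) auto
  also have "\<dots> \<le> mu\<^sup>2 * (\<Sum>k=1..n. 1 / (\<Prod>j=1..k. g j * p j)) / (mu / 2)\<^sup>2"
    using var by (intro divide_right_mono) auto
  also have "\<dots> = 4 * (\<Sum>k=1..n. 1 / (\<Prod>j=1..k. g j * p j))"
    using mupos by (simp add: power_divide)
  finally show ?thesis unfolding mu_def A_def g_def .
qed

text \<open>If at least half of the expected number of branches survive, each adds at least the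
  exponential of the summed lower bounds \<open>al k + s k * y k\<close>. The half costs
  \<open>ln 2\<close>.\<close>

theorem lower_tail:
  fixes y :: "nat \<Rightarrow> real"
  assumes H: "\<And>k. k \<in> {1..n} \<Longrightarrow> H k \<subseteq> B k" "\<And>k. k \<in> {1..n} \<Longrightarrow> H k \<noteq> {}"
    and p: "\<And>k. p k = measure std_normal_distribution {y k..}" "\<And>k. 0 < p k"
    and al: "\<And>k b. k \<in> {1..n} \<Longrightarrow> b \<in> H k \<Longrightarrow> al k \<le> a k b"
    and s: "\<And>k. k \<in> {1..n} \<Longrightarrow> 0 \<le> s k"
  shows "measure P {x \<in> space P.
      ln (Rsum a s 1 n x) < (\<Sum>k=1..n. ln (real (card (H k)) * p k) + al k + s k * y k) - ln 2}
    \<le> 4 * (\<Sum>k=1..n. 1 / (\<Prod>j=1..k. real (card (H j)) * p j))"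
proof -
  interpret P: prob_space "P" by (rule prob_space_gauss)
  define A where "A = Pi\<^sub>E {1..n} H"
  have finH: "finite (H k)" if "k \<in> {1..n}" for k using H that finB finite_subset by blast
  have cardH: "0 < card (H k)" if "k \<in> {1..n}" for k using finH H that by (simp add: card_gt_0_iff)
  have finA: "finite A" unfolding A_def using finH by (intro finite_PiE) auto
  have AV: "A \<subseteq> V n" unfolding A_def V_def using H by (intro PiE_mono) auto
  let ?g = "\<lambda>x. {v \<in> A. \<forall>k\<in>{1..n}. y k \<le> x (nd k v)}"
  define mu where "mu = (\<Prod>k=1..n. real (card (H k)) * p k)"
  have pos: "0 < real (card (H k)) * p k" if "k \<in> {1..n}" for k using cardH[OF that] p by simp
  have mupos: "0 < mu" unfolding mu_def using pos by (intro prod_pos) auto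
  have lnmu: "ln mu = (\<Sum>k=1..n. ln (real (card (H k)) * p k))"
    unfolding mu_def using pos by (intro ln_prod) force+
  have sub: "{x \<in> space P.
      ln (Rsum a s 1 n x) < (\<Sum>k=1..n. ln (real (card (H k)) * p k) + al k + s k * y k) - ln 2}
    \<subseteq> {x \<in> space P. real (card (?g x)) \<le> mu / 2}"
  proof (safe, rule ccontr)
    fix x assume lt: "ln (Rsum a s 1 n x) < (\<Sum>k=1..n. ln (real (card (H k)) * p k) + al k + s k * y k) - ln 2"
      and "\<not> real (card (?g x)) \<le> mu / 2"
    then have c: "mu / 2 < real (card (?g x))" by simp
    let ?E = "\<Sum>k=1..n. al k + s k * y k"
    have "mu / 2 * exp ?E \<le> real (card (?g x)) * exp ?E"
      using c by (intro mult_right_mono) auto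
    also have "\<dots> = (\<Sum>v\<in>?g x. exp ?E)" by simp
    also have "\<dots> \<le> (\<Sum>v\<in>?g x. exp (1 * energy a s n v x))"
    proof (intro sum_mono)
      fix v assume v: "v \<in> ?g x"
      have "?E \<le> energy a s n v x" unfolding energy_def
      proof (intro sum_mono add_mono mult_left_mono)
        fix k assume k: "k \<in> {1..n}"
        have "v k \<in> H k" using v k by (auto simp: A_def PiE_iff)
        then show "al k \<le> a k (v k)" using al k by simp
        show "y k \<le> x (nd k v)" "0 \<le> s k" using v k s by auto
      qed
      then show "exp ?E \<le> exp (1 * energy a s n v x)" by simp
    qed
    also have "\<dots> \<le> Rsum a s 1 n x" unfolding Rsum_def using AV finV by (intro sum_mono2) auto
    finally have "ln (mu / 2 * exp ?E) \<le> ln (Rsum a s 1 n x)"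
      using mupos by (intro ln_mono) auto
    moreover have "ln (mu / 2 * exp ?E) = ln mu - ln 2 + ?E" using mupos by (simp add: ln_mult ln_div)
    ultimately show False using lt by (simp add: lnmu sum.distrib)
  qed
  have meas: "{x \<in> space P. real (card (?g x)) \<le> mu / 2} \<in> sets P"
  proof -
    have S: "{x \<in> space P. \<forall>k\<in>{1..n}. y k \<le> x (nd k v)} \<in> sets P" if "v \<in> A" for v
      using that AV by (intro threshold_sets) auto
    have "(\<lambda>x. \<Sum>v\<in>A. indicat_real {x \<in> space P. \<forall>k\<in>{1..n}. y k \<le> x (nd k v)} x) \<in> borel_measurable P"
      using S by (intro borel_measurable_sum borel_measurable_indicator) auto
    then have "{x \<in> space P. (\<Sum>v\<in>A. indicat_real {x \<in> space P. \<forall>k\<in>{1..n}. y k \<le> x (nd k v)} x) \<le> mu / 2} \<in> sets P"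
      by measurable
    also have "{x \<in> space P. (\<Sum>v\<in>A. indicat_real {x \<in> space P. \<forall>k\<in>{1..n}. y k \<le> x (nd k v)} x) \<le> mu / 2} =
       {x \<in> space P. real (card (?g x)) \<le> mu / 2}"
      using finA by (intro Collect_cong conj_cong refl) (simp add: indicator_def sum.If_cases Int_def)
    finally show ?thesis .
  qed
  show ?thesis
    using P.finite_measure_mono[OF sub meas] lower_tail_count[of H p y, OF H p]
    unfolding A_def mu_def by linarith
qed

end

section \<open>The GREM as a Gaussian tree\<close>

text \<open>As an image of the standard normal law under scaling, the degenerate case
  \<open>v = 0\<close> needs no separate treatment afterwards.\<close>

lemma centered_normal_eq_distr:
  assumes "0 \<le> v"
  shows "centered_normal v = distr std_normal_distribution borel (\<lambda>y. sqrt v * y)"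
proof (cases "v = 0")
  case True
  interpret prob_space std_normal_distribution by (rule std_normal_prob)
  show ?thesis using True by (simp add: centered_normal_def distr_const)
next
  case False
  with assms have s: "0 < sqrt v" by simp
  interpret prob_space std_normal_distribution by (rule std_normal_prob)
  have "distributed std_normal_distribution lborel (\<lambda>y. y) std_normal_density"
    unfolding distributed_def by (simp add: distr_id2)
  then have "distributed std_normal_distribution lborel (\<lambda>y. sqrt v * y) (normal_density 0 (sqrt v))"
    using s by (subst normal_standard_normal_convert[OF s]) simp
  then have "distr std_normal_distribution lborel (\<lambda>y. sqrt v * y) = density lborel (normal_density 0 (sqrt v))"
    by (rule distributed_distr_eq_density)
  moreover have "distr std_normal_distribution lborel (\<lambda>y. sqrt v * y) = distr std_normal_distribution borel (\<lambda>y. sqrt v * y)"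
    by (rule distr_cong) auto
  ultimately show ?thesis using False by (simp add: centered_normal_def)
qed

lemma std_normal_square:
  "integrable std_normal_distribution (\<lambda>y. y\<^sup>2)" "(\<integral>y. y\<^sup>2 \<partial>std_normal_distribution) = 1"
  using integrable_std_normal_distribution_moment[of 2] std_normal_distribution_even_moments[of 1]
  by (auto simp: has_bochner_integral_iff)

lemma centered_normal_facts:
  assumes X: "X \<in> borel_measurable M" and d: "distr M borel X = centered_normal v" and v: "0 \<le> v"
  shows "integrable M (\<lambda>\<omega>. (X \<omega>)\<^sup>2)" "(\<integral>\<omega>. (X \<omega>)\<^sup>2 \<partial>M) = v"
    "(CLINT \<omega>|M. iexp (X \<omega>)) = of_real (exp (- v / 2))"
    "(\<integral>\<^sup>+\<omega>. ennreal (exp (t * X \<omega>)) \<partial>M) = ennreal (exp (t\<^sup>2 * v / 2))"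
proof -
  note e = d[unfolded centered_normal_eq_distr[OF v]]
  have "integrable (distr M borel X) (\<lambda>y. y\<^sup>2)"
    unfolding e using v by (subst integrable_distr_eq) (auto simp: power_mult_distrib intro!: integrable_mult_right std_normal_square)
  then show "integrable M (\<lambda>\<omega>. (X \<omega>)\<^sup>2)" using X by (subst (asm) integrable_distr_eq) auto
  have "(\<integral>y. y\<^sup>2 \<partial>distr M borel X) = v"
    unfolding e using v by (subst integral_distr) (auto simp: power_mult_distrib std_normal_square)
  then show "(\<integral>\<omega>. (X \<omega>)\<^sup>2 \<partial>M) = v" using X by (subst (asm) integral_distr) auto
  have "(CLINT y|distr M borel X. iexp y) = (CLINT y|std_normal_distribution. iexp (sqrt v * y))"
    unfolding e by (subst integral_distr) auto
  also have "\<dots> = char std_normal_distribution (sqrt v)" by (simp add: char_def)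
  also have "\<dots> = of_real (exp (- v / 2))" using v by (simp add: char_std_normal_distribution)
  finally show "(CLINT \<omega>|M. iexp (X \<omega>)) = of_real (exp (- v / 2))"
    using X by (subst (asm) integral_distr) auto
  have "(\<integral>\<^sup>+y. ennreal (exp (t * y)) \<partial>distr M borel X) = (\<integral>\<^sup>+y. ennreal (exp ((t * sqrt v) * y)) \<partial>std_normal_distribution)"
    unfolding e by (subst nn_integral_distr) (auto simp: mult.assoc)
  also have "\<dots> = ennreal (exp (t\<^sup>2 * v / 2))"
    using v by (simp add: nn_integral_exp_std_normal power_mult_distrib)
  finally show "(\<integral>\<^sup>+\<omega>. ennreal (exp (t * X \<omega>)) \<partial>M) = ennreal (exp (t\<^sup>2 * v / 2))"
    using X by (subst (asm) nn_integral_distr) auto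
qed

text \<open>The definition only grants some variance \<open>v\<close> for each linear combination.
  Comparing second moments identifies it as the quadratic form of the covariances, and then the
  characteristic function is known.\<close>

lemma gaussian_process_char:
  assumes g: "centered_gaussian_process M S X" and S: "finite S"
  shows "(CLINT \<omega>|M. iexp (\<Sum>s\<in>S. c s * X s \<omega>)) =
    of_real (exp (- (\<Sum>s\<in>S. \<Sum>t\<in>S. c s * c t * (\<integral>\<omega>. X s \<omega> * X t \<omega> \<partial>M)) / 2))"
    and "s \<in> S \<Longrightarrow> integrable M (\<lambda>\<omega>. (X s \<omega>)\<^sup>2)"
proof -
  have X: "X s \<in> borel_measurable M" if "s \<in> S" for s
    using g that by (auto simp: centered_gaussian_process_def)
  have ex: "\<exists>v\<ge>0. distr M borel (\<lambda>\<omega>. \<Sum>s\<in>T. c s * X s \<omega>) = centered_normal v" if "T \<subseteq> S" for T c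
    using g finite_subset[OF that S] that by (auto simp: centered_gaussian_process_def)
  show sq: "integrable M (\<lambda>\<omega>. (X s \<omega>)\<^sup>2)" if s: "s \<in> S" for s
  proof -
    obtain v where v: "0 \<le> v" "distr M borel (\<lambda>\<omega>. \<Sum>t\<in>{s}. 1 * X t \<omega>) = centered_normal v"
      using ex[of "{s}" "\<lambda>_. 1"] s by blast
    then have "distr M borel (X s) = centered_normal v" by simp
    from centered_normal_facts(1)[OF X[OF s] this v(1)] show ?thesis .
  qed
  have prod: "integrable M (\<lambda>\<omega>. X s \<omega> * X t \<omega>)" if s: "s \<in> S" "t \<in> S" for s t
  proof (rule Bochner_Integration.integrable_bound)
    show "integrable M (\<lambda>\<omega>. (X s \<omega>)\<^sup>2 + (X t \<omega>)\<^sup>2)" using sq s by (intro Bochner_Integration.integrable_add) auto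
    show "(\<lambda>\<omega>. X s \<omega> * X t \<omega>) \<in> borel_measurable M" using X s by (intro borel_measurable_times) auto
    have "\<bar>a * b\<bar> \<le> a\<^sup>2 + b\<^sup>2" for a b :: real
      using sum_squares_bound[of "\<bar>a\<bar>" "\<bar>b\<bar>"] zero_le_power2[of a] zero_le_power2[of b] unfolding abs_mult power2_abs by linarith
    then show "AE \<omega> in M. norm (X s \<omega> * X t \<omega>) \<le> norm ((X s \<omega>)\<^sup>2 + (X t \<omega>)\<^sup>2)" by simp
  qed
  obtain v where v: "0 \<le> v" "distr M borel (\<lambda>\<omega>. \<Sum>s\<in>S. c s * X s \<omega>) = centered_normal v" using ex[of S c] by blast
  have m: "(\<lambda>\<omega>. \<Sum>s\<in>S. c s * X s \<omega>) \<in> borel_measurable M" using X by (intro borel_measurable_sum borel_measurable_times) auto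
  note f = centered_normal_facts[OF m v(2) v(1)]
  have "v = (\<integral>\<omega>. (\<Sum>s\<in>S. \<Sum>t\<in>S. c s * c t * (X s \<omega> * X t \<omega>)) \<partial>M)"
    unfolding f(2)[symmetric] power2_eq_square sum_product by (intro Bochner_Integration.integral_cong sum.cong refl) (simp add: algebra_simps)
  also have "\<dots> = (\<Sum>s\<in>S. \<Sum>t\<in>S. c s * c t * (\<integral>\<omega>. X s \<omega> * X t \<omega> \<partial>M))"
    using prod by (simp add: Bochner_Integration.integral_sum Bochner_Integration.integrable_sum)
  finally show "(CLINT \<omega>|M. iexp (\<Sum>s\<in>S. c s * X s \<omega>)) =
    of_real (exp (- (\<Sum>s\<in>S. \<Sum>t\<in>S. c s * c t * (\<integral>\<omega>. X s \<omega> * X t \<omega> \<partial>M)) / 2))"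
    using f(3) by simp
qed

section \<open>Blocks of spins as the labels of a tree\<close>

locale grem_level = order_parameter n x q h for n x q h +
  fixes N :: nat and \<beta> :: real
  assumes N: "N \<in> admissible_sizes n x" and \<beta>: "0 < \<beta>"
begin

text \<open>The last spin of level \<open>k\<close>. For admissible \<open>N\<close> and
  \<open>k \<le> n\<close> the product is already a natural number, so the floor only changes the
  type.\<close>

definition lev :: "nat \<Rightarrow> nat" where "lev k = nat \<lfloor>x k * real N\<rfloor>"
definition blk :: "nat \<Rightarrow> nat set" where "blk k = {lev (k - 1) + 1..lev k}"
definition cfg :: "nat \<Rightarrow> (nat \<Rightarrow> real) set" where "cfg k = blk k \<rightarrow>\<^sub>E {-1, 1}"

lemma N_pos: "1 \<le> N" using N by (simp add: admissible_sizes_def)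

lemma lev: "k \<le> n \<Longrightarrow> real (lev k) = x k * real N"
proof (cases "k = 0")
  case True
  then show ?thesis by (simp add: lev_def x0)
next
  case False
  assume "k \<le> n"
  with False N have "x k * real N \<in> \<nat>" by (auto simp: admissible_sizes_def)
  then obtain j where "x k * real N = real j" by (rule Nats_cases)
  then show ?thesis by (simp add: lev_def)
qed

lemma lev_0: "lev 0 = 0" and lev_n: "lev n = N"
  using lev[of 0] lev[of n] by (simp_all add: x0 xn)

lemma lev_strict: "j < k \<Longrightarrow> k \<le> n \<Longrightarrow> lev j < lev k"
proof -
  assume "j < k" "k \<le> n"
  then have "real (lev j) < real (lev k)" using lev x_strict N_pos by simp
  then show ?thesis by simp
qed

lemma lev_mono: "j \<le> k \<Longrightarrow> k \<le> n \<Longrightarrow> lev j \<le> lev k"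
  using lev_strict[of j k] by (cases "j = k") auto

lemma blk_ex:
  assumes "i \<in> {1..lev k}" "k \<le> n"
  shows "\<exists>j\<in>{1..k}. i \<in> blk j"
proof -
  define j where "j = (LEAST j. i \<le> lev j)"
  have ik: "i \<le> lev k" using assms by simp
  have j: "i \<le> lev j" unfolding j_def by (rule LeastI[of "\<lambda>j. i \<le> lev j", OF ik])
  have jk: "j \<le> k" unfolding j_def by (rule Least_le[of "\<lambda>j. i \<le> lev j", OF ik])
  have "j \<noteq> 0"
  proof
    assume "j = 0"
    with j lev_0 assms show False by simp
  qed
  then have "j - 1 < (LEAST j. i \<le> lev j)" by (simp add: j_def[symmetric])
  from not_less_Least[OF this] \<open>j \<noteq> 0\<close> have "\<not> i \<le> lev (j - 1)" "j \<noteq> 0" by simp_all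
  then show ?thesis using j jk \<open>j \<noteq> 0\<close> by (intro bexI[of _ j]) (auto simp: blk_def)
qed

lemma blk_sub: "j \<in> {1..k} \<Longrightarrow> k \<le> n \<Longrightarrow> blk j \<subseteq> {1..lev k}"
  using lev_mono[of j k] by (auto simp: blk_def)

lemma fin_cfg: "finite (cfg k)" and ne_cfg: "cfg k \<noteq> {}"
  by (auto simp: cfg_def blk_def PiE_eq_empty_iff intro!: finite_PiE)

sublocale tree n cfg by unfold_locales (rule fin_cfg ne_cfg)+

definition enc :: "(nat \<Rightarrow> real) \<Rightarrow> nat \<Rightarrow> nat \<Rightarrow> real" where
  "enc \<sigma> = (\<lambda>k\<in>{1..n}. restrict \<sigma> (blk k))"

lemma nd_enc_eq_iff:
  assumes "k \<le> n"
  shows "nd k (enc \<sigma>) = nd k (enc \<tau>) \<longleftrightarrow> (\<forall>i\<in>{1..lev k}. \<sigma> i = \<tau> i)"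
proof -
  have "nd k (enc \<sigma>) = nd k (enc \<tau>) \<longleftrightarrow> (\<forall>j\<in>{1..k}. \<forall>i\<in>blk j. \<sigma> i = \<tau> i)"
  proof -
    have "enc \<sigma> j = enc \<tau> j \<longleftrightarrow> (\<forall>i\<in>blk j. \<sigma> i = \<tau> i)" if "j \<in> {1..k}" for j
      using that assms by (auto simp: enc_def restrict_def fun_eq_iff)
    then show ?thesis unfolding nd_eq_iff by simp
  qed
  also have "\<dots> \<longleftrightarrow> (\<forall>i\<in>{1..lev k}. \<sigma> i = \<tau> i)"
    using blk_ex[OF _ assms] blk_sub[OF _ assms] by blast
  finally show ?thesis .
qed

abbreviation "spins \<equiv> spin_configs N"

lemma finite_spin: "finite (spins)"
  unfolding spin_configs_def by (intro finite_PiE) auto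

lemma card_cfg: "card (cfg k) = 2 ^ (lev k - lev (k - 1))"
  by (simp add: cfg_def blk_def card_PiE numeral_2_eq_2)

text \<open>Surjectivity is obtained by counting: the block lengths telescope to \<open>N\<close>,
  so both sides have \<open>2 ^ N\<close> elements.\<close>

lemma bij_enc: "bij_betw enc (spins) (V n)"
proof -
  have inj: "inj_on enc (spins)"
  proof (rule inj_onI)
    fix \<sigma> \<tau> assume st: "\<sigma> \<in> spins" "\<tau> \<in> spins" "enc \<sigma> = enc \<tau>"
    then have "\<forall>i\<in>{1..N}. \<sigma> i = \<tau> i" using nd_enc_eq_iff[of n \<sigma> \<tau>] lev_n by simp
    then show "\<sigma> = \<tau>" using st unfolding spin_configs_def by (metis PiE_ext)
  qed
  have sub: "enc ` spins \<subseteq> V n"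
  proof (intro image_subsetI)
    fix \<sigma> assume s: "\<sigma> \<in> spins"
    have "restrict \<sigma> (blk k) \<in> cfg k" if "k \<in> {1..n}" for k
    proof -
      have "blk k \<subseteq> {1..N}" using blk_sub[of k n] that lev_n by simp
      with s show ?thesis by (auto simp: cfg_def spin_configs_def PiE_iff)
    qed
    then show "enc \<sigma> \<in> V n" by (auto simp: enc_def V_def)
  qed
  have "card (V n) = (\<Prod>k=1..n. 2 ^ (lev k - lev (k - 1)))"
    by (simp add: V_def card_PiE card_cfg)
  also have "\<dots> = 2 ^ (\<Sum>k=1..n. lev k - lev (k - 1))" by (simp add: power_sum)
  also have "(\<Sum>k=1..n. lev k - lev (k - 1)) = N"
  proof -
    have "j \<le> n \<Longrightarrow> (\<Sum>k=1..j. lev k - lev (k - 1)) = lev j" for j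
      by (induction j) (use lev_0 lev_mono in \<open>auto simp: Suc_le_eq less_imp_le\<close>)
    then show ?thesis using lev_n by simp
  qed
  also have "(2::nat) ^ N = card (spins)"
    by (simp add: spin_configs_def card_PiE numeral_2_eq_2)
  finally have "card (enc ` spins) = card (V n)" by (simp add: card_image[OF inj])
  then have "enc ` spins = V n" using sub finV by (intro card_subset_eq) auto
  with inj show ?thesis by (simp add: bij_betw_def)
qed

definition dq :: "nat \<Rightarrow> real" where "dq k = q k - q (k - 1)"

lemma dq_pos: "k \<in> {1..n} \<Longrightarrow> 0 < dq k"
  using q_strict[of "k - 1" k] by (auto simp: dq_def)

lemma sum_dq: "j \<le> n \<Longrightarrow> (\<Sum>k=1..j. dq k) = q j"
  by (induction j) (auto simp: q0 dq_def)

text \<open>The covariance of two branch sums with independent node variables of variance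
  \<open>dq k\<close>.\<close>

definition overlap_cov :: "(nat \<Rightarrow> real) \<Rightarrow> (nat \<Rightarrow> real) \<Rightarrow> real" where
  "overlap_cov \<sigma> \<tau> = (\<Sum>k=1..n. dq k * (if nd k (enc \<sigma>) = nd k (enc \<tau>) then 1 else 0))"

text \<open>Both sides equal \<open>q r\<close> when the number \<open>K\<close> of common initial
  spins satisfies \<open>lev r \<le> K\<close> and \<open>K < lev (Suc r)\<close>: exactly the
  levels up to \<open>r\<close> are shared and their increments telescope. The case
  \<open>K = N\<close> is separate because no step of the order parameter contains the point
  1.\<close>

lemma order_param_overlap:
  "order_param n x q (lex_overlap N \<sigma> \<tau>) =
     overlap_cov \<sigma> \<tau>"
proof -
  define A where "A = {k \<in> {0..N}. \<forall>i\<in>{1..k}. \<sigma> i = \<tau> i}"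
  define K where "K = Max A"
  have finA: "finite A" by (simp add: A_def)
  have "0 \<in> A" by (simp add: A_def)
  then have KA: "K \<in> A" unfolding K_def using finA by (intro Max_in) auto
  have agree: "(\<forall>i\<in>{1..j}. \<sigma> i = \<tau> i) \<longleftrightarrow> j \<le> K" if "j \<le> N" for j
  proof
    assume "\<forall>i\<in>{1..j}. \<sigma> i = \<tau> i"
    then have "j \<in> A" using that by (simp add: A_def)
    then show "j \<le> K" unfolding K_def using finA by simp
  next
    assume "j \<le> K" then show "\<forall>i\<in>{1..j}. \<sigma> i = \<tau> i" using KA by (simp add: A_def)
  qed
  have t: "lex_overlap N \<sigma> \<tau> = real K / real N" by (simp add: lex_overlap_def K_def A_def)
  have KN: "K \<le> N" using KA by (simp add: A_def)
  have Np: "0 < real N" using N_pos by simp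
  have ind: "nd k (enc \<sigma>) = nd k (enc \<tau>) \<longleftrightarrow> lev k \<le> K" if "k \<in> {1..n}" for k
    using that nd_enc_eq_iff[of k] agree[of "lev k"] lev_mono[of k n] lev_n by auto
  show ?thesis
  proof (cases "K = N")
    case True
    have "overlap_cov \<sigma> \<tau> = (\<Sum>k=1..n. dq k)"
      unfolding overlap_cov_def using ind lev_mono[of _ n] lev_n True by (intro sum.cong refl) auto
    then show ?thesis using True Np sum_dq[of n] by (simp add: t order_param_def qn)
  next
    case False
    define r where "r = (LEAST r. K < lev (Suc r))"
    have ex: "K < lev (Suc (n - 1))" using False KN n lev_n by simp
    have r1: "K < lev (Suc r)" unfolding r_def using ex by (rule LeastI)
    have rn: "r < n" using Least_le[of "\<lambda>r. K < lev (Suc r)", OF ex] n unfolding r_def by linarith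
    have r2: "lev r \<le> K"
    proof (cases r)
      case (Suc r')
      then show ?thesis using not_less_Least[of r' "\<lambda>r. K < lev (Suc r)"] by (simp add: r_def not_less)
    qed (simp add: lev_0)
    have iff: "x k \<le> real K / real N \<and> real K / real N < x (Suc k) \<longleftrightarrow> lev k \<le> K \<and> K < lev (Suc k)" if "k < n" for k
    proof -
      have "x k \<le> real K / real N \<longleftrightarrow> real (lev k) \<le> real K" using Np lev[of k] that by (simp add: le_divide_eq)
      moreover have "real K / real N < x (Suc k) \<longleftrightarrow> real K < real (lev (Suc k))"
        using Np lev[of "Suc k"] that by (simp add: divide_less_eq)
      ultimately show ?thesis by simp
    qed
    have the: "(THE k. k < n \<and> x k \<le> real K / real N \<and> real K / real N < x (Suc k)) = r"
    proof (rule the_equality)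
      show "r < n \<and> x r \<le> real K / real N \<and> real K / real N < x (Suc r)" using iff[OF rn] rn r1 r2 by simp
      fix k assume k: "k < n \<and> x k \<le> real K / real N \<and> real K / real N < x (Suc k)"
      then have "lev k \<le> K" "K < lev (Suc k)" using iff[of k] by auto
      then show "k = r" using k rn r1 r2 lev_mono[of "Suc k" r] lev_mono[of "Suc r" k]
        by (cases k r rule: linorder_cases) auto
    qed
    have "overlap_cov \<sigma> \<tau> = (\<Sum>k=1..r. dq k)"
    proof (unfold overlap_cov_def, rule sum.mono_neutral_cong_right)
      show "\<forall>k\<in>{1..n} - {1..r}. dq k * (if nd k (enc \<sigma>) = nd k (enc \<tau>) then 1 else 0) = 0"
      proof
        fix k assume k: "k \<in> {1..n} - {1..r}"
        then have "lev (Suc r) \<le> lev k" by (intro lev_mono) auto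
        then show "dq k * (if nd k (enc \<sigma>) = nd k (enc \<tau>) then 1 else 0) = 0" using ind[of k] k r1 by auto
      qed
      fix k assume k: "k \<in> {1..r}"
      then have "lev k \<le> lev r" using rn by (intro lev_mono) auto
      then show "dq k * (if nd k (enc \<sigma>) = nd k (enc \<tau>) then 1 else 0) = dq k" using ind[of k] k r2 rn by auto
    qed (use rn in auto)
    then show ?thesis using False Np the sum_dq[of r] rn by (simp add: t order_param_def)
  qed
qed

definition field :: "(nat \<Rightarrow> real) \<Rightarrow> (nat \<times> (nat \<Rightarrow> nat \<Rightarrow> real) \<Rightarrow> real) \<Rightarrow> real" where
  "field \<sigma> \<omega> = (\<Sum>k=1..n. sqrt (dq k) * \<omega> (nd k (enc \<sigma>)))"

lemma enc_V: "\<sigma> \<in> spins \<Longrightarrow> enc \<sigma> \<in> V n"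
  using bij_enc by (auto simp: bij_betw_def)

lemma field_measurable: "\<sigma> \<in> spins \<Longrightarrow> field \<sigma> \<in> borel_measurable P"
  unfolding field_def using nd_nodes[of _ n] enc_V
  by (intro borel_measurable_sum borel_measurable_times borel_measurable_const measurable_gauss_component) auto

text \<open>Every field value is a linear form in the node variables. The coefficient vectors of two
  configurations overlap only at shared nodes, so their inner product is
  \<open>overlap_cov\<close>.\<close>

lemma field_char:
  "(CLINT \<omega>|P. iexp (\<Sum>\<sigma>\<in>spins. c \<sigma> * field \<sigma> \<omega>)) =
    of_real (exp (- (\<Sum>\<sigma>\<in>spins. \<Sum>\<tau>\<in>spins.
      c \<sigma> * c \<tau> * overlap_cov \<sigma> \<tau>) / 2))"
proof -
  let ?S = "spins"
  define e where "e \<sigma> i = sqrt (dq (fst i)) * (if nd (fst i) (enc \<sigma>) = i then 1 else 0)" for \<sigma> i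
  have nodes_sum: "(\<Sum>i\<in>nodes. f i) = (\<Sum>k=1..n. \<Sum>u\<in>V k. f (k, u))" for f :: "_ \<Rightarrow> real"
    unfolding nodes_def using finV by (subst sum.Sigma) auto
  have single: "(\<Sum>u\<in>V k. (if nd k (enc \<sigma>) = (k, u) then f u else 0)) = f (restrict (enc \<sigma>) {1..k})"
    if "\<sigma> \<in> ?S" "k \<in> {1..n}" for \<sigma> k and f :: "_ \<Rightarrow> real"
  proof -
    have "restrict (enc \<sigma>) {1..k} \<in> V k"
      using nd_nodes[of k n "enc \<sigma>"] enc_V that by (auto simp: nodes_def nd_def)
    then show ?thesis using finV by (simp add: nd_def)
  qed
  have lin: "field \<sigma> \<omega> = (\<Sum>i\<in>nodes. e \<sigma> i * \<omega> i)" if s: "\<sigma> \<in> ?S" for \<sigma> \<omega>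
  proof -
    have "(\<Sum>i\<in>nodes. e \<sigma> i * \<omega> i) = (\<Sum>k=1..n. \<Sum>u\<in>V k. (if nd k (enc \<sigma>) = (k, u) then sqrt (dq k) * \<omega> (k, u) else 0))"
      unfolding nodes_sum e_def by (intro sum.cong) auto
    also have "\<dots> = (\<Sum>k=1..n. sqrt (dq k) * \<omega> (nd k (enc \<sigma>)))"
      using single[OF s] by (intro sum.cong refl) (simp add: nd_def)
    finally show ?thesis by (simp add: field_def)
  qed
  have cov: "(\<Sum>i\<in>nodes. e \<sigma> i * e \<tau> i) = overlap_cov \<sigma> \<tau>"
    if s: "\<sigma> \<in> ?S" for \<sigma> \<tau>
  proof -
    have "(\<Sum>i\<in>nodes. e \<sigma> i * e \<tau> i) =
      (\<Sum>k=1..n. \<Sum>u\<in>V k. (if nd k (enc \<sigma>) = (k, u) then dq k * (if nd k (enc \<tau>) = (k, u) then 1 else 0) else 0))"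
      unfolding nodes_sum e_def
    proof (intro sum.cong refl)
      fix k u assume "k \<in> {1..n}"
      then have "sqrt (dq k) * sqrt (dq k) = dq k" using dq_pos[of k] by simp
      then show "sqrt (dq (fst (k, u))) * (if nd (fst (k, u)) (enc \<sigma>) = (k, u) then 1 else 0) *
         (sqrt (dq (fst (k, u))) * (if nd (fst (k, u)) (enc \<tau>) = (k, u) then 1 else 0)) =
        (if nd k (enc \<sigma>) = (k, u) then dq k * (if nd k (enc \<tau>) = (k, u) then 1 else 0) else 0)" by simp
    qed
    also have "\<dots> = overlap_cov \<sigma> \<tau>"
    proof (unfold overlap_cov_def, intro sum.cong refl)
      fix k assume k: "k \<in> {1..n}"
      have eq: "nd k (enc \<tau>) = (k, restrict (enc \<sigma>) {1..k}) \<longleftrightarrow> nd k (enc \<sigma>) = nd k (enc \<tau>)"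
        by (auto simp: nd_def)
      show "(\<Sum>u\<in>V k. (if nd k (enc \<sigma>) = (k, u) then dq k * (if nd k (enc \<tau>) = (k, u) then 1 else 0) else 0)) =
        dq k * (if nd k (enc \<sigma>) = nd k (enc \<tau>) then 1 else 0)"
        unfolding single[OF s k] eq ..
    qed
    finally show ?thesis .
  qed
  define d where "d i = (\<Sum>\<sigma>\<in>?S. c \<sigma> * e \<sigma> i)" for i
  have "(\<Sum>\<sigma>\<in>?S. c \<sigma> * field \<sigma> \<omega>) = (\<Sum>i\<in>nodes. d i * \<omega> i)" for \<omega>
  proof -
    have "(\<Sum>\<sigma>\<in>?S. c \<sigma> * field \<sigma> \<omega>) = (\<Sum>\<sigma>\<in>?S. \<Sum>i\<in>nodes. c \<sigma> * e \<sigma> i * \<omega> i)"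
      by (intro sum.cong refl) (simp add: lin sum_distrib_left mult.assoc)
    also have "\<dots> = (\<Sum>i\<in>nodes. \<Sum>\<sigma>\<in>?S. c \<sigma> * e \<sigma> i * \<omega> i)" by (rule sum.swap)
    finally show ?thesis by (simp add: d_def sum_distrib_right)
  qed
  moreover have "(\<Sum>i\<in>nodes. (d i)\<^sup>2) = (\<Sum>\<sigma>\<in>?S. \<Sum>\<tau>\<in>?S. c \<sigma> * c \<tau> * overlap_cov \<sigma> \<tau>)"
  proof -
    have "(\<Sum>i\<in>nodes. (d i)\<^sup>2) = (\<Sum>i\<in>nodes. \<Sum>\<sigma>\<in>?S. \<Sum>\<tau>\<in>?S. c \<sigma> * c \<tau> * (e \<sigma> i * e \<tau> i))"
      unfolding d_def power2_eq_square sum_product by (intro sum.cong refl) (simp add: algebra_simps)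
    also have "\<dots> = (\<Sum>\<sigma>\<in>?S. \<Sum>\<tau>\<in>?S. \<Sum>i\<in>nodes. c \<sigma> * c \<tau> * (e \<sigma> i * e \<tau> i))"
      by (subst sum.swap, subst sum.swap[of _ nodes]) (rule refl)
    also have "\<dots> = (\<Sum>\<sigma>\<in>?S. \<Sum>\<tau>\<in>?S. c \<sigma> * c \<tau> * overlap_cov \<sigma> \<tau>)"
      by (intro sum.cong refl) (simp add: sum_distrib_left[symmetric] cov)
    finally show ?thesis .
  qed
  ultimately show ?thesis using char_gauss[OF fin_nodes, of d] by simp
qed

text \<open>All linear combinations have the same Gaussian characteristic function, so Cramer-Wold
  identifies the joint laws. This gives access to a GREM whose own space need not contain node
  variables.\<close>

lemma GREM_law:
  assumes M: "prob_space M" and G: "is_GREM M n x q N G"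
  shows "distr M (PiM (spins) (\<lambda>_. borel)) (\<lambda>\<omega>. \<lambda>\<sigma>\<in>spins. G \<sigma> \<omega>) =
    distr P (PiM (spins) (\<lambda>_. borel)) (\<lambda>\<omega>. \<lambda>\<sigma>\<in>spins. field \<sigma> \<omega>)"
proof (rule cramer_wold[OF M prob_space_gauss finite_spin])
  have gp: "centered_gaussian_process M (spins) G"
    and cov: "\<And>\<sigma> \<tau>. \<sigma> \<in> spins \<Longrightarrow> \<tau> \<in> spins \<Longrightarrow>
      (\<integral>\<omega>. G \<sigma> \<omega> * G \<tau> \<omega> \<partial>M) = order_param n x q (lex_overlap N \<sigma> \<tau>)"
    using G by (auto simp: is_GREM_def)
  show "G \<sigma> \<in> borel_measurable M" if "\<sigma> \<in> spins" for \<sigma>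
    using gp that by (auto simp: centered_gaussian_process_def)
  show "field \<sigma> \<in> borel_measurable P" if "\<sigma> \<in> spins" for \<sigma>
    using that by (rule field_measurable)
  show "(CLINT \<omega>|M. iexp (\<Sum>\<sigma>\<in>spins. c \<sigma> * G \<sigma> \<omega>)) =
     (CLINT \<omega>|P. iexp (\<Sum>\<sigma>\<in>spins. c \<sigma> * field \<sigma> \<omega>))" for c
    unfolding gaussian_process_char(1)[OF gp finite_spin] field_char order_param_overlap[symmetric]
    by (simp add: cov)
qed

section \<open>The partition function as a sum over branches, and the law of the free energy\<close>

definition wt :: "nat \<Rightarrow> (nat \<Rightarrow> real) \<Rightarrow> real" where "wt k b = \<beta> * h * (\<Sum>i\<in>blk k. b i)"
definition sd :: "nat \<Rightarrow> real" where "sd k = \<beta> * sqrt (real N) * sqrt (dq k)"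

lemma sum_blk: "j \<le> n \<Longrightarrow> (\<Sum>k=1..j. \<Sum>i\<in>blk k. f i) = (\<Sum>i=1..lev j. f i)"
proof (induction j)
  case (Suc j)
  have "{1..lev (Suc j)} = {1..lev j} \<union> blk (Suc j)"
    using lev_mono[of j "Suc j"] Suc.prems by (auto simp: blk_def)
  moreover have "{1..lev j} \<inter> blk (Suc j) = {}" by (auto simp: blk_def)
  ultimately show ?case using Suc by (simp add: sum.union_disjoint blk_def)
qed (simp add: lev_0)

lemma partition_function_field:
  "partition_function N field \<beta> h \<omega> = Rsum wt sd 1 n \<omega>"
proof -
  have e: "\<beta> * sqrt (real N) * field_process N field h \<sigma> \<omega> = energy wt sd n (enc \<sigma>) \<omega>" for \<sigma>
  proof -
    have "energy wt sd n (enc \<sigma>) \<omega> = (\<Sum>k=1..n. \<beta> * h * (\<Sum>i\<in>blk k. \<sigma> i)) + (\<Sum>k=1..n. sd k * \<omega> (nd k (enc \<sigma>)))"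
      unfolding energy_def sum.distrib
      by (intro arg_cong2[where f="(+)"] sum.cong refl) (auto simp: wt_def enc_def)
    also have "(\<Sum>k=1..n. \<beta> * h * (\<Sum>i\<in>blk k. \<sigma> i)) = \<beta> * h * (\<Sum>i=1..N. \<sigma> i)"
      using sum_blk[of n \<sigma>] lev_n by (simp add: sum_distrib_left[symmetric])
    also have "(\<Sum>k=1..n. sd k * \<omega> (nd k (enc \<sigma>))) = \<beta> * sqrt (real N) * field \<sigma> \<omega>"
      by (simp add: field_def sd_def sum_distrib_left mult.assoc)
    finally show ?thesis using N_pos by (simp add: field_process_def algebra_simps)
  qed
  show ?thesis
    unfolding partition_function_def Rsum_def e
    using sum.reindex_bij_betw[OF bij_enc, of "\<lambda>v. exp (1 * energy wt sd n v \<omega>)"] by simp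
qed

text \<open>The free energy as a function of the vector of field values alone, so that equality of
  joint laws passes to it; \<open>()\<close> is a dummy sample point.\<close>

definition fe_of :: "((nat \<Rightarrow> real) \<Rightarrow> real) \<Rightarrow> real" where
  "fe_of z = free_energy N (\<lambda>\<sigma> _. z \<sigma>) \<beta> h ()"

lemma free_energy_eq_fe_of:
  "free_energy N G \<beta> h \<omega> = fe_of (\<lambda>\<sigma>\<in>spins. G \<sigma> \<omega>)"
  unfolding fe_of_def free_energy_def partition_function_def field_process_def
  by (intro arg_cong[where f="\<lambda>z. ln z / real N"] sum.cong) auto

lemma fe_of_measurable: "fe_of \<in> borel_measurable (PiM (spins) (\<lambda>_. borel))"
  unfolding fe_of_def free_energy_def partition_function_def field_process_def
  by (intro borel_measurable_divide borel_measurable_ln borel_measurable_sum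
      measurable_compose[OF _ borel_measurable_exp] borel_measurable_times borel_measurable_add
      borel_measurable_const measurable_component_singleton) auto

theorem free_energy_law:
  assumes M: "prob_space M" and G: "is_GREM M n x q N G"
  shows "free_energy N G \<beta> h \<in> borel_measurable M"
    and "(\<lambda>\<omega>. ln (Rsum wt sd 1 n \<omega>) / real N) \<in> borel_measurable P"
    and "distr M borel (free_energy N G \<beta> h) = distr P borel (\<lambda>\<omega>. ln (Rsum wt sd 1 n \<omega>) / real N)"
proof -
  have mG: "(\<lambda>\<omega>. \<lambda>\<sigma>\<in>spins. G \<sigma> \<omega>) \<in> measurable M (PiM (spins) (\<lambda>_. borel))"
    using G by (intro measurable_restrict) (auto simp: is_GREM_def centered_gaussian_process_def)
  have mf: "(\<lambda>\<omega>. \<lambda>\<sigma>\<in>spins. field \<sigma> \<omega>) \<in> measurable P (PiM (spins) (\<lambda>_. borel))"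
    using field_measurable by (intro measurable_restrict) auto
  have 1: "free_energy N G \<beta> h = fe_of \<circ> (\<lambda>\<omega>. \<lambda>\<sigma>\<in>spins. G \<sigma> \<omega>)"
    unfolding o_def by (rule ext, rule free_energy_eq_fe_of)
  have 2: "(\<lambda>\<omega>. ln (Rsum wt sd 1 n \<omega>) / real N) = fe_of \<circ> (\<lambda>\<omega>. \<lambda>\<sigma>\<in>spins. field \<sigma> \<omega>)"
    unfolding o_def free_energy_eq_fe_of[symmetric] by (simp add: free_energy_def partition_function_field)
  show "free_energy N G \<beta> h \<in> borel_measurable M"
    unfolding 1 using mG fe_of_measurable by (rule measurable_comp)
  show "(\<lambda>\<omega>. ln (Rsum wt sd 1 n \<omega>) / real N) \<in> borel_measurable P"
    unfolding 2 using mf fe_of_measurable by (rule measurable_comp)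
  show "distr M borel (free_energy N G \<beta> h) = distr P borel (\<lambda>\<omega>. ln (Rsum wt sd 1 n \<omega>) / real N)"
    unfolding 1 2 distr_distr[OF fe_of_measurable mG, symmetric] distr_distr[OF fe_of_measurable mf, symmetric]
      GREM_law[OF M G] ..
qed

end

section \<open>Exponential tail bounds\<close>

text \<open>Under the product weights the spins are independent with mean \<open>tanh u\<close> and
  variance \<open>1 - (tanh u)^2\<close>, which is at most one; the power of
  \<open>2 * cosh u\<close> is the normalization. The second part is thus an unnormalized variance
  bound.\<close>

lemma tilted_sum:
  fixes u :: real
  assumes "finite S"
  shows "(\<Sum>b\<in>S \<rightarrow>\<^sub>E {-1, 1}. exp (u * (\<Sum>i\<in>S. b i))) = (2 * cosh u) ^ card S"
    and "(\<Sum>b\<in>S \<rightarrow>\<^sub>E {-1, 1}. exp (u * (\<Sum>i\<in>S. b i)) * ((\<Sum>i\<in>S. b i) - real (card S) * tanh u)\<^sup>2)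
      \<le> real (card S) * (2 * cosh u) ^ card S"
  using assms
proof (induction S rule: finite_induct)
  case empty
  { case 1 show ?case by simp }
  { case 2 show ?case by simp }
next
  case (insert k S)
  let ?P = "S \<rightarrow>\<^sub>E {-1, 1 :: real}"
  let ?Z = "\<lambda>b. exp (u * (\<Sum>i\<in>S. b i))"
  have sum_upd: "(\<Sum>i\<in>insert k S. (b(k := c)) i) = c + (\<Sum>i\<in>S. b i)" for b :: "_ \<Rightarrow> real" and c
    using insert by (simp, intro sum.cong) auto
  have c2: "exp (- u) + exp u = 2 * cosh u" by (simp add: cosh_def)
  { case 1
    have "(\<Sum>b\<in>insert k S \<rightarrow>\<^sub>E {-1, 1}. exp (u * (\<Sum>i\<in>insert k S. b i))) =
      (\<Sum>b\<in>?P. ?Z b * (2 * cosh u))"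
      unfolding sum_PiE_insert[OF insert(2)] sum_upd c2[symmetric]
      by (intro sum.cong refl) (simp add: exp_add[symmetric] algebra_simps)
    also have "\<dots> = (2 * cosh u) ^ card (insert k S)"
      using insert by (simp add: sum_distrib_right[symmetric])
    finally show ?case . }
  { case 2
    define t where "t = tanh u"
    define A where "A b = (\<Sum>i\<in>S. b i) - real (card S) * t" for b :: "_ \<Rightarrow> real"
    have ct: "exp u - exp (- u) = t * (2 * cosh u)"
      unfolding t_def tanh_def by (simp add: sinh_def cosh_real_nonzero)
    have t1: "1 - t\<^sup>2 \<le> 1" by simp
    \<comment> \<open>The cross term drops out because the tilted mean of the new spin is
      \<open>t\<close>; what remains is its variance.\<close>
    have trm: "(\<Sum>c\<in>{-1, 1}. exp (u * (c + (\<Sum>i\<in>S. b i))) * (c + (\<Sum>i\<in>S. b i) - real (card (insert k S)) * t)\<^sup>2)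
       = 2 * cosh u * (?Z b * (A b)\<^sup>2) + (1 - t\<^sup>2) * (2 * cosh u) * ?Z b" for b
    proof -
      have "(\<Sum>c\<in>{-1, 1}. exp (u * (c + (\<Sum>i\<in>S. b i))) * (c + (\<Sum>i\<in>S. b i) - real (card (insert k S)) * t)\<^sup>2)
        = ?Z b * (exp (- u) * (A b + (-1 - t))\<^sup>2 + exp u * (A b + (1 - t))\<^sup>2)"
        using insert by (simp add: A_def distrib_left exp_add algebra_simps)
      also have "exp (- u) * (A b + (-1 - t))\<^sup>2 + exp u * (A b + (1 - t))\<^sup>2 =
         (exp (- u) + exp u) * ((A b)\<^sup>2 - 2 * t * A b + 1 + t\<^sup>2) + (exp u - exp (- u)) * (2 * A b - 2 * t)"
        by (simp add: power2_eq_square algebra_simps)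
      also have "\<dots> = 2 * cosh u * (A b)\<^sup>2 + (1 - t\<^sup>2) * (2 * cosh u)"
        unfolding ct c2 by (simp add: power2_eq_square algebra_simps)
      finally show ?thesis by (simp add: algebra_simps)
    qed
    have "(\<Sum>b\<in>insert k S \<rightarrow>\<^sub>E {-1, 1}. exp (u * (\<Sum>i\<in>insert k S. b i)) * ((\<Sum>i\<in>insert k S. b i) - real (card (insert k S)) * tanh u)\<^sup>2)
      = (\<Sum>b\<in>?P. 2 * cosh u * (?Z b * (A b)\<^sup>2) + (1 - t\<^sup>2) * (2 * cosh u) * ?Z b)"
      unfolding sum_PiE_insert[OF insert(2)] sum_upd t_def[symmetric] trm ..
    also have "\<dots> = 2 * cosh u * (\<Sum>b\<in>?P. ?Z b * (A b)\<^sup>2) + (1 - t\<^sup>2) * (2 * cosh u) * (\<Sum>b\<in>?P. ?Z b)"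
      by (simp add: sum.distrib sum_distrib_left)
    also have "\<dots> \<le> 2 * cosh u * (real (card S) * (2 * cosh u) ^ card S) + 1 * (2 * cosh u) * (\<Sum>b\<in>?P. ?Z b)"
      using insert.IH(2) t1
      by (intro add_mono mult_left_mono mult_right_mono)
        (auto simp: A_def t_def cosh_real_nonneg intro!: sum_nonneg)
    also have "\<dots> = real (card (insert k S)) * (2 * cosh u) ^ card (insert k S)"
      using insert by (simp add: algebra_simps)
    finally show ?case . }
qed

text \<open>Chebyshev's inequality for independent spins with weights \<open>exp (u * b i)\<close>, whose mean is \<open>tanh u\<close>.\<close>

lemma card_near_tanh:
  fixes u \<eta> :: real and S :: "'i set"
  assumes S: "finite S" and u: "0 \<le> u" and \<eta>: "0 < \<eta>" and large: "2 / \<eta>\<^sup>2 \<le> real (card S)"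
  defines "H \<equiv> {b \<in> S \<rightarrow>\<^sub>E {-1, 1}. \<bar>(\<Sum>i\<in>S. b i) - real (card S) * tanh u\<bar> \<le> \<eta> * real (card S)}"
  shows "H \<noteq> {}" and "real (card S) * (ent u - u * \<eta>) - ln 2 \<le> ln (real (card H))"
proof -
  let ?P = "S \<rightarrow>\<^sub>E {-1, 1 :: real}"
  let ?M = "\<lambda>b. \<Sum>i\<in>S. b i :: real"
  define d where "d = real (card S)"
  define Z where "Z = (2 * cosh u) ^ card S"
  have finP: "finite ?P" using S by (intro finite_PiE) auto
  have finH: "finite H" using finP by (simp add: H_def)
  have HP: "H \<subseteq> ?P" by (auto simp: H_def)
  have Z: "0 < Z" by (simp add: Z_def cosh_real_pos)
  have "0 < 2 / \<eta>\<^sup>2" using \<eta> by simp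
  from less_le_trans[OF this large] have d: "0 < d" unfolding d_def .
  \<comment> \<open>Configurations outside the window carry at most half of the total weight, and
    inside it the weight of each is bounded above, so many are needed.\<close>
  have "(\<Sum>b\<in>?P - H. exp (u * ?M b)) \<le> (\<Sum>b\<in>?P - H. exp (u * ?M b) * (?M b - d * tanh u)\<^sup>2 / (\<eta> * d)\<^sup>2)"
  proof (intro sum_mono)
    fix b assume "b \<in> ?P - H"
    then have "\<eta> * d < \<bar>?M b - d * tanh u\<bar>" by (auto simp: H_def d_def not_le)
    then have "(\<eta> * d)\<^sup>2 \<le> (?M b - d * tanh u)\<^sup>2" using \<eta> d by (subst abs_le_square_iff[symmetric]) auto
    then show "exp (u * ?M b) \<le> exp (u * ?M b) * (?M b - d * tanh u)\<^sup>2 / (\<eta> * d)\<^sup>2"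
      using \<eta> d by (simp add: le_divide_eq)
  qed
  also have "\<dots> \<le> (\<Sum>b\<in>?P. exp (u * ?M b) * (?M b - d * tanh u)\<^sup>2 / (\<eta> * d)\<^sup>2)"
    using finP by (intro sum_mono2) auto
  also have "\<dots> \<le> d * Z / (\<eta> * d)\<^sup>2"
    using tilted_sum(2)[OF S, of u] unfolding sum_divide_distrib[symmetric] d_def[symmetric] Z_def[symmetric]
    by (intro divide_right_mono) auto
  also have "\<dots> \<le> Z / 2"
  proof -
    \<comment> \<open>The size hypothesis is tuned so that Chebyshev leaves exactly the proportion
      1/2.\<close>
    have "2 \<le> d * \<eta>\<^sup>2" using large \<eta> by (simp add: d_def divide_le_eq)
    then have "2 * (d * Z) \<le> (d * \<eta>\<^sup>2) * (d * Z)" using d Z by (intro mult_right_mono) auto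
    then have "d * Z \<le> Z / 2 * (\<eta> * d)\<^sup>2" by (simp add: power2_eq_square algebra_simps)
    moreover have "0 < (\<eta> * d)\<^sup>2" using d \<eta> by simp
    ultimately show ?thesis by (simp only: divide_le_eq if_True)
  qed
  finally have out: "(\<Sum>b\<in>?P - H. exp (u * ?M b)) \<le> Z / 2" .
  have "Z = (\<Sum>b\<in>?P - H. exp (u * ?M b)) + (\<Sum>b\<in>H. exp (u * ?M b))"
    using tilted_sum(1)[OF S, of u] sum.subset_diff[OF HP finP, of "\<lambda>b. exp (u * ?M b)"] by (simp add: Z_def)
  with out have "Z / 2 \<le> (\<Sum>b\<in>H. exp (u * ?M b))" by simp
  also have "\<dots> \<le> (\<Sum>b\<in>H. exp (u * (d * tanh u + \<eta> * d)))"
    using u by (intro sum_mono) (auto simp: H_def d_def intro!: mult_left_mono)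
  also have "\<dots> = real (card H) * exp (u * (d * tanh u + \<eta> * d))" by simp
  finally have *: "Z / 2 \<le> real (card H) * exp (u * (d * tanh u + \<eta> * d))" .
  show "H \<noteq> {}" using * Z by auto
  then have cH: "0 < real (card H)" using finH by (simp add: card_gt_0_iff)
  have "ln (Z / 2) \<le> ln (real (card H) * exp (u * (d * tanh u + \<eta> * d)))"
    using * Z by (intro ln_mono) auto
  also have "\<dots> = ln (real (card H)) + u * (d * tanh u + \<eta> * d)" using cH by (simp add: ln_mult)
  finally have "ln Z - ln 2 \<le> ln (real (card H)) + u * (d * tanh u + \<eta> * d)" using Z by (simp add: ln_div)
  moreover have "ln Z = d * ln (2 * cosh u)"
    unfolding Z_def d_def by (rule ln_realpow)
  ultimately show "real (card S) * (ent u - u * \<eta>) - ln 2 \<le> ln (real (card H))"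
    by (simp add: ent_def d_def[symmetric] algebra_simps)
qed

section \<open>Deviation bounds for the partition function at fixed size\<close>

context grem_level
begin

lemma card_blk: "k \<in> {1..n} \<Longrightarrow> real (card (blk k)) = (x k - x (k - 1)) * real N"
  using lev[of k] lev[of "k - 1"] lev_mono[of "k - 1" k] by (auto simp: blk_def of_nat_diff algebra_simps)

text \<open>With exponent \<open>l / \<beta>\<close> the inverse temperature cancels. The Gaussian
  term \<open>l^2 * dq k / 2\<close> is read as the energy \<open>l * (l * dq k)\<close> minus the
  entropy cost \<open>l^2 * dq k / 2\<close>, which splits the result into \<open>gain\<close> and
  \<open>excess\<close>.\<close>

lemma ln_Kfac:
  assumes "k \<in> {1..n}" "0 < l"
  shows "ln (Kfac wt sd (l / \<beta>) k) = real N * (excess k k l + l * gain k k l)"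
proof -
  have p: "l / \<beta> * wt k b = l * h * (\<Sum>i\<in>blk k. b i)" for b using \<beta> by (simp add: wt_def)
  have s: "(l / \<beta>)\<^sup>2 * (sd k)\<^sup>2 = l\<^sup>2 * real N * dq k"
    using \<beta> dq_pos[OF assms(1)] by (simp add: sd_def power_mult_distrib power_divide)
  have "Kfac wt sd (l / \<beta>) k = (2 * cosh (l * h)) ^ card (blk k) * exp (l\<^sup>2 * real N * dq k / 2)"
    unfolding Kfac_def p s cfg_def by (subst tilted_sum) (simp_all add: blk_def)
  then have "ln (Kfac wt sd (l / \<beta>) k) = real (card (blk k)) * ln (2 * cosh (l * h)) + l\<^sup>2 * real N * dq k / 2"
    by (simp add: ln_mult ln_realpow cosh_real_pos distrib_left)
  also have "ln (2 * cosh (l * h)) = ent (l * h) + l * h * tanh (l * h)" by (simp add: ent_def)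
  finally show ?thesis
    unfolding card_blk[OF assms(1)] excess_def gain_def dq_def
    by (simp add: algebra_simps power2_eq_square add_divide_distrib diff_divide_distrib)
qed

text \<open>Dividing \<open>ln_Kfac\<close> by the exponent \<open>l k / \<beta>\<close> weights the
  excess of each level by \<open>\<beta> / l k\<close> instead of one. The slackness clause says
  that the differences sum to zero, so \<open>W\<close> and the margins remain.\<close>

lemma upper_dev:
  assumes t: "tilts \<beta> n \<beta> l W"
  shows "measure P {\<omega> \<in> space P.
      real N * W + r * (\<Sum>k=1..n. \<beta> / l k) < ln (Rsum wt sd 1 n \<omega>)} \<le> real n * exp (- r)"
proof -
  have l: "0 < l k" "l k \<le> \<beta>" if "k \<in> {1..n}" for k using t that unfolding tilts_def by auto
  have mono: "\<forall>j\<in>{1..n}. \<forall>k\<in>{1..n}. j \<le> k \<longrightarrow> l j \<le> l k" using t unfolding tilts_def by blast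
  have slack: "(\<Sum>j=1..n. (\<beta> / l j - 1) * excess j j (l j)) = 0"
    and W: "(\<Sum>j=1..n. excess j j (l j) + \<beta> * gain j j (l j)) = W"
    using t unfolding tilts_def by blast+
  have "(\<Sum>k=1..n. (r + ln (Kfac wt sd (l k / \<beta>) k)) / (l k / \<beta>)) =
     (\<Sum>k=1..n. r * (\<beta> / l k) + real N * ((\<beta> / l k - 1) * excess k k (l k)) + real N * (excess k k (l k) + \<beta> * gain k k (l k)))"
  proof (intro sum.cong refl)
    fix k assume k: "k \<in> {1..n}"
    have lb: "0 < l k" using l k by simp
    have e: "(r + real N * (E + lk * g)) / (lk / \<beta>) = r * (\<beta> / lk) + real N * ((\<beta> / lk - 1) * E) + real N * (E + \<beta> * g)"
      if "0 < lk" for lk E g using that \<beta> by (simp add: field_simps)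
    show "(r + ln (Kfac wt sd (l k / \<beta>) k)) / (l k / \<beta>) =
      r * (\<beta> / l k) + real N * ((\<beta> / l k - 1) * excess k k (l k)) + real N * (excess k k (l k) + \<beta> * gain k k (l k))"
      unfolding ln_Kfac[OF k lb] by (rule e[OF lb])
  qed
  also have "\<dots> = r * (\<Sum>k=1..n. \<beta> / l k) + real N * W"
    unfolding sum.distrib[of "\<lambda>k. _ k + _ k"] sum.distrib[of "\<lambda>k. r * _ k"] sum_distrib_left[symmetric] slack W by simp
  finally have "(\<Sum>k=1..n. (r + ln (Kfac wt sd (l k / \<beta>) k)) / (l k / \<beta>)) = real N * W + r * (\<Sum>k=1..n. \<beta> / l k)"
    by simp
  with upper_tail[of "\<lambda>k. l k / \<beta>" r wt sd] l mono \<beta> show ?thesis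
    by (simp add: divide_right_mono)
qed

text \<open>Level \<open>k\<close> keeps the block configurations whose magnetization per spin is
  within \<open>\<eta>\<close> of \<open>tanh (l k * h)\<close>, and the Gaussians above their
  tilted mean. The window costs at most \<open>\<beta> * h * \<eta>\<close> per spin and level in
  the entropy and once more in the field energy, hence the factor 2 in the value but not in the
  probability; \<open>R\<close> collects errors of order \<open>sqrt N\<close>.\<close>

lemma lower_dev:
  assumes l: "\<And>k. k \<in> {1..n} \<Longrightarrow> 0 < l k \<and> l k \<le> \<beta>" and \<eta>: "0 < \<eta>"
    and large: "\<And>k. k \<in> {1..n} \<Longrightarrow> 2 / \<eta>\<^sup>2 \<le> (x k - x (k - 1)) * real N"
  defines "R \<equiv> real n * (sqrt (real N) * \<beta> + 4)"
  shows "measure P {\<omega> \<in> space P.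
      ln (Rsum wt sd 1 n \<omega>) < real N * ((\<Sum>k=1..n. excess k k (l k) + \<beta> * gain k k (l k)) - 2 * real n * \<beta> * h * \<eta>) - R - ln 2}
    \<le> 4 * (\<Sum>k=1..n. exp (- (real N * ((\<Sum>j=1..k. excess j j (l j)) - real n * \<beta> * h * \<eta>) - R)))"
proof -
  \<comment> \<open>The value 0 outside the levels keeps \<open>y k\<close> nonnegative, so the tail
    estimate and the positivity of \<open>p k\<close> hold for every \<open>k\<close>.\<close>
  define y where "y k = (if k \<in> {1..n} then sqrt (real N) * l k * sqrt (dq k) else 0)" for k
  define p where "p k = measure std_normal_distribution {y k..}" for k
  have dq1: "dq k \<le> 1" if "k \<in> {1..n}" for k
  proof -
    have "0 \<le> q (k - 1)" using q_strict[of 0 "k - 1"] that q0 by (cases "k - 1 = 0") (auto simp: less_imp_le)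
    moreover have "q k \<le> 1" using q_strict[of k n] that qn by (cases "k = n") (auto simp: less_imp_le)
    ultimately show ?thesis by (simp add: dq_def)
  qed
  have dx: "0 < x k - x (k - 1)" "x k - x (k - 1) \<le> 1" if "k \<in> {1..n}" for k
  proof -
    have "0 \<le> x (k - 1)" using x_strict[of 0 "k - 1"] that x0 by (cases "k - 1 = 0") (auto simp: less_imp_le)
    moreover have "x k \<le> 1" using x_strict[of k n] that xn by (cases "k = n") (auto simp: less_imp_le)
    ultimately show "x k - x (k - 1) \<le> 1" by simp
    show "0 < x k - x (k - 1)" using x_strict[of "k - 1" k] that by auto
  qed
  have y0: "0 \<le> y k" for k using l by (auto simp: y_def less_imp_le dq_pos)
  have yb: "y k \<le> sqrt (real N) * \<beta>" if "k \<in> {1..n}" for k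
  proof -
    have "l k * sqrt (dq k) \<le> \<beta> * 1" using l[OF that] dq1[OF that] dq_pos[OF that] \<beta> by (intro mult_mono) auto
    then show ?thesis using that by (simp add: y_def mult.assoc mult_left_mono)
  qed
  have pge: "exp (- (y k + 1)\<^sup>2 / 2) / sqrt (2 * pi) \<le> p k" for k
    unfolding p_def using y0 by (rule std_normal_tail_ge)
  have ppos: "0 < p k" for k using less_le_trans[OF _ pge[of k]] by simp
  \<comment> \<open>Expanding \<open>(y k + 1)^2 / 2\<close> leaves 1/2, and
    \<open>ln (sqrt (2 * pi)) \<le> 2\<close> supplies the rest of the 5/2.\<close>
  have lnp: "- (y k)\<^sup>2 / 2 - y k - 5/2 \<le> ln (p k)" for k
  proof -
    have "ln (exp (- (y k + 1)\<^sup>2 / 2) / sqrt (2 * pi)) \<le> ln (p k)" using pge by (intro ln_mono) auto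
    moreover have "ln (sqrt (2 * pi)) \<le> 2"
    proof -
      have "sqrt (2 * pi) \<le> sqrt (3\<^sup>2)" using pi_less_4 by (intro real_sqrt_le_mono) simp
      then show ?thesis using ln_le_minus_one[of "sqrt (2 * pi)"] by simp
    qed
    ultimately show ?thesis by (simp add: ln_div power2_sum field_simps)
  qed
  define u where "u k = l k * h" for k
  have u0: "0 \<le> u k" if "k \<in> {1..n}" for k using l[OF that] h by (simp add: u_def)
  define H where "H k = {b \<in> cfg k. \<bar>(\<Sum>i\<in>blk k. b i) - real (card (blk k)) * tanh (u k)\<bar> \<le> \<eta> * real (card (blk k))}" for k
  have H: "H k \<subseteq> cfg k" for k by (auto simp: H_def)
  have finblk: "finite (blk k)" for k by (simp add: blk_def)
  have near: "H k \<noteq> {}" "real (card (blk k)) * (ent (u k) - u k * \<eta>) - ln 2 \<le> ln (real (card (H k)))"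
    if k: "k \<in> {1..n}" for k
    using card_near_tanh[OF finblk u0[OF k] \<eta>, of k] large[OF k] unfolding card_blk[OF k, symmetric] H_def cfg_def by auto
  have cH: "0 < real (card (H k))" if k: "k \<in> {1..n}" for k
    using near(1)[OF k] finite_subset[OF H fin_cfg, of k] by (simp add: card_gt_0_iff)
  \<comment> \<open>The 4 covers the 5/2 of \<open>lnp\<close> and the \<open>ln 2\<close> of
    \<open>near\<close>; the linear term \<open>y k\<close> is at most
    \<open>sqrt N * \<beta>\<close>.\<close>
  have gp: "real N * (excess k k (l k) - \<beta> * h * \<eta>) - (sqrt (real N) * \<beta> + 4) \<le> ln (real (card (H k)) * p k)"
    if k: "k \<in> {1..n}" for k
  proof -
    have "ln (real (card (H k)) * p k) = ln (real (card (H k))) + ln (p k)" using cH[OF k] ppos[of k] by (simp add: ln_mult)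
    moreover have "(y k)\<^sup>2 = real N * ((l k)\<^sup>2 * dq k)" using k dq_pos[OF k] by (simp add: y_def power_mult_distrib)
    moreover have "real (card (blk k)) * (ent (u k) - u k * \<eta>) - real N * ((l k)\<^sup>2 * dq k) / 2 \<ge> real N * (excess k k (l k) - \<beta> * h * \<eta>)"
    proof -
      have "(x k - x (k - 1)) * (l k * h * \<eta>) \<le> 1 * (\<beta> * h * \<eta>)"
        using dx[OF k] l[OF k] h \<eta> by (intro mult_mono mult_right_mono) auto
      then have "real N * ((x k - x (k - 1)) * (l k * h * \<eta>)) \<le> real N * (\<beta> * h * \<eta>)" by (intro mult_left_mono) auto
      then show ?thesis unfolding card_blk[OF k] excess_def u_def dq_def by (simp add: algebra_simps diff_divide_distrib)
    qed
    moreover have "ln (2::real) \<le> 1" using ln_le_minus_one[of "2::real"] by simp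
    ultimately show ?thesis using near(2)[OF k] lnp[of k] yb[OF k] by linarith
  qed
  define al where "al k = \<beta> * h * ((tanh (u k) - \<eta>) * real (card (blk k)))" for k
  have al: "al k \<le> wt k b" if "b \<in> H k" for k b
    unfolding al_def wt_def using that \<beta> h
    by (intro mult_left_mono) (auto simp: H_def abs_le_iff algebra_simps)
  have sdpos: "0 \<le> sd k" if "k \<in> {1..n}" for k using \<beta> dq_pos[OF that] by (simp add: sd_def)
  have trm: "real N * (excess k k (l k) + \<beta> * gain k k (l k) - 2 * \<beta> * h * \<eta>) - (sqrt (real N) * \<beta> + 4)
      \<le> ln (real (card (H k)) * p k) + al k + sd k * y k" if k: "k \<in> {1..n}" for k
  proof -
    have "sd k * y k = real N * (\<beta> * (l k * dq k))"
      using k dq_pos[OF k] by (simp add: sd_def y_def mult_ac)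
    moreover have "al k = real N * (\<beta> * (h * (x k - x (k - 1)) * tanh (l k * h))) - real N * ((x k - x (k - 1)) * (\<beta> * h * \<eta>))"
      unfolding al_def card_blk[OF k] u_def by (simp add: algebra_simps)
    moreover have "real N * ((x k - x (k - 1)) * (\<beta> * h * \<eta>)) \<le> real N * (1 * (\<beta> * h * \<eta>))"
      using dx[OF k] \<beta> h \<eta> by (intro mult_left_mono mult_right_mono) auto
    moreover have "real N * (\<beta> * gain k k (l k)) = real N * (\<beta> * (l k * dq k)) + real N * (\<beta> * (h * (x k - x (k - 1)) * tanh (l k * h)))"
      by (simp add: gain_def dq_def algebra_simps)
    ultimately show ?thesis using gp[OF k] by (simp add: algebra_simps)
  qed
  have sumterm: "real N * ((\<Sum>k=1..n. excess k k (l k) + \<beta> * gain k k (l k)) - 2 * real n * \<beta> * h * \<eta>) - R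
      \<le> (\<Sum>k=1..n. ln (real (card (H k)) * p k) + al k + sd k * y k)"
  proof -
    have "(\<Sum>k=1..n. real N * (excess k k (l k) + \<beta> * gain k k (l k) - 2 * \<beta> * h * \<eta>) - (sqrt (real N) * \<beta> + 4))
      \<le> (\<Sum>k=1..n. ln (real (card (H k)) * p k) + al k + sd k * y k)"
      using trm by (intro sum_mono) auto
    moreover have "(\<Sum>k=1..n. real N * (excess k k (l k) + \<beta> * gain k k (l k) - 2 * \<beta> * h * \<eta>) - (sqrt (real N) * \<beta> + 4))
       = real N * ((\<Sum>k=1..n. excess k k (l k) + \<beta> * gain k k (l k)) - 2 * real n * \<beta> * h * \<eta>) - R"
      unfolding sum_subtractf sum_distrib_left[symmetric] R_def by (simp add: right_diff_distrib)
    ultimately show ?thesis by simp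
  qed
  have prodb: "1 / (\<Prod>j=1..k. real (card (H j)) * p j) \<le> exp (- (real N * ((\<Sum>j=1..k. excess j j (l j)) - real n * \<beta> * h * \<eta>) - R))"
    if k: "k \<in> {1..n}" for k
  proof -
    have pos: "0 < real (card (H j)) * p j" if "j \<in> {1..k}" for j using cH[of j] ppos[of j] that k by simp
    have "real N * ((\<Sum>j=1..k. excess j j (l j)) - real k * \<beta> * h * \<eta>) - real k * (sqrt (real N) * \<beta> + 4)
      = (\<Sum>j=1..k. real N * (excess j j (l j) - \<beta> * h * \<eta>) - (sqrt (real N) * \<beta> + 4))"
      unfolding sum_subtractf sum_distrib_left[symmetric] by (simp add: right_diff_distrib)
    also have "\<dots> \<le> (\<Sum>j=1..k. ln (real (card (H j)) * p j))" using gp k by (intro sum_mono) auto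
    also have "\<dots> = ln (\<Prod>j=1..k. real (card (H j)) * p j)" using pos by (intro ln_prod[symmetric]) force+
    finally have 1: "real N * ((\<Sum>j=1..k. excess j j (l j)) - real k * \<beta> * h * \<eta>) - real k * (sqrt (real N) * \<beta> + 4)
        \<le> ln (\<Prod>j=1..k. real (card (H j)) * p j)" .
    have "real k * (sqrt (real N) * \<beta> + 4) \<le> R" unfolding R_def using k \<beta> by (intro mult_right_mono) auto
    moreover have "real N * (real k * \<beta> * h * \<eta>) \<le> real N * (real n * \<beta> * h * \<eta>)"
      using k \<beta> h \<eta> by (intro mult_left_mono mult_right_mono) auto
    ultimately have "real N * ((\<Sum>j=1..k. excess j j (l j)) - real n * \<beta> * h * \<eta>) - R \<le> ln (\<Prod>j=1..k. real (card (H j)) * p j)"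
      using 1 by (simp add: right_diff_distrib)
    moreover have P: "0 < (\<Prod>j=1..k. real (card (H j)) * p j)" using pos by (intro prod_pos) auto
    ultimately have "exp (real N * ((\<Sum>j=1..k. excess j j (l j)) - real n * \<beta> * h * \<eta>) - R) \<le> (\<Prod>j=1..k. real (card (H j)) * p j)"
      by (simp add: ln_ge_iff)
    then show ?thesis using P by (subst exp_minus) (simp add: inverse_eq_divide frac_le)
  qed
  interpret P: prob_space "P" by (rule prob_space_gauss)
  have "measure P {\<omega> \<in> space P.
      ln (Rsum wt sd 1 n \<omega>) < real N * ((\<Sum>k=1..n. excess k k (l k) + \<beta> * gain k k (l k)) - 2 * real n * \<beta> * h * \<eta>) - R - ln 2}
    \<le> measure P {\<omega> \<in> space P.
      ln (Rsum wt sd 1 n \<omega>) < (\<Sum>k=1..n. ln (real (card (H k)) * p k) + al k + sd k * y k) - ln 2}"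
  proof (rule P.finite_measure_mono)
    show "{\<omega> \<in> space P.
      ln (Rsum wt sd 1 n \<omega>) < (\<Sum>k=1..n. ln (real (card (H k)) * p k) + al k + sd k * y k) - ln 2} \<in> P.events"
    proof -
      have [measurable]: "Rsum wt sd 1 n \<in> borel_measurable P" by (rule Rsum_measurable) simp
      show ?thesis by measurable
    qed
  qed (use sumterm in auto)
  also have "\<dots> \<le> 4 * (\<Sum>k=1..n. 1 / (\<Prod>j=1..k. real (card (H j)) * p j))"
    using H near(1) al sdpos ppos by (intro lower_tail) (auto simp: p_def)
  also have "\<dots> \<le> 4 * (\<Sum>k=1..n. exp (- (real N * ((\<Sum>j=1..k. excess j j (l j)) - real n * \<beta> * h * \<eta>) - R)))"
    using prodb by (intro mult_left_mono sum_mono) auto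
  finally show ?thesis .
qed

end

section \<open>Convergence\<close>

context grem_level
begin

text \<open>\<open>K\<close> is an annealed bound: the mean of \<open>Z\<close> is at most
  \<open>exp (N * K)\<close>. Negative values of the free energy are controlled by a single
  Boltzmann weight, values above \<open>K\<close> by \<open>Z / exp (N * K)\<close>, whose mean is
  at most one. This makes the bound independent of \<open>N\<close>.\<close>

lemma free_energy_second_moment:
  assumes M: "prob_space M" and G: "is_GREM M n x q N G"
  defines "K \<equiv> ln 2 + \<beta> * h + \<beta>\<^sup>2 / 2"
  shows "integrable M (\<lambda>\<omega>. (free_energy N G \<beta> h \<omega>)\<^sup>2)"
    and "(\<integral>\<omega>. (free_energy N G \<beta> h \<omega>)\<^sup>2 \<partial>M) \<le> \<beta>\<^sup>2 + 2 * K\<^sup>2 + 4"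
proof -
  interpret M: prob_space M by fact
  let ?S = "spin_configs N"
  have gp: "centered_gaussian_process M ?S G"
    and cov: "\<And>\<sigma> \<tau>. \<sigma> \<in> ?S \<Longrightarrow> \<tau> \<in> ?S \<Longrightarrow>
      (\<integral>\<omega>. G \<sigma> \<omega> * G \<tau> \<omega> \<partial>M) = order_param n x q (lex_overlap N \<sigma> \<tau>)"
    using G by (auto simp: is_GREM_def)
  have Gm: "G \<sigma> \<in> borel_measurable M" if "\<sigma> \<in> ?S" for \<sigma>
    using gp that by (auto simp: centered_gaussian_process_def)
  have N1: "distr M borel (G \<sigma>) = centered_normal 1" if s: "\<sigma> \<in> ?S" for \<sigma>
  proof -
    have "\<exists>v\<ge>0. distr M borel (\<lambda>\<omega>. \<Sum>t\<in>T. c t * G t \<omega>) = centered_normal v"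
      if "finite T" "T \<subseteq> ?S" for T c
      using gp that by (auto simp: centered_gaussian_process_def)
    from this[of "{\<sigma>}" "\<lambda>_. 1"] s obtain v
      where v: "0 \<le> v" "distr M borel (G \<sigma>) = centered_normal v" by auto
    have "v = order_param n x q (lex_overlap N \<sigma> \<sigma>)"
      using centered_normal_facts(2)[OF Gm[OF s] v(2,1)] cov[OF s s] by (simp add: power2_eq_square)
    also have "\<dots> = 1" unfolding order_param_overlap overlap_cov_def using sum_dq[of n] by (simp add: qn)
    finally show ?thesis using v by simp
  qed
  have facts: "integrable M (\<lambda>\<omega>. (G \<sigma> \<omega>)\<^sup>2)" "(\<integral>\<omega>. (G \<sigma> \<omega>)\<^sup>2 \<partial>M) = 1"
    "(\<integral>\<^sup>+\<omega>. ennreal (exp (t * G \<sigma> \<omega>)) \<partial>M) = ennreal (exp (t\<^sup>2 / 2))" if s: "\<sigma> \<in> ?S" for \<sigma> t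
    using centered_normal_facts(1,2,4)[OF Gm[OF s] N1[OF s]] by simp_all
  define Z where "Z \<omega> = partition_function N G \<beta> h \<omega>" for \<omega>
  have Zm: "Z \<in> borel_measurable M" unfolding Z_def partition_function_def field_process_def
    using Gm by (intro borel_measurable_sum measurable_compose[OF _ borel_measurable_exp]
      borel_measurable_times borel_measurable_add borel_measurable_const) auto
  \<comment> \<open>For the all-plus configuration the field term is nonnegative, so the free energy
    is bounded below through its Gaussian alone.\<close>
  define s0 where "s0 = (\<lambda>i\<in>{1..N}. 1 :: real)"
  have s0: "s0 \<in> ?S" by (simp add: s0_def spin_configs_def)
  have Np: "0 < real N" using N_pos by simp
  have Zpos: "0 < Z \<omega>" for \<omega> unfolding Z_def partition_function_def
    using finite_spin s0 by (intro sum_pos) auto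
  have trm: "\<beta> * sqrt (real N) * field_process N G h \<sigma> \<omega> = \<beta> * sqrt (real N) * G \<sigma> \<omega> + \<beta> * h * (\<Sum>i=1..N. \<sigma> i)" for \<sigma> \<omega>
    using Np by (simp add: field_process_def algebra_simps)
  have EZ: "(\<integral>\<^sup>+\<omega>. ennreal (Z \<omega>) \<partial>M) \<le> ennreal (exp (real N * K))"
  proof -
    have "(\<integral>\<^sup>+\<omega>. ennreal (Z \<omega>) \<partial>M) \<le> (\<integral>\<^sup>+\<omega>. (\<Sum>\<sigma>\<in>?S. ennreal (exp (\<beta> * h * real N)) * ennreal (exp ((\<beta> * sqrt (real N)) * G \<sigma> \<omega>))) \<partial>M)"
    proof (intro nn_integral_mono)
      fix \<omega>
      have "Z \<omega> \<le> (\<Sum>\<sigma>\<in>?S. exp (\<beta> * h * real N) * exp ((\<beta> * sqrt (real N)) * G \<sigma> \<omega>))"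
        unfolding Z_def partition_function_def trm
      proof (intro sum_mono)
        fix \<sigma> assume s: "\<sigma> \<in> ?S"
        have "(\<Sum>i=1..N. \<sigma> i) \<le> (\<Sum>i=1..N. 1)"
        proof (rule sum_mono)
          fix i assume "i \<in> {1..N}"
          with s have "\<sigma> i \<in> {-1, 1}" by (simp only: spin_configs_def PiE_iff)
          then show "\<sigma> i \<le> 1" by auto
        qed
        then have "\<beta> * h * (\<Sum>i=1..N. \<sigma> i) \<le> \<beta> * h * real N" using \<beta> h by (intro mult_left_mono) auto
        then show "exp (\<beta> * sqrt (real N) * G \<sigma> \<omega> + \<beta> * h * (\<Sum>i=1..N. \<sigma> i)) \<le>
          exp (\<beta> * h * real N) * exp ((\<beta> * sqrt (real N)) * G \<sigma> \<omega>)"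
          unfolding exp_add[symmetric] by simp
      qed
      then show "ennreal (Z \<omega>) \<le> (\<Sum>\<sigma>\<in>?S. ennreal (exp (\<beta> * h * real N)) * ennreal (exp ((\<beta> * sqrt (real N)) * G \<sigma> \<omega>)))"
        by (subst ennreal_sum_mult) (auto intro: ennreal_leI)
    qed
    also have "\<dots> = (\<Sum>\<sigma>\<in>?S. ennreal (exp (\<beta> * h * real N)) * (\<integral>\<^sup>+\<omega>. ennreal (exp ((\<beta> * sqrt (real N)) * G \<sigma> \<omega>)) \<partial>M))"
    proof -
      have m: "(\<lambda>\<omega>. ennreal (exp ((\<beta> * sqrt (real N)) * G \<sigma> \<omega>))) \<in> borel_measurable M" if "\<sigma> \<in> ?S" for \<sigma>
      proof -
        have [measurable]: "G \<sigma> \<in> borel_measurable M" by (rule Gm[OF that])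
        show ?thesis by measurable
      qed
      show ?thesis
        using m by (subst nn_integral_sum) (auto intro!: sum.cong nn_integral_cmult borel_measurable_times_ennreal)
    qed
    also have "\<dots> = (\<Sum>\<sigma>\<in>?S. ennreal (exp (\<beta> * h * real N) * exp (\<beta>\<^sup>2 * real N / 2)))"
      using facts(3) by (intro sum.cong refl) (simp add: ennreal_mult power_mult_distrib)
    also have "\<dots> = ennreal (2 ^ N * (exp (\<beta> * h * real N) * exp (\<beta>\<^sup>2 * real N / 2)))"
      by (subst sum_ennreal) (auto simp: spin_configs_def card_PiE numeral_2_eq_2[symmetric])
    also have "2 ^ N * (exp (\<beta> * h * real N) * exp (\<beta>\<^sup>2 * real N / 2)) = exp (real N * K)"
    proof -
      have "(2::real) ^ N = exp (real N * ln 2)" by (simp add: exp_of_nat_mult)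
      then show ?thesis by (simp add: K_def exp_add[symmetric] algebra_simps)
    qed
    finally show ?thesis .
  qed
  have Zi: "integrable M Z" using Zm EZ Zpos
    by (intro integrableI_nonneg) (auto simp: less_imp_le intro: le_less_trans)
  have EZr: "(\<integral>\<omega>. Z \<omega> \<partial>M) \<le> exp (real N * K)"
  proof -
    have "ennreal (\<integral>\<omega>. Z \<omega> \<partial>M) = (\<integral>\<^sup>+\<omega>. ennreal (Z \<omega>) \<partial>M)"
      using Zi Zpos by (intro nn_integral_eq_integral[symmetric]) (auto simp: less_imp_le)
    with EZ have "ennreal (\<integral>\<omega>. Z \<omega> \<partial>M) \<le> ennreal (exp (real N * K))" by (simp only:)
    then show ?thesis by (subst (asm) ennreal_le_iff) auto
  qed
  let ?p = "free_energy N G \<beta> h"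
  let ?D = "\<lambda>\<omega>. \<beta>\<^sup>2 * (G s0 \<omega>)\<^sup>2 + 2 * K\<^sup>2 + 4 * exp (- (real N * K)) * Z \<omega>"
  have Kpos: "0 < K" unfolding K_def using \<beta> h by (intro add_pos_nonneg) auto
  have bound: "(?p \<omega>)\<^sup>2 \<le> ?D \<omega>" for \<omega>
  proof -
    have pZ: "real N * ?p \<omega> = ln (Z \<omega>)" using Np by (simp add: free_energy_def Z_def)
    have nn: "0 \<le> \<beta>\<^sup>2 * (G s0 \<omega>)\<^sup>2" "0 \<le> 4 * exp (- (real N * K)) * Z \<omega>" "0 \<le> K\<^sup>2"
      using Zpos[of \<omega>] by auto
    consider "?p \<omega> < 0" | "0 \<le> ?p \<omega>" "?p \<omega> \<le> K" | "K < ?p \<omega>" by linarith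
    then show ?thesis
    proof cases
      case 1
      have "exp (\<beta> * sqrt (real N) * field_process N G h s0 \<omega>) \<le> Z \<omega>"
        unfolding Z_def partition_function_def using finite_spin s0 by (intro member_le_sum) auto
      then have "\<beta> * sqrt (real N) * field_process N G h s0 \<omega> \<le> ln (Z \<omega>)" using Zpos by (simp add: ln_ge_iff)
      moreover have "0 \<le> \<beta> * h * (\<Sum>i=1..N. s0 i)" using \<beta> h by (auto simp: s0_def intro!: mult_nonneg_nonneg)
      ultimately have "\<beta> * sqrt (real N) * G s0 \<omega> \<le> real N * ?p \<omega>" unfolding trm pZ by simp
      then have "real N * - ?p \<omega> \<le> sqrt (real N) * (\<beta> * \<bar>G s0 \<omega>\<bar>)"
        using mult_left_mono[OF abs_ge_minus_self[of "G s0 \<omega>"], of "\<beta> * sqrt (real N)"] \<beta> by (simp add: algebra_simps)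
      also have "\<dots> \<le> real N * (\<beta> * \<bar>G s0 \<omega>\<bar>)"
      proof (rule mult_right_mono)
        show "sqrt (real N) \<le> real N" using N_pos by (intro real_le_lsqrt) (simp_all add: power2_eq_square)
      qed (use \<beta> in simp)
      finally have "- ?p \<omega> \<le> \<beta> * \<bar>G s0 \<omega>\<bar>" using Np by (rule mult_left_le_imp_le)
      then have "(- ?p \<omega>)\<^sup>2 \<le> (\<beta> * \<bar>G s0 \<omega>\<bar>)\<^sup>2" using 1 by (intro power_mono) auto
      then have "(?p \<omega>)\<^sup>2 \<le> \<beta>\<^sup>2 * (G s0 \<omega>)\<^sup>2" by (simp add: power_mult_distrib)
      then show ?thesis using nn by linarith
    next
      case 2
      then have "(?p \<omega>)\<^sup>2 \<le> K\<^sup>2" by (intro power_mono)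
      with nn show ?thesis by linarith
    next
      case 3
      define z where "z = ?p \<omega> - K"
      have z: "0 < z" using 3 by (simp add: z_def)
      \<comment> \<open>The quadratic Taylor term gives the 2, and \<open>N \<ge> 1\<close> permits
        passing to \<open>exp (N * z)\<close>, a multiple of \<open>Z\<close>.\<close>
      have "z\<^sup>2 \<le> 2 * exp z" using exp_lower_Taylor_quadratic[of z] z by simp
      also have "\<dots> \<le> 2 * exp (real N * z)" using z N_pos by simp
      also have "exp (real N * z) = exp (- (real N * K)) * Z \<omega>"
        using Zpos[of \<omega>] by (simp add: z_def right_diff_distrib pZ exp_diff exp_minus field_simps)
      finally have "z\<^sup>2 \<le> 2 * (exp (- (real N * K)) * Z \<omega>)" .
      moreover have "(?p \<omega>)\<^sup>2 \<le> 2 * K\<^sup>2 + 2 * z\<^sup>2"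
      proof -
        have "(?p \<omega>)\<^sup>2 = (K + z)\<^sup>2" by (simp add: z_def)
        also have "\<dots> = 2 * K\<^sup>2 + 2 * z\<^sup>2 - (K - z)\<^sup>2" by (simp add: power2_eq_square algebra_simps)
        finally show ?thesis by simp
      qed
      moreover have "4 * exp (- (real N * K)) * Z \<omega> = 2 * (2 * (exp (- (real N * K)) * Z \<omega>))" by simp
      ultimately show ?thesis using nn(1) by linarith
    qed
  qed
  have Di: "integrable M ?D"
    using Zi facts(1)[OF s0] by (intro Bochner_Integration.integrable_add integrable_mult_right M.integrable_const)
  have pm: "?p \<in> borel_measurable M" by (rule free_energy_law(1)[OF M G])
  show int: "integrable M (\<lambda>\<omega>. (?p \<omega>)\<^sup>2)"
  proof (rule Bochner_Integration.integrable_bound[OF Di])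
    show "(\<lambda>\<omega>. (?p \<omega>)\<^sup>2) \<in> borel_measurable M" using pm by (rule borel_measurable_power)
    show "AE \<omega> in M. norm ((?p \<omega>)\<^sup>2) \<le> norm (?D \<omega>)"
      using order_trans[OF bound abs_ge_self] by simp
  qed
  have "(\<integral>\<omega>. (?p \<omega>)\<^sup>2 \<partial>M) \<le> (\<integral>\<omega>. ?D \<omega> \<partial>M)" using int Di bound by (rule integral_mono)
  also have "\<dots> = \<beta>\<^sup>2 * (\<integral>\<omega>. (G s0 \<omega>)\<^sup>2 \<partial>M) + 2 * K\<^sup>2 + 4 * exp (- (real N * K)) * (\<integral>\<omega>. Z \<omega> \<partial>M)"
    using Zi facts(1)[OF s0] by (simp add: M.prob_space)
  also have "\<dots> \<le> \<beta>\<^sup>2 + 2 * K\<^sup>2 + 4 * exp (- (real N * K)) * exp (real N * K)"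
    using EZr facts(2)[OF s0] by simp
  also have "\<dots> = \<beta>\<^sup>2 + 2 * K\<^sup>2 + 4" by (simp add: exp_minus)
  finally show "(\<integral>\<omega>. (?p \<omega>)\<^sup>2 \<partial>M) \<le> \<beta>\<^sup>2 + 2 * K\<^sup>2 + 4" .
qed

lemma free_energy_dev:
  assumes M: "prob_space M" and G: "is_GREM M n x q N G"
  shows "measure M {\<omega> \<in> space M. t < free_energy N G \<beta> h \<omega>} =
      measure P {\<omega> \<in> space P. real N * t < ln (Rsum wt sd 1 n \<omega>)}"
    and "measure M {\<omega> \<in> space M. free_energy N G \<beta> h \<omega> < t} =
      measure P {\<omega> \<in> space P. ln (Rsum wt sd 1 n \<omega>) < real N * t}"
proof -
  note law = free_energy_law[OF M G]
  have Np: "0 < real N" using N_pos by simp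
  have "measure (distr M borel (free_energy N G \<beta> h)) B = measure (distr P borel (\<lambda>\<omega>. ln (Rsum wt sd 1 n \<omega>) / real N)) B" for B
    using law(3) by simp
  then have *: "measure M (free_energy N G \<beta> h -` B \<inter> space M) =
     measure P ((\<lambda>\<omega>. ln (Rsum wt sd 1 n \<omega>) / real N) -` B \<inter> space P)" if "B \<in> sets borel" for B
    using that measure_distr[OF law(1) that] measure_distr[OF law(2) that] by simp
  have "free_energy N G \<beta> h -` {t<..} \<inter> space M = {\<omega> \<in> space M. t < free_energy N G \<beta> h \<omega>}"
    "(\<lambda>\<omega>. ln (Rsum wt sd 1 n \<omega>) / real N) -` {t<..} \<inter> space P = {\<omega> \<in> space P. real N * t < ln (Rsum wt sd 1 n \<omega>)}"
    using Np by (auto simp: field_simps)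
  then show "measure M {\<omega> \<in> space M. t < free_energy N G \<beta> h \<omega>} =
      measure P {\<omega> \<in> space P. real N * t < ln (Rsum wt sd 1 n \<omega>)}"
    using *[of "{t<..}"] by simp
  have "free_energy N G \<beta> h -` {..<t} \<inter> space M = {\<omega> \<in> space M. free_energy N G \<beta> h \<omega> < t}"
    "(\<lambda>\<omega>. ln (Rsum wt sd 1 n \<omega>) / real N) -` {..<t} \<inter> space P = {\<omega> \<in> space P. ln (Rsum wt sd 1 n \<omega>) < real N * t}"
    using Np by (auto simp: field_simps)
  then show "measure M {\<omega> \<in> space M. free_energy N G \<beta> h \<omega> < t} =
      measure P {\<omega> \<in> space P. ln (Rsum wt sd 1 n \<omega>) < real N * t}"
    using *[of "{..<t}"] by simp
qed

end

section \<open>From deviation bounds to almost sure and mean convergence\<close>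

locale grem_family = order_parameter n x q h + prob_space M
  for n x q h and M :: "'w measure" +
  fixes G :: "nat \<Rightarrow> (nat \<Rightarrow> real) \<Rightarrow> 'w \<Rightarrow> real" and \<beta> :: real
  assumes \<beta>: "0 < \<beta>" and G: "\<And>N. N \<in> admissible_sizes n x \<Longrightarrow> is_GREM M n x q N (G N)"
begin

abbreviation "adm \<equiv> admissible_sizes n x"
abbreviation "p N \<equiv> free_energy N (G N) \<beta> h"
abbreviation "W \<equiv> limit_free_energy n x q \<beta> h"
abbreviation "far \<epsilon> N \<equiv> {\<omega> \<in> space M. \<epsilon> < \<bar>p N \<omega> - W\<bar>}"

lemma upper_deviation:
  assumes \<epsilon>: "0 < \<epsilon>"
  shows "\<exists>c>0. \<forall>N\<in>adm.
    prob {\<omega> \<in> space M. W + \<epsilon> < p N \<omega>} \<le> real n * exp (- c * real N)"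
proof -
  obtain l where t: "tilts \<beta> n \<beta> l W" using tilts_exist[OF \<beta>] by blast
  have l: "0 < l k" if "k \<in> {1..n}" for k using t that unfolding tilts_def by auto
  define S where "S = (\<Sum>k=1..n. \<beta> / l k)"
  have S: "0 < S" unfolding S_def using l \<beta> n by (intro sum_pos) auto
  have "prob {\<omega> \<in> space M. W + \<epsilon> < p N \<omega>} \<le> real n * exp (- (\<epsilon> / S) * real N)"
    if N: "N \<in> adm" for N
  proof -
    interpret grem_level n x q h N \<beta> by unfold_locales (rule N \<beta>)+
    \<comment> \<open>A margin \<open>r\<close> on every level costs \<open>r * S\<close> in all, so
      this choice of \<open>r\<close> spends exactly \<open>N * \<epsilon>\<close>.\<close>
    have "real N * \<epsilon> / S * (\<Sum>k=1..n. \<beta> / l k) = real N * \<epsilon>" using S unfolding S_def[symmetric] by simp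
    then show ?thesis
      unfolding free_energy_dev(1)[OF prob_space_axioms G[OF N]] using upper_dev[OF t, of "real N * \<epsilon> / S"]
      by (simp add: distrib_left mult.commute)
  qed
  then show ?thesis using S \<epsilon> by (intro exI[of _ "\<epsilon> / S"]) auto
qed

text \<open>Partial entropies may vanish at the optimal tilts, and then the second moment bound is
  not exponentially small. Shrinking all tilts by \<open>1 - d\<close> makes every partial sum
  strictly positive because \<open>excess\<close> strictly decreases, while continuity keeps the
  value within \<open>\<epsilon> / 4\<close> of \<open>W\<close>.\<close>

lemma lower_deviation:
  assumes \<epsilon>: "0 < \<epsilon>"
  shows "\<exists>c>0. \<forall>\<^sub>F N in sequentially. N \<in> adm \<longrightarrow>
    prob {\<omega> \<in> space M. p N \<omega> < W - \<epsilon>} \<le> 4 * real n * exp (- c * real N)"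
proof -
  obtain l where t: "tilts \<beta> n \<beta> l W" using tilts_exist[OF \<beta>] by blast
  have l: "0 < l k" "l k \<le> \<beta>" if "k \<in> {1..n}" for k using t that unfolding tilts_def by auto
  have cum: "0 \<le> (\<Sum>j=1..k. excess j j (l j))" if "k \<le> n" for k using t that unfolding tilts_def by blast
  have W: "(\<Sum>j=1..n. excess j j (l j) + \<beta> * gain j j (l j)) = W" using t unfolding tilts_def by blast
  define V' where "V' d = (\<Sum>j=1..n. excess j j ((1 - d) * l j) + \<beta> * gain j j ((1 - d) * l j))" for d
  have cont: "continuous_on UNIV V'"
    unfolding V'_def excess_def gain_def by (intro continuous_intros) (auto simp: cosh_real_nonzero)
  then have "(V' \<longlongrightarrow> V' 0) (at_right 0)"
    unfolding continuous_on_def using tendsto_within_subset by blast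
  moreover have "V' 0 = W" using W by (simp add: V'_def)
  ultimately have "\<forall>\<^sub>F d in at_right 0. W - \<epsilon> / 4 < V' d" using \<epsilon> by (intro order_tendstoD(1)) auto
  moreover have "\<forall>\<^sub>F d in at_right (0::real). d \<in> {0<..<1}" by (rule eventually_at_right_real) simp
  ultimately have "\<forall>\<^sub>F d in at_right 0. W - \<epsilon> / 4 < V' d \<and> d \<in> {0<..<1}" by (rule eventually_conj)
  then obtain d where d: "W - \<epsilon> / 4 < V' d" "0 < d" "d < 1"
    using eventually_happens[of _ "at_right (0::real)"] by (auto simp: trivial_limit_at_right_real)
  define l' where "l' k = (1 - d) * l k" for k
  have l': "0 < l' k \<and> l' k \<le> \<beta>" "l' k < l k" if k: "k \<in> {1..n}" for k
  proof -
    show *: "l' k < l k" using d l[OF k] by (simp add: l'_def algebra_simps)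
    have "0 < l' k" using d l[OF k] by (simp add: l'_def)
    with * show "0 < l' k \<and> l' k \<le> \<beta>" using l[OF k] by simp
  qed
  have cum': "0 < (\<Sum>j=1..k. excess j j (l' j))" if k: "k \<in> {1..n}" for k
  proof -
    have "(\<Sum>j=1..k. excess j j (l j)) < (\<Sum>j=1..k. excess j j (l' j))"
      using k l' by (intro sum_strict_mono excess_strict) (auto simp: less_imp_le)
    then show ?thesis using cum[of k] k by simp
  qed
  define \<kappa> where "\<kappa> = Min ((\<lambda>k. \<Sum>j=1..k. excess j j (l' j)) ` {1..n})"
  have \<kappa>: "0 < \<kappa>" unfolding \<kappa>_def using cum' n by (subst Min_gr_iff) auto
  have \<kappa>_le: "\<kappa> \<le> (\<Sum>j=1..k. excess j j (l' j))" if "k \<in> {1..n}" for k unfolding \<kappa>_def using that by simp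
  \<comment> \<open>One \<open>\<tau>\<close> pays for the magnetization window and another for
    \<open>R N + ln 2\<close>. With the \<open>\<epsilon> / 4\<close> spent on \<open>d\<close> this
    stays within \<open>\<epsilon>\<close>, and the bound by \<open>\<kappa> / 4\<close> leaves at
    least \<open>\<kappa> / 2\<close> in the exponent.\<close>
  define \<tau> where "\<tau> = min (\<epsilon> / 4) (\<kappa> / 4)"
  have \<tau>: "0 < \<tau>" "\<tau> \<le> \<epsilon> / 4" "\<tau> \<le> \<kappa> / 4" using \<epsilon> \<kappa> by (auto simp: \<tau>_def)
  define A where "A = 2 * real n * \<beta> * h"
  have A: "0 \<le> A" using \<beta> h by (simp add: A_def)
  \<comment> \<open>The \<open>+ 1\<close> keeps the denominator positive when
    \<open>h = 0\<close>.\<close>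
  define \<eta> where "\<eta> = \<tau> / (A + 1)"
  have \<eta>: "0 < \<eta>" "A * \<eta> \<le> \<tau>" using \<tau> A by (auto simp: \<eta>_def field_simps)
  define R where "R N = real n * (sqrt (real N) * \<beta> + 4)" for N :: nat
  have dx: "0 < x k - x (k - 1)" if "k \<in> {1..n}" for k using x_strict[of "k - 1" k] that by auto
  have ev1: "\<forall>\<^sub>F N in sequentially. \<forall>k\<in>{1..n}. 2 / \<eta>\<^sup>2 \<le> (x k - x (k - 1)) * real N"
  proof (intro eventually_ball_finite ballI)
    fix k assume k: "k \<in> {1..n}"
    have "\<forall>\<^sub>F N in sequentially. 2 / \<eta>\<^sup>2 / (x k - x (k - 1)) \<le> real N"
      using filterlim_real_sequentially unfolding filterlim_at_top by blast
    then show "\<forall>\<^sub>F N in sequentially. 2 / \<eta>\<^sup>2 \<le> (x k - x (k - 1)) * real N"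
      by eventually_elim (simp only: pos_divide_le_eq[OF dx[OF k]] mult.commute)
  qed simp
  have ev2: "\<forall>\<^sub>F N in sequentially. R N + ln 2 \<le> real N * \<tau>"
  proof -
    have "(\<lambda>N. (R N + ln 2) / real N) \<longlonglongrightarrow> 0" unfolding R_def by real_asymp
    then have "\<forall>\<^sub>F N in sequentially. (R N + ln 2) / real N < \<tau>" using \<tau>(1) by (rule order_tendstoD(2))
    with eventually_gt_at_top[of 0] show ?thesis
      by eventually_elim (simp add: divide_less_eq mult.commute)
  qed
  from ev1 ev2 have "\<forall>\<^sub>F N in sequentially. N \<in> adm \<longrightarrow>
    prob {\<omega> \<in> space M. p N \<omega> < W - \<epsilon>} \<le> 4 * real n * exp (- (\<kappa> / 2) * real N)"
  proof (eventually_elim, intro impI)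
    fix N assume large: "\<forall>k\<in>{1..n}. 2 / \<eta>\<^sup>2 \<le> (x k - x (k - 1)) * real N"
      and R: "R N + ln 2 \<le> real N * \<tau>" and N: "N \<in> adm"
    interpret grem_level n x q h N \<beta> by unfold_locales (rule N \<beta>)+
    interpret P: prob_space "P" by (rule prob_space_gauss)
    let ?t = "real N * ((\<Sum>k=1..n. excess k k (l' k) + \<beta> * gain k k (l' k)) - 2 * real n * \<beta> * h * \<eta>) - R N - ln 2"
    have "real N * (W - \<epsilon>) \<le> ?t"
    proof -
      have "real N * (W - \<epsilon>) + real N * \<tau> \<le> real N * (V' d - A * \<eta>)"
        unfolding distrib_left[symmetric] using d(1) \<tau> \<eta>(2) by (intro mult_left_mono) auto
      then show ?thesis using R by (simp add: V'_def l'_def A_def)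
    qed
    then have "measure P {\<omega> \<in> space P. ln (Rsum wt sd 1 n \<omega>) < real N * (W - \<epsilon>)}
      \<le> measure P {\<omega> \<in> space P. ln (Rsum wt sd 1 n \<omega>) < ?t}"
    proof (intro P.finite_measure_mono)
      have [measurable]: "Rsum wt sd 1 n \<in> borel_measurable P" by (rule Rsum_measurable) simp
      show "{\<omega> \<in> space P. ln (Rsum wt sd 1 n \<omega>) < ?t} \<in> P.events" by measurable
    qed auto
    also have "\<dots> \<le> 4 * (\<Sum>k=1..n. exp (- (real N * ((\<Sum>j=1..k. excess j j (l' j)) - real n * \<beta> * h * \<eta>) - R N)))"
      unfolding R_def using l'(1) \<eta>(1) large by (intro lower_dev) auto
    also have "\<dots> \<le> 4 * (\<Sum>k=1..n. exp (- (\<kappa> / 2) * real N))"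
    proof (intro mult_left_mono sum_mono)
      fix k assume k: "k \<in> {1..n}"
      have "real n * \<beta> * h * \<eta> \<le> \<kappa> / 4" using \<eta> \<tau> A \<beta> h by (simp add: A_def)
      then have "real N * (\<kappa> / 2) + real N * \<tau> \<le> real N * ((\<Sum>j=1..k. excess j j (l' j)) - real n * \<beta> * h * \<eta>)"
        unfolding distrib_left[symmetric] using \<kappa>_le[OF k] \<tau> by (intro mult_left_mono) auto
      then show "exp (- (real N * ((\<Sum>j=1..k. excess j j (l' j)) - real n * \<beta> * h * \<eta>) - R N)) \<le> exp (- (\<kappa> / 2) * real N)"
      proof -
        assume *: "real N * (\<kappa> / 2) + real N * \<tau> \<le> real N * ((\<Sum>j=1..k. excess j j (l' j)) - real n * \<beta> * h * \<eta>)"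
        have "(0::real) \<le> ln 2" by simp
        moreover have "- (\<kappa> / 2) * real N = - (real N * (\<kappa> / 2))" by simp
        ultimately show ?thesis unfolding exp_le_cancel_iff using R * by linarith
      qed
    qed simp
    finally show "prob {\<omega> \<in> space M. p N \<omega> < W - \<epsilon>} \<le> 4 * real n * exp (- (\<kappa> / 2) * real N)"
      unfolding free_energy_dev(2)[OF prob_space_axioms G[OF N]] by simp
  qed
  then show ?thesis using \<kappa> by (intro exI[of _ "\<kappa> / 2"]) auto
qed

lemma two_sided_deviation:
  assumes \<epsilon>: "0 < \<epsilon>"
  shows "\<exists>c>0. \<forall>\<^sub>F N in sequentially. N \<in> adm \<longrightarrow>
    prob (far \<epsilon> N) \<le> 5 * real n * exp (- c * real N)"
proof -
  obtain c1 where c1: "0 < c1" "\<forall>N\<in>adm.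
    prob {\<omega> \<in> space M. W + \<epsilon> < p N \<omega>} \<le> real n * exp (- c1 * real N)"
    using upper_deviation[OF \<epsilon>] by blast
  obtain c2 where c2: "0 < c2" "\<forall>\<^sub>F N in sequentially. N \<in> adm \<longrightarrow>
    prob {\<omega> \<in> space M. p N \<omega> < W - \<epsilon>} \<le> 4 * real n * exp (- c2 * real N)"
    using lower_deviation[OF \<epsilon>] by blast
  define c where "c = min c1 c2"
  from c2(2) have "\<forall>\<^sub>F N in sequentially. N \<in> adm \<longrightarrow>
    prob (far \<epsilon> N) \<le> 5 * real n * exp (- c * real N)"
  proof (eventually_elim, intro impI)
    fix N assume lo: "N \<in> adm \<longrightarrow>
      prob {\<omega> \<in> space M. p N \<omega> < W - \<epsilon>} \<le> 4 * real n * exp (- c2 * real N)"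
      and N: "N \<in> adm"
    interpret grem_level n x q h N \<beta> by unfold_locales (rule N \<beta>)+
    have [measurable]: "p N \<in> borel_measurable M" by (rule free_energy_law(1)[OF prob_space_axioms G[OF N]])
    have "(far \<epsilon> N) =
      {\<omega> \<in> space M. W + \<epsilon> < p N \<omega>} \<union> {\<omega> \<in> space M. p N \<omega> < W - \<epsilon>}"
      by auto
    then have "prob (far \<epsilon> N) \<le>
      prob {\<omega> \<in> space M. W + \<epsilon> < p N \<omega>} + prob {\<omega> \<in> space M. p N \<omega> < W - \<epsilon>}"
      by (simp only:) (intro measure_Un_le; measurable)
    also have "\<dots> \<le> real n * exp (- c1 * real N) + 4 * real n * exp (- c2 * real N)"
      using lo c1(2) N by (intro add_mono) auto
    also have "\<dots> \<le> real n * exp (- c * real N) + 4 * real n * exp (- c * real N)"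
      by (intro add_mono mult_left_mono) (auto simp: c_def intro!: mult_right_mono)
    finally show "prob (far \<epsilon> N) \<le> 5 * real n * exp (- c * real N)" by simp
  qed
  then show ?thesis using c1 c2 by (intro exI[of _ c]) (auto simp: c_def)
qed

lemma eventually_admissible:
  "eventually P (admissible_at_top n x) \<longleftrightarrow> (\<forall>\<^sub>F N in sequentially. N \<in> adm \<longrightarrow> P N)"
  by (simp add: admissible_at_top_def eventually_inf_principal)

lemma free_energy_AE:
  shows "AE \<omega> in M. ((\<lambda>N. p N \<omega>) \<longlongrightarrow> W) (admissible_at_top n x)"
proof -
  have ae: "AE \<omega> in M. \<forall>\<^sub>F N in sequentially. N \<in> adm \<longrightarrow> \<bar>p N \<omega> - W\<bar> \<le> \<epsilon>"
    if \<epsilon>: "0 < \<epsilon>" for \<epsilon>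
  proof -
    obtain c where c: "0 < c" "\<forall>\<^sub>F N in sequentially. N \<in> adm \<longrightarrow>
      prob (far \<epsilon> N) \<le> 5 * real n * exp (- c * real N)"
      using two_sided_deviation[OF \<epsilon>] by blast
    \<comment> \<open>Empty events at inadmissible sizes let Borel-Cantelli run over all natural
      numbers.\<close>
    define A where "A N = (if N \<in> adm then (far \<epsilon> N) else {})" for N
    have A: "A N \<in> events" for N
    proof (cases "N \<in> adm")
      case True
      interpret grem_level n x q h N \<beta> by unfold_locales (rule True \<beta>)+
      have [measurable]: "p N \<in> borel_measurable M" by (rule free_energy_law(1)[OF prob_space_axioms G[OF True]])
      show ?thesis unfolding A_def using True by simp
    qed (simp add: A_def)
    have "summable (\<lambda>N. prob (A N))"
    proof (rule summable_comparison_test_ev)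
      show "\<forall>\<^sub>F N in sequentially. norm (prob (A N)) \<le> 5 * real n * exp (- c) ^ N"
        using c(2) by eventually_elim (auto simp: A_def exp_of_nat_mult[symmetric] mult.commute)
      show "summable (\<lambda>N. 5 * real n * exp (- c) ^ N)" using c(1) by (intro summable_mult summable_geometric) simp
    qed
    then have "AE \<omega> in M. \<forall>\<^sub>F N in sequentially. \<omega> \<in> space M - A N"
      using A emeasure_finite by (intro borel_cantelli_AE1) (auto simp: less_top[symmetric])
    then show ?thesis
    proof eventually_elim
      case (elim \<omega>)
      then show ?case by eventually_elim (auto simp: A_def)
    qed
  qed
  \<comment> \<open>The exceptional null set depends on the accuracy, so the accuracy is restricted
    to a countable sequence.\<close>
  have "AE \<omega> in M. \<forall>j. \<forall>\<^sub>F N in sequentially. N \<in> adm \<longrightarrow> \<bar>p N \<omega> - W\<bar> \<le> 1 / real (Suc j)"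
    unfolding AE_all_countable using ae by simp
  then show ?thesis
  proof eventually_elim
    case (elim \<omega>)
    show ?case
    proof (rule tendstoI)
      fix e :: real assume "0 < e"
      then obtain j where "inverse (real (Suc j)) < e" using reals_Archimedean by blast
      then have "1 / real (Suc j) < e" by (simp add: inverse_eq_divide)
      moreover have "\<forall>\<^sub>F N in sequentially. N \<in> adm \<longrightarrow> \<bar>p N \<omega> - W\<bar> \<le> 1 / real (Suc j)"
        using elim by blast
      ultimately show "\<forall>\<^sub>F N in admissible_at_top n x. dist (p N \<omega>) W < e"
        unfolding eventually_admissible
        by (elim eventually_mono) (auto simp: dist_real_def)
    qed
  qed
qed

text \<open>Off the far event the error is at most \<open>\<epsilon>\<close>. On it
  \<open>z \<le> r * z^2 + 1 / r\<close> for the error \<open>z\<close>, so a small \<open>r\<close>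
  multiplies the bounded second moment and \<open>1 / r\<close> the exponentially small
  probability.\<close>

lemma free_energy_L1:
  shows "\<forall>N\<in>adm. integrable M (p N)"
    and "((\<lambda>N. \<integral>\<omega>. \<bar>p N \<omega> - W\<bar> \<partial>M) \<longlongrightarrow> 0) (admissible_at_top n x)"
proof -
  define C where "C = \<beta>\<^sup>2 + 2 * (ln 2 + \<beta> * h + \<beta>\<^sup>2 / 2)\<^sup>2 + 4"
  have pm: "p N \<in> borel_measurable M" and p2: "integrable M (\<lambda>\<omega>. (p N \<omega>)\<^sup>2)" and pC: "(\<integral>\<omega>. (p N \<omega>)\<^sup>2 \<partial>M) \<le> C"
    if N: "N \<in> adm" for N
  proof -
    interpret grem_level n x q h N \<beta> by unfold_locales (rule N \<beta>)+
    show "p N \<in> borel_measurable M" "integrable M (\<lambda>\<omega>. (p N \<omega>)\<^sup>2)" "(\<integral>\<omega>. (p N \<omega>)\<^sup>2 \<partial>M) \<le> C"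
      unfolding C_def using free_energy_law(1)[OF prob_space_axioms G[OF N]] free_energy_second_moment[OF prob_space_axioms G[OF N]] by auto
  qed
  have pint: "integrable M (p N)" if N: "N \<in> adm" for N
    using pm[OF N] p2[OF N] by (rule square_integrable_imp_integrable)
  then show "\<forall>N\<in>adm. integrable M (p N)" by blast
  define D where "D = 2 * C + 2 * W\<^sup>2"
  have "0 \<le> C" by (simp add: C_def)
  then have D0: "0 \<le> D" by (simp add: D_def)
  have bound: "(\<integral>\<omega>. \<bar>p N \<omega> - W\<bar> \<partial>M) \<le> \<epsilon> + r * D + prob (far \<epsilon> N) / r"
    if N: "N \<in> adm" and e: "0 < \<epsilon>" "0 < r" for N \<epsilon> r
  proof -
    let ?A = "(far \<epsilon> N)"
    have [measurable]: "p N \<in> borel_measurable M" by (rule pm[OF N])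
    have A: "?A \<in> events" by measurable
    have pt: "\<bar>p N \<omega> - W\<bar> \<le> \<epsilon> + r * (2 * (p N \<omega>)\<^sup>2 + 2 * W\<^sup>2) + indicator ?A \<omega> / r" if w: "\<omega> \<in> space M" for \<omega>
    proof (cases "\<omega> \<in> ?A")
      case True
      define z where "z = \<bar>p N \<omega> - W\<bar>"
      have "2 * (r * z) * 1 \<le> (r * z)\<^sup>2 + 1\<^sup>2" by (rule sum_squares_bound)
      moreover have "0 \<le> r * z" using e by (simp add: z_def)
      moreover have "(r * z)\<^sup>2 = r * (r * z\<^sup>2)" by (simp add: power2_eq_square)
      ultimately have "r * z \<le> r * (r * z\<^sup>2) + 1" by simp
      also have "\<dots> = r * (r * z\<^sup>2 + 1 / r)" using e by (simp add: distrib_left)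
      finally have "z \<le> r * z\<^sup>2 + 1 / r" using e(2) by (rule mult_left_le_imp_le)
      moreover have "z\<^sup>2 \<le> 2 * (p N \<omega>)\<^sup>2 + 2 * W\<^sup>2"
      proof -
        have "z\<^sup>2 = 2 * (p N \<omega>)\<^sup>2 + 2 * W\<^sup>2 - (p N \<omega> + W)\<^sup>2" by (simp add: z_def power2_eq_square algebra_simps)
        then show ?thesis by simp
      qed
      then have "r * z\<^sup>2 \<le> r * (2 * (p N \<omega>)\<^sup>2 + 2 * W\<^sup>2)" using e by (intro mult_left_mono) auto
      ultimately have "z \<le> r * (2 * (p N \<omega>)\<^sup>2 + 2 * W\<^sup>2) + 1 / r" by linarith
      moreover have I: "indicat_real ?A \<omega> = 1" using True by (rule indicator_simps(1))
      ultimately show ?thesis unfolding I z_def[symmetric] using e by linarith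
    next
      case False
      then show ?thesis using w e by (auto simp: not_less intro!: add_increasing2 mult_nonneg_nonneg)
    qed
    have i1: "integrable M (\<lambda>\<omega>. \<bar>p N \<omega> - W\<bar>)" using pint[OF N] by (intro integrable_abs Bochner_Integration.integrable_diff) auto
    have ind: "integrable M (indicat_real ?A)" using A by (intro integrable_real_indicator) (auto simp: less_top[symmetric])
    have i2: "integrable M (\<lambda>\<omega>. \<epsilon> + r * (2 * (p N \<omega>)\<^sup>2 + 2 * W\<^sup>2) + indicator ?A \<omega> / r)"
      using p2[OF N] ind by (intro Bochner_Integration.integrable_add integrable_mult_right integrable_divide) auto
    have "(\<integral>\<omega>. \<bar>p N \<omega> - W\<bar> \<partial>M) \<le> (\<integral>\<omega>. \<epsilon> + r * (2 * (p N \<omega>)\<^sup>2 + 2 * W\<^sup>2) + indicator ?A \<omega> / r \<partial>M)"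
      using i1 i2 pt by (rule integral_mono)
    also have "\<dots> = \<epsilon> + r * (2 * (\<integral>\<omega>. (p N \<omega>)\<^sup>2 \<partial>M) + 2 * W\<^sup>2) + prob ?A / r"
      using p2[OF N] ind A by (simp add: prob_space)
    also have "\<dots> \<le> \<epsilon> + r * D + prob ?A / r"
      using pC[OF N] e by (intro add_mono mult_left_mono) (auto simp: D_def)
    finally show ?thesis .
  qed
  show "((\<lambda>N. \<integral>\<omega>. \<bar>p N \<omega> - W\<bar> \<partial>M) \<longlongrightarrow> 0) (admissible_at_top n x)"
  proof (rule tendstoI)
    fix e :: real assume e: "0 < e"
    \<comment> \<open>\<open>r\<close> is fixed first, making the second moment term small uniformly
      in \<open>N\<close>; only then is \<open>N\<close> taken so large that the probability falls
      below \<open>r * (e / 4)\<close>.\<close>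
    define r where "r = e / (4 * (D + 1))"
    have r: "0 < r" "r * D \<le> e / 4" using e D0 by (auto simp: r_def field_simps)
    have e4: "0 < e / 4" using e by simp
    obtain c where c: "0 < c" "\<forall>\<^sub>F N in sequentially. N \<in> adm \<longrightarrow>
      prob (far (e / 4) N) \<le> 5 * real n * exp (- c * real N)"
      using two_sided_deviation[OF e4] by blast
    have "(\<lambda>N. 5 * real n * exp (- c * real N)) \<longlonglongrightarrow> 0" using c(1) by real_asymp
    then have "\<forall>\<^sub>F N in sequentially. 5 * real n * exp (- c * real N) < r * (e / 4)"
      using r(1) e by (intro order_tendstoD(2)) auto
    with c(2) show "\<forall>\<^sub>F N in admissible_at_top n x. dist (\<integral>\<omega>. \<bar>p N \<omega> - W\<bar> \<partial>M) 0 < e"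
      unfolding eventually_admissible
    proof (eventually_elim, intro impI)
      fix N assume *: "N \<in> adm \<longrightarrow> prob (far (e / 4) N) \<le> 5 * real n * exp (- c * real N)"
        "5 * real n * exp (- c * real N) < r * (e / 4)" and N: "N \<in> adm"
      have "prob (far (e / 4) N) / r < e / 4"
      proof -
        have "prob (far (e / 4) N) < r * (e / 4)"
          using *(1)[rule_format, OF N] *(2) by (rule le_less_trans)
        then show ?thesis by (simp only: pos_divide_less_eq[OF r(1)] mult.commute)
      qed
      then have "(\<integral>\<omega>. \<bar>p N \<omega> - W\<bar> \<partial>M) < e"
        using bound[OF N e4 r(1)] r(2) e4 by linarith
      moreover have "0 \<le> (\<integral>\<omega>. \<bar>p N \<omega> - W\<bar> \<partial>M)" by simp
      ultimately show "dist (\<integral>\<omega>. \<bar>p N \<omega> - W\<bar> \<partial>M) 0 < e" by (simp add: dist_real_def)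
    qed
  qed
qed

end

theorem theorem1p4:
  fixes M :: "'w measure"
    and G :: "nat \<Rightarrow> (nat \<Rightarrow> real) \<Rightarrow> 'w \<Rightarrow> real"
    and n :: nat and x q :: "nat \<Rightarrow> real" and \<beta> h :: real
  assumes "prob_space M"
    and "n \<ge> 1"
    and "x 0 = 0" and "x n = 1" and "\<And>k. k < n \<Longrightarrow> x k < x (Suc k)"
    and "q 0 = 0" and "q n = 1" and "\<And>k. k < n \<Longrightarrow> q k < q (Suc k)"
    and "h \<ge> 0" and "\<beta> > 0"
    and "\<And>N. N \<in> admissible_sizes n x \<Longrightarrow> is_GREM M n x q N (G N)"
  shows "(AE \<omega> in M. ((\<lambda>N. free_energy N (G N) \<beta> h \<omega>) \<longlongrightarrow> limit_free_energy n x q \<beta> h)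
                        (admissible_at_top n x))
    \<and> (\<forall>N \<in> admissible_sizes n x. integrable M (free_energy N (G N) \<beta> h))
    \<and> ((\<lambda>N. \<integral>\<omega>. \<bar>free_energy N (G N) \<beta> h \<omega> - limit_free_energy n x q \<beta> h\<bar> \<partial>M) \<longlongrightarrow> 0)
         (admissible_at_top n x)"
proof -
  interpret prob_space M by fact
  interpret grem_family n x q h M G \<beta> by unfold_locales (use assms in auto)
  show ?thesis using free_energy_AE free_energy_L1 by blast
qed

end
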